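(* There exist infinitely many real quadratic fields and infinitely many imaginary quadratic fields $K$ whose ideal class group has an element of order $4$ and for which there is an integer $t$ with $t\equiv -13,\ -7$ or $11 \pmod{30}$ such that $K=\mathbb{Q}(\sqrt{t(t-4)(4t+9)})$ and the corresponding portion of the Hilbert class field of $K$ is generated by $x^4-x^3-tx^2-x+1$; that is, the splitting field over $K$ of $$x^4-x^3-tx^2-x+1$$ is an unramified cyclic extension of $K$ of degree $4$.
   Context: Unramified means unramified at all places, finite and infinite. *)

theory Defs
  imports
    "HOL-Algebra.Algebra"
    "HOL-Algebra.Algebraic_Closure_Type"
    "HOL-Number_Theory.Cong"
    "HOL.Complex"
begin

text \<open>
  Number fields are taken to be subfields of \<open>\<complex>\<close>. Distinct quadratic subfields of \<open>\<complex>\<close> are not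
  isomorphic, so counting quadratic fields as subsets of \<open>\<complex>\<close> counts isomorphism classes.
\<close>

abbreviation complex_field :: "complex ring" where
  "complex_field \<equiv> ring_of_type_algebra"

abbreviation subfield_ring :: "complex set \<Rightarrow> complex ring" where
  "subfield_ring K \<equiv> complex_field\<lparr>carrier := K\<rparr>"

definition quadratic_field :: "complex set \<Rightarrow> bool" where
  "quadratic_field K \<longleftrightarrow> subfield K complex_field \<and> ring.dimension complex_field 2 \<rat> K"

definition real_quadratic_field :: "complex set \<Rightarrow> bool" where
  "real_quadratic_field K \<longleftrightarrow> quadratic_field K \<and> K \<subseteq> \<real>"

definition imaginary_quadratic_field :: "complex set \<Rightarrow> bool" where
  "imaginary_quadratic_field K \<longleftrightarrow> quadratic_field K \<and> \<not> K \<subseteq> \<real>"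

definition splitting_field :: "complex set \<Rightarrow> complex poly \<Rightarrow> complex set" where
  "splitting_field K f = generate_field complex_field (K \<union> {z. poly f z = 0})"

definition ring_of_integers :: "complex set \<Rightarrow> complex ring" where
  "ring_of_integers K = complex_field\<lparr>carrier := {x \<in> K. algebraic_int x}\<rparr>"


section \<open>Ideal class group\<close>

definition fractional_ideal :: "complex set \<Rightarrow> complex set \<Rightarrow> bool" where
  "fractional_ideal K I \<longleftrightarrow>
     (\<exists>J d. ideal J (ring_of_integers K) \<and> J \<noteq> {0} \<and>
            d \<in> carrier (ring_of_integers K) \<and> d \<noteq> 0 \<and> I = (\<lambda>x. x / d) ` J)"

text \<open>
  The product of two fractional ideals is the set of finite sums of products, formed in \<open>\<complex>\<close>.
\<close>

definition fractional_ideal_group :: "complex set \<Rightarrow> complex set monoid" where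
  "fractional_ideal_group K =
     \<lparr>carrier = {I. fractional_ideal K I},
      monoid.mult = ideal_prod complex_field,
      one = carrier (ring_of_integers K)\<rparr>"

definition principal_fractional_ideals :: "complex set \<Rightarrow> complex set set" where
  "principal_fractional_ideals K =
     {(\<lambda>x. a * x) ` carrier (ring_of_integers K) | a. a \<in> K \<and> a \<noteq> 0}"

definition ideal_class_group :: "complex set \<Rightarrow> complex set set monoid" where
  "ideal_class_group K = fractional_ideal_group K Mod principal_fractional_ideals K"


section \<open>Cyclic extensions\<close>

definition galois_group :: "complex set \<Rightarrow> complex set \<Rightarrow> (complex \<Rightarrow> complex) monoid" where
  "galois_group K L = (BijGroup L)
     \<lparr>carrier := {\<sigma> \<in> Bij L. \<sigma> \<in> ring_hom (subfield_ring L) (subfield_ring L) \<and> (\<forall>x\<in>K. \<sigma> x = x)}\<rparr>"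

definition galois_extension :: "complex set \<Rightarrow> complex set \<Rightarrow> bool" where
  "galois_extension K L \<longleftrightarrow>
     subfield K complex_field \<and> subfield L complex_field \<and> K \<subseteq> L \<and>
     ring.finite_dimension complex_field K L \<and>
     {x \<in> L. \<forall>\<sigma> \<in> carrier (galois_group K L). \<sigma> x = x} = K"

definition cyclic_extension :: "complex set \<Rightarrow> complex set \<Rightarrow> bool" where
  "cyclic_extension K L \<longleftrightarrow> galois_extension K L \<and> cyclic_group (galois_group K L)"


section \<open>Ramification\<close>

text \<open>
  The exponent of the prime \<open>Q\<close> of \<open>L\<close> in the factorization of the extension of the prime \<open>P\<close>
  to the ring of integers of \<open>L\<close>.
\<close>

definition ramification_index :: "complex set \<Rightarrow> complex set \<Rightarrow> complex set \<Rightarrow> nat" where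
  "ramification_index L P Q =
     (GREATEST e. Idl\<^bsub>ring_of_integers L\<^esub> P \<subseteq> Q [^]\<^bsub>ideals_set (ring_of_integers L)\<^esub> e)"

definition unramified_at_finite_places :: "complex set \<Rightarrow> complex set \<Rightarrow> bool" where
  "unramified_at_finite_places K L \<longleftrightarrow>
     (\<forall>P Q. primeideal P (ring_of_integers K) \<and> P \<noteq> {0} \<and>
            primeideal Q (ring_of_integers L) \<and> Q \<inter> K = P \<longrightarrow> ramification_index L P Q = 1)"

text \<open>
  An infinite place is a conjugate pair of embeddings into \<open>\<complex>\<close>; it ramifies if it is complex and
  lies over a real place.
\<close>

definition unramified_at_infinite_places :: "complex set \<Rightarrow> complex set \<Rightarrow> bool" where
  "unramified_at_infinite_places K L \<longleftrightarrow>
     (\<forall>\<tau> \<in> ring_hom (subfield_ring L) complex_field. \<tau> ` K \<subseteq> \<real> \<longrightarrow> \<tau> ` L \<subseteq> \<real>)"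

definition unramified_extension :: "complex set \<Rightarrow> complex set \<Rightarrow> bool" where
  "unramified_extension K L \<longleftrightarrow>
     unramified_at_finite_places K L \<and> unramified_at_infinite_places K L"

definition unramified_cyclic_extension_of_degree :: "nat \<Rightarrow> complex set \<Rightarrow> complex set \<Rightarrow> bool" where
  "unramified_cyclic_extension_of_degree n K L \<longleftrightarrow>
     cyclic_extension K L \<and> ring.dimension complex_field n K L \<and> unramified_extension K L"

end

theory Submission
  imports Defs "Jordan_Normal_Form.Char_Poly" "HOL-Number_Theory.Number_Theory"
begin

text \<open>
  Put \<open>s\<^sup>2 = 4 t + 9\<close> and \<open>g\<^sup>2 = t (t - 4)\<close>, so that \<open>K = \<rat>(s g)\<close>. The substitution \<open>y = x + 1/x\<close> splits
  the quartic over \<open>M = K(s)\<close> into \<open>x\<^sup>2 - y\<^sub>i x + 1\<close> with \<open>y\<^sub>i = (1 \<plusminus> s) / 2\<close>, and the square roots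
  \<open>\<rho>\<^sub>1\<close>, \<open>\<rho>\<^sub>2\<close> of the discriminants satisfy \<open>\<rho>\<^sub>1 \<rho>\<^sub>2 = g\<close>. Hence \<open>s \<mapsto> - s\<close> extends to an automorphism
  \<open>\<rho>\<^sub>1 \<mapsto> \<rho>\<^sub>2 \<mapsto> - \<rho>\<^sub>1\<close> of order 4 of \<open>L = M(\<rho>\<^sub>1)\<close>. Because \<open>4 t + 9\<close> and \<open>t (t - 4)\<close> are coprime, at
  every prime \<open>M/K\<close> and \<open>L/M\<close> are generated by a quadratic polynomial with unit discriminant; so a
  prime \<open>Q\<close> of \<open>L\<close> is locally generated by \<open>Q \<inter> K\<close>, and Nakayama's lemma gives ramification index 1.

  For the class group no class field theory is needed. The prime \<open>I = (3, 1 + \<surd>D)\<close> splits in \<open>K\<close> and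
  is inert in \<open>M\<close>. If \<open>I ^ 2 k\<close> is principal with \<open>k\<close> odd, a generator of trace \<open>a\<close> gives
  \<open>a\<^sup>2 \<minusplus> 4 \<cdot> 9 ^ k = D v\<^sup>2\<close>. With \<open>4 t + 9 = \<delta> w\<^sup>2\<close>, where \<open>q = \<bar>\<delta>\<bar>\<close> is prime, and the upper sign, each prime of odd
  multiplicity in the factor \<open>a + 2 \<cdot> 3 ^ k\<close> or \<open>a - 2 \<cdot> 3 ^ k\<close> that is prime to \<open>q\<close> divides \<open>t (t - 4)\<close>,
  so it is a square modulo \<open>q\<close> by quadratic reciprocity; but that factor is \<open>\<plusminus> 4 \<cdot> 3 ^ k\<close> modulo \<open>q\<close>,
  and 3 is not a square modulo \<open>q\<close>. The lower sign is excluded by size if \<open>D < 0\<close>, and by a prime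
  congruent to 3 modulo 4 dividing \<open>t\<close> to an odd power if \<open>D > 0\<close>. So the class of \<open>I\<close> has order
  divisible by 4. The choices \<open>\<delta> = 29\<close> and \<open>\<delta> = - 19\<close> give the real and the imaginary fields.
\<close>

text \<open>The obstacle is to bound the order of an ideal class from below. The residue argument
  needs a single modulus q at which 3 is a nonresidue, so \<open>4 * t + 9\<close> is kept in a
  fixed square class \<delta>, and \<open>t\<close> becomes a quadratic function of
  \<open>w\<close>. As \<open>4 * t + 9\<close> is 5 modulo 8 and \<open>t\<close> is 2 modulo 3,
  \<delta> has to be 5 modulo 8 and 2 modulo 3. Both 29 and -19 satisfy this and are q with the sign
  that makes it 1 modulo 4, for which reciprocity carries no sign. Ramification is treated without
  unique factorization of ideals and without the different: index 1 only requires that the prime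
  below is not contained in the square of \<open>Q\<close>, and Nakayama's lemma turns this into a
  statement about generators. A class whose order is divisible by 4 has a power of order 4 only if
  its order is positive; this is what the finiteness of the class group is for. Different
  \<open>t\<close> can give the same field. Infinitude therefore rests on members of the family
  whose \<open>D\<close> contains, to an odd power, a prime that is new with respect to any given
  finite list.\<close>

subsection \<open>Sums and products of algebraic integers\<close>

interpretation zmod: Modules.module "\<lambda>(c::int) (x::complex). of_int c * x"
  by unfold_locales (auto simp: algebra_simps)

text \<open>Determinant trick: multiplication by \<open>z\<close> acts on the generators
  \<open>B\<close> by an integer matrix, and the vector of generators is an eigenvector for
  \<open>z\<close>, so \<open>z\<close> is a root of the monic integral characteristic polynomial.
  \<open>B\<close> may be linearly dependent; a nonzero member keeps the eigenvector
  nonzero.\<close>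

lemma algebraic_int_if_stable:
  fixes z :: complex
  assumes fin: "finite B" and nz: "b0 \<in> B" "b0 \<noteq> 0"
    and st: "\<And>b. b \<in> B \<Longrightarrow> z * b \<in> zmod.span B"
  shows "algebraic_int z"
proof -
  have "\<exists>c::complex \<Rightarrow> int. z * b = (\<Sum>x\<in>B. of_int (c x) * x)" if "b \<in> B" for b
  proof -
    have "z * b \<in> range (\<lambda>u. \<Sum>x\<in>B. of_int (u x) * x)"
      using st[OF that] by (simp only: zmod.span_finite[OF fin])
    then show ?thesis by (elim rangeE exI)
  qed
  then obtain c :: "complex \<Rightarrow> complex \<Rightarrow> int"
    where c: "\<And>b. b \<in> B \<Longrightarrow> z * b = (\<Sum>x\<in>B. of_int (c b x) * x)"
    using bchoice[of B "\<lambda>b c. z * b = (\<Sum>x\<in>B. of_int (c x) * x)"] by blast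
  define n where "n = card B"
  obtain f where f: "bij_betw f {0..<n} B"
    using ex_bij_betw_nat_finite[OF fin] unfolding n_def by (elim exE)
  define A :: "int mat" where "A = mat n n (\<lambda>(i,j). c (f i) (f j))"
  define M :: "complex mat" where "M = map_mat of_int A"
  define v where "v = vec n f"
  have A: "A \<in> carrier_mat n n" and M: "M \<in> carrier_mat n n" by (auto simp: A_def M_def)
  have "M *\<^sub>v v = z \<cdot>\<^sub>v v"
  proof (rule eq_vecI)
    fix i assume "i < dim_vec (z \<cdot>\<^sub>v v)"
    hence i: "i < n" by (simp add: v_def)
    have "(M *\<^sub>v v) $ i = (\<Sum>j\<in>{0..<n}. of_int (c (f i) (f j)) * f j)"
      using i by (simp add: M_def A_def v_def scalar_prod_def)
    also have "\<dots> = (\<Sum>x\<in>B. of_int (c (f i) x) * x)"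
      by (rule sum.reindex_bij_betw[OF f, of "\<lambda>x. of_int (c (f i) x) * x"])
    also have "\<dots> = z * f i"
      using c[of "f i"] bij_betwE[OF f] i by simp
    finally show "(M *\<^sub>v v) $ i = (z \<cdot>\<^sub>v v) $ i" using i by (simp add: v_def)
  qed (simp add: M_def A_def v_def)
  moreover have "v \<noteq> 0\<^sub>v n"
  proof
    obtain i where i: "i < n" "f i = b0"
      using nz f by (metis (full_types) atLeastLessThan_iff bij_betw_iff_bijections)
    assume "v = 0\<^sub>v n"
    hence "v $ i = 0\<^sub>v n $ i" by simp
    thus False using i nz by (simp add: v_def)
  qed
  ultimately have "eigenvector M v z"
    using M by (auto simp: eigenvector_def v_def)
  hence "poly (char_poly M) z = 0"
    using eigenvalue_root_char_poly[OF M] by (auto simp: eigenvalue_def)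
  moreover have "char_poly M = map_poly of_int (char_poly A)"
    unfolding M_def by (rule of_int_hom.char_poly_hom[OF A])
  moreover have "lead_coeff (char_poly A) = 1"
    using degree_monic_char_poly[OF A] by simp
  ultimately show ?thesis
    unfolding algebraic_int_altdef_ipoly by metis
qed

lemma algebraic_int_power_dep:
  fixes x :: complex
  assumes "algebraic_int x"
  obtains n a where "n > 0" "x ^ n = (\<Sum>i<n. of_int (a i) * x ^ i)"
proof -
  from assms obtain p where p: "poly (map_poly of_int p) x = 0" "lead_coeff p = 1"
    unfolding algebraic_int_altdef_ipoly by auto
  let ?n = "degree p" and ?p = "map_poly of_int p :: complex poly"
  have d: "degree ?p = ?n" by (rule degree_map_poly) auto
  have "?n \<noteq> 0"
  proof
    assume *: "?n = 0"
    hence "p = [:coeff p 0:]" by (metis degree_0_id)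
    hence "p = [:1:]" using p(2) * by simp
    with p(1) show False by simp
  qed
  moreover have "x ^ ?n = (\<Sum>i<?n. of_int (- coeff p i) * x ^ i)"
  proof -
    have "0 = (\<Sum>i\<le>?n. coeff ?p i * x ^ i)" using p(1) by (simp add: poly_altdef d)
    also have "\<dots> = (\<Sum>i<?n. coeff ?p i * x ^ i) + coeff ?p ?n * x ^ ?n"
      by (simp add: lessThan_Suc_atMost[symmetric])
    finally show ?thesis using p(2)
      by (simp add: coeff_map_poly sum_negf eq_neg_iff_add_eq_0 add.commute)
  qed
  ultimately show ?thesis using that[of ?n "\<lambda>i. - coeff p i"] by blast
qed

text \<open>The monomials \<open>x ^ i * y ^ j\<close> below the two degrees span a module stable
  under \<open>x\<close> and \<open>y\<close>, hence under \<open>x + y\<close> and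
  \<open>x * y\<close>; a top power is rewritten by its monic relation.\<close>

lemma algebraic_int_plus_times:
  fixes x y :: complex
  assumes "algebraic_int x" "algebraic_int y"
  shows "algebraic_int (x + y)" "algebraic_int (x * y)"
proof -
  obtain m a where m: "m > 0" "x ^ m = (\<Sum>i<m. of_int (a i) * x ^ i)"
    using algebraic_int_power_dep[OF assms(1)] by blast
  obtain n b where n: "n > 0" "y ^ n = (\<Sum>i<n. of_int (b i) * y ^ i)"
    using algebraic_int_power_dep[OF assms(2)] by blast
  define B where "B = (\<lambda>(i,j). x ^ i * y ^ j) ` ({..<m} \<times> {..<n})"
  have fin: "finite B" by (auto simp: B_def)
  have one: "1 \<in> B" unfolding B_def using m(1) n(1) by (intro image_eqI[of _ _ "(0,0)"]) auto
  have base: "x ^ i * y ^ j \<in> zmod.span B" if "i < m" "j < n" for i j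
    by (rule zmod.span_base) (use that in \<open>auto simp: B_def\<close>)
  have xb: "x * e \<in> zmod.span B" if e: "e \<in> B" for e
  proof -
    obtain i j where ij: "i < m" "j < n" "e = x ^ i * y ^ j" using e by (auto simp: B_def)
    show ?thesis
    proof (cases "Suc i < m")
      case True
      then show ?thesis using base[OF True ij(2)] ij(3) by (simp add: mult_ac)
    next
      case False
      hence "Suc i = m" using ij by simp
      hence "x * e = (\<Sum>k<m. of_int (a k) * x ^ k) * y ^ j"
        using m(2) ij(3) by (metis mult.assoc power_Suc)
      also have "\<dots> = (\<Sum>k<m. of_int (a k) * (x ^ k * y ^ j))"
        by (simp add: sum_distrib_right mult.assoc)
      also have "\<dots> \<in> zmod.span B"
        using base ij(2) by (intro zmod.span_sum zmod.span_scale) auto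
      finally show ?thesis .
    qed
  qed
  have yb: "y * e \<in> zmod.span B" if e: "e \<in> B" for e
  proof -
    obtain i j where ij: "i < m" "j < n" "e = x ^ i * y ^ j" using e by (auto simp: B_def)
    show ?thesis
    proof (cases "Suc j < n")
      case True
      then show ?thesis using base[OF ij(1) True] ij(3) by (simp add: mult_ac)
    next
      case False
      hence "Suc j = n" using ij by simp
      hence "y * e = (\<Sum>k<n. of_int (b k) * y ^ k) * x ^ i"
        using n(2) ij(3) by (metis mult.assoc mult.commute power_Suc)
      also have "\<dots> = (\<Sum>k<n. of_int (b k) * (x ^ i * y ^ k))"
        by (simp add: sum_distrib_right mult.assoc mult.commute[of "x ^ i"])
      also have "\<dots> \<in> zmod.span B"
        using base ij(1) by (intro zmod.span_sum zmod.span_scale) auto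
      finally show ?thesis .
    qed
  qed
  have xs: "x * e \<in> zmod.span B" if "e \<in> zmod.span B" for e
    using that
  proof (induction rule: zmod.span_induct_alt)
    case (step c u v)
    have "x * (of_int c * u + v) = of_int c * (x * u) + x * v" by (simp add: algebra_simps)
    then show ?case using xb step by (auto intro!: zmod.span_add zmod.span_scale)
  qed (simp add: zmod.span_zero)
  show "algebraic_int (x + y)"
    by (rule algebraic_int_if_stable[OF fin one])
       (use xb yb in \<open>auto simp: distrib_right intro: zmod.span_add\<close>)
  show "algebraic_int (x * y)"
    by (rule algebraic_int_if_stable[OF fin one])
       (use xs yb in \<open>auto simp: mult.assoc\<close>)
qed

lemma algebraic_int_diff:
  fixes x y :: complex
  assumes "algebraic_int x" "algebraic_int y"
  shows "algebraic_int (x - y)"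
  using algebraic_int_plus_times(1)[OF assms(1), of "- y"] assms(2) by simp

lemma algebraic_int_quadratic:
  fixes x b c :: complex
  assumes "b \<in> \<int>" "c \<in> \<int>" "x\<^sup>2 + b * x + c = 0"
  shows "algebraic_int x"
proof
  show "poly [:c, b, 1:] x = 0" using assms(3) by (simp add: algebra_simps power2_eq_square)
  show "\<forall>i. coeff [:c, b, 1:] i \<in> \<int>" using assms by (auto simp: coeff_pCons split: nat.splits)
qed simp

lemma algebraic_int_rational:
  fixes x :: complex
  assumes "algebraic_int x" "x \<in> \<rat>"
  obtains n where "x = of_int n"
  using rational_algebraic_int_is_int[OF assms] by (auto elim: Ints_cases)

subsection \<open>Subfields of the complex numbers and their quadratic extensions\<close>

lemma complex_field_simps [simp]:
  "carrier complex_field = UNIV"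
  "x \<otimes>\<^bsub>complex_field\<^esub> y = x * y"
  "x \<oplus>\<^bsub>complex_field\<^esub> y = x + y"
  "\<one>\<^bsub>complex_field\<^esub> = 1"
  "\<zero>\<^bsub>complex_field\<^esub> = 0"
  by (simp_all add: ring_of_type_algebra_def)

interpretation cf: cring complex_field
  by (rule cring_from_type_algebra)

lemmas field_complex_field = field_from_type_algebra[where 'a = complex]

lemma complex_field_inverses [simp]:
  "\<ominus>\<^bsub>complex_field\<^esub> x = - x"
  "x \<noteq> 0 \<Longrightarrow> inv\<^bsub>complex_field\<^esub> x = inverse x"
proof -
  show "\<ominus>\<^bsub>complex_field\<^esub> x = - x" using cf.minus_equality[of "- x" x] by simp
  show "x \<noteq> 0 \<Longrightarrow> inv\<^bsub>complex_field\<^esub> x = inverse x"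
    by (rule cf.comm_inv_char) auto
qed

locale complex_subfield =
  fixes F :: "complex set"
  assumes one_in [simp, intro]: "1 \<in> F"
    and add_in [simp, intro]: "x \<in> F \<Longrightarrow> y \<in> F \<Longrightarrow> x + y \<in> F"
    and mult_in [simp, intro]: "x \<in> F \<Longrightarrow> y \<in> F \<Longrightarrow> x * y \<in> F"
    and uminus_in [simp, intro]: "x \<in> F \<Longrightarrow> - x \<in> F"
    and inverse_in [simp, intro]: "x \<in> F \<Longrightarrow> inverse x \<in> F"
begin

lemma zero_in [simp, intro]: "0 \<in> F"
  using add_in[OF one_in uminus_in[OF one_in]] by simp

lemma diff_in [simp, intro]: "x \<in> F \<Longrightarrow> y \<in> F \<Longrightarrow> x - y \<in> F"
  using add_in[OF _ uminus_in] by force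

lemma divide_in [simp, intro]: "x \<in> F \<Longrightarrow> y \<in> F \<Longrightarrow> x / y \<in> F"
  by (simp add: divide_inverse)

lemma power_in [simp, intro]: "x \<in> F \<Longrightarrow> x ^ n \<in> F"
  by (induction n) auto

lemma of_nat_in [simp, intro]: "of_nat n \<in> F"
  by (induction n) auto

lemma of_int_in [simp, intro]: "of_int n \<in> F"
  by (cases n) auto

lemma numeral_in [simp, intro]: "numeral n \<in> F"
  using of_nat_in[of "numeral n"] by simp

lemma rat_in: "x \<in> \<rat> \<Longrightarrow> x \<in> F"
  by (auto elim: Rats_cases')

end

lemma subfield_complex_field_iff: "subfield F complex_field \<longleftrightarrow> complex_subfield F"
proof
  assume F: "subfield F complex_field"
  note S = subringE[OF subfieldE(1)[OF F]]
  show "complex_subfield F"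
  proof
    fix x assume x: "x \<in> F"
    show "inverse x \<in> F"
    proof (cases "x = 0")
      case False
      then show ?thesis using cf.subfield_m_inv(1)[OF F, of x] x by simp
    qed (use x in simp)
  qed (use S in auto)
next
  assume "complex_subfield F"
  then interpret complex_subfield F .
  show "subfield F complex_field"
    by (intro field.subfieldI'[OF field_complex_field] cf.subringI) auto
qed

text \<open>The target is always the complex numbers and values outside \<open>F\<close> are
  unconstrained, so embeddings and automorphisms are handled alike.\<close>

locale complex_hom = complex_subfield +
  fixes \<tau> :: "complex \<Rightarrow> complex"
  assumes hom_one [simp]: "\<tau> 1 = 1"
    and hom_add: "x \<in> F \<Longrightarrow> y \<in> F \<Longrightarrow> \<tau> (x + y) = \<tau> x + \<tau> y"
    and hom_mult: "x \<in> F \<Longrightarrow> y \<in> F \<Longrightarrow> \<tau> (x * y) = \<tau> x * \<tau> y"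
begin

lemma hom_zero [simp]: "\<tau> 0 = 0"
  using hom_add[of 0 0] by simp

lemma hom_uminus: "x \<in> F \<Longrightarrow> \<tau> (- x) = - \<tau> x"
  using hom_add[of x "- x"] by (simp add: eq_neg_iff_add_eq_0 add.commute)

lemma hom_diff: "x \<in> F \<Longrightarrow> y \<in> F \<Longrightarrow> \<tau> (x - y) = \<tau> x - \<tau> y"
  using hom_add[of x "- y"] by (simp add: hom_uminus)

lemma hom_inverse: "x \<in> F \<Longrightarrow> \<tau> (inverse x) = inverse (\<tau> x)"
proof (cases "x = 0")
  case False
  assume "x \<in> F"
  hence "\<tau> x * \<tau> (inverse x) = 1" using hom_mult[of x "inverse x"] False by simp
  thus ?thesis by (metis inverse_unique)
qed simp

lemma hom_divide: "x \<in> F \<Longrightarrow> y \<in> F \<Longrightarrow> \<tau> (x / y) = \<tau> x / \<tau> y"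
  by (simp add: divide_inverse hom_mult hom_inverse)

lemma hom_nonzero: "x \<in> F \<Longrightarrow> x \<noteq> 0 \<Longrightarrow> \<tau> x \<noteq> 0"
  using hom_mult[of x "inverse x"] by auto

lemma hom_inj: "x \<in> F \<Longrightarrow> y \<in> F \<Longrightarrow> \<tau> x = \<tau> y \<Longrightarrow> x = y"
  using hom_nonzero[of "x - y"] by (auto simp: hom_diff)

lemma hom_power: "x \<in> F \<Longrightarrow> \<tau> (x ^ n) = \<tau> x ^ n"
  by (induction n) (auto simp: hom_mult)

lemma hom_of_nat [simp]: "\<tau> (of_nat n) = of_nat n"
  by (induction n) (auto simp: hom_add)

lemma hom_of_int [simp]: "\<tau> (of_int n) = of_int n"
  by (cases n) (auto simp: hom_diff hom_uminus)

lemma hom_numeral [simp]: "\<tau> (numeral n) = numeral n"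
  using hom_of_nat[of "numeral n"] by simp

lemma hom_algebraic_int:
  assumes "x \<in> F" "algebraic_int x"
  shows "algebraic_int (\<tau> x)"
proof -
  have *: "poly (map_poly of_int p) x \<in> F \<and>
    \<tau> (poly (map_poly of_int p) x) = poly (map_poly of_int p) (\<tau> x)" for p
    by (induction p) (use assms(1) in \<open>auto simp: map_poly_pCons hom_add hom_mult\<close>)
  from assms(2) show ?thesis
    unfolding algebraic_int_altdef_ipoly using * by (metis hom_zero)
qed

end

lemma complex_hom_id: "complex_subfield F \<Longrightarrow> complex_hom F (\<lambda>x. x)"
  by (simp add: complex_hom_def complex_hom_axioms_def)

lemma ring_hom_subfield_iff:
  assumes "complex_subfield F"
  shows "\<tau> \<in> Ring.ring_hom (subfield_ring F) complex_field \<longleftrightarrow> complex_hom F \<tau>"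
    and "\<tau> \<in> Ring.ring_hom (subfield_ring F) (subfield_ring E) \<longleftrightarrow> complex_hom F \<tau> \<and> \<tau> ` F \<subseteq> E"
  using assms by (auto simp: Ring.ring_hom_def complex_hom_def complex_hom_axioms_def Pi_def)

locale quadratic_extension = complex_subfield F for F +
  fixes \<rho> :: complex
  assumes gen_notin: "\<rho> \<notin> F" and gen_square: "\<rho>\<^sup>2 \<in> F"
begin

definition E :: "complex set" where "E = {u + v * \<rho> | u v. u \<in> F \<and> v \<in> F}"

lemma E_I: "u \<in> F \<Longrightarrow> v \<in> F \<Longrightarrow> u + v * \<rho> \<in> E"
  by (auto simp: E_def)

lemma gen_nz: "\<rho> \<noteq> 0"
  using gen_notin by auto

lemma coord_unique:
  assumes "u + v * \<rho> = u' + v' * \<rho>" "u \<in> F" "v \<in> F" "u' \<in> F" "v' \<in> F"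
  shows "u = u' \<and> v = v'"
proof (rule ccontr)
  assume *: "\<not> ?thesis"
  have "(v - v') * \<rho> = u' - u" using assms(1) by (simp add: algebra_simps)
  moreover from this have "v \<noteq> v'" using * by auto
  ultimately have "\<rho> = (u' - u) / (v - v')" by (simp add: field_simps)
  thus False using gen_notin assms by auto
qed

definition c0 where "c0 z = (THE u. u \<in> F \<and> (\<exists>v\<in>F. z = u + v * \<rho>))"
definition c1 where "c1 z = (z - c0 z) / \<rho>"

lemma coords [simp]:
  assumes "u \<in> F" "v \<in> F"
  shows "c0 (u + v * \<rho>) = u" "c1 (u + v * \<rho>) = v"
proof -
  show "c0 (u + v * \<rho>) = u"
    unfolding c0_def using assms coord_unique by (intro the_equality) blast+
  thus "c1 (u + v * \<rho>) = v" by (simp add: c1_def gen_nz)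
qed

lemma coords_base [simp]: "u \<in> F \<Longrightarrow> c0 u = u" "u \<in> F \<Longrightarrow> c1 u = 0"
  using coords[of u 0] by auto

lemma coords_gen [simp]: "c0 \<rho> = 0" "c1 \<rho> = 1"
  using coords[of 0 1] by auto

lemma coord_in: "z \<in> E \<Longrightarrow> c0 z \<in> F" "z \<in> E \<Longrightarrow> c1 z \<in> F"
  by (auto simp: E_def)

lemma coord_eq: "z \<in> E \<Longrightarrow> z = c0 z + c1 z * \<rho>"
  by (auto simp: E_def)

lemma base_sub: "F \<subseteq> E"
  using E_I[of _ 0] by auto

lemma gen_in: "\<rho> \<in> E"
  using E_I[of 0 1] by auto

lemma mult_coords:
  "(u + v * \<rho>) * (u' + v' * \<rho>) = (u * u' + v * v' * \<rho>\<^sup>2) + (u * v' + v * u') * \<rho>"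
  by (simp add: algebra_simps power2_eq_square)

sublocale ext: complex_subfield E
proof
  show "1 \<in> E" using base_sub by auto
  fix x y assume "x \<in> E" "y \<in> E"
  then obtain u v u' v' where *: "x = u + v * \<rho>" "y = u' + v' * \<rho>" "u \<in> F" "v \<in> F" "u' \<in> F" "v' \<in> F"
    by (auto simp: E_def)
  have "x + y = (u + u') + (v + v') * \<rho>" using * by (simp add: algebra_simps)
  thus "x + y \<in> E" using E_I[of "u + u'" "v + v'"] * by (simp only: add_in)
  show "x * y \<in> E" unfolding *(1,2) mult_coords using * gen_square by (intro E_I) auto
next
  fix x assume "x \<in> E"
  then obtain u v where *: "x = u + v * \<rho>" "u \<in> F" "v \<in> F" by (auto simp: E_def)
  have "- x = (- u) + (- v) * \<rho>" using * by simp
  thus "- x \<in> E" using * E_I by (metis uminus_in)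
  show "inverse x \<in> E"
  proof (cases "x = 0")
    case True
    then show ?thesis using base_sub by auto
  next
    case False
    \<comment> \<open>Rationalising the denominator: \<open>\<rho>\<close> is outside
      \<open>F\<close>, so the conjugate of a nonzero element is nonzero and so is the norm.\<close>
    have nz: "u - v * \<rho> \<noteq> 0"
    proof
      assume "u - v * \<rho> = 0"
      hence "u + (- v) * \<rho> = 0 + 0 * \<rho>" by simp
      hence "u = 0 \<and> - v = 0" using * by (intro coord_unique) auto
      thus False using False * by simp
    qed
    let ?n = "u\<^sup>2 - v\<^sup>2 * \<rho>\<^sup>2"
    have n: "?n = x * (u - v * \<rho>)" using * by (simp add: algebra_simps power2_eq_square)
    have "inverse x = (u - v * \<rho>) / ?n" unfolding n using nz False by (simp add: divide_inverse)
    also have "\<dots> = u / ?n + (- v / ?n) * \<rho>" by (simp add: diff_divide_distrib)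
    also have "\<dots> \<in> E" using * gen_square by (intro E_I) auto
    finally show ?thesis .
  qed
qed

lemma E_minimal:
  assumes "complex_subfield L" "F \<subseteq> L" "\<rho> \<in> L"
  shows "E \<subseteq> L"
proof -
  interpret L: complex_subfield L by fact
  show ?thesis using assms by (auto simp: E_def)
qed

lemma dimension_E: "cf.dimension 2 F E"
proof -
  have "cf.dimension (Suc 0) F (cf.line_extension F 1 {0})"
    using cf.Suc_dim[OF _ _ cf.zero_dim, of 1 F] by simp
  moreover have "cf.line_extension F 1 {0} = F"
    by (auto simp: cf.line_extension_mem_iff)
  ultimately have "cf.dimension (Suc (Suc 0)) F (cf.line_extension F \<rho> F)"
    using gen_notin by (intro cf.Suc_dim) auto
  moreover have "cf.line_extension F \<rho> F = E"
    unfolding set_eq_iff cf.line_extension_mem_iff E_def mem_Collect_eq complex_field_simps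
    by (metis add.commute)
  ultimately show ?thesis by (simp add: numeral_2_eq_2)
qed

text \<open>Two instances matter: conjugation (\<open>\<tau>\<close> the identity,
  \<open>b = - \<rho>\<close>) and the automorphism of order 4, which extends a conjugation that
  moves the radicand.\<close>

definition lift_hom :: "(complex \<Rightarrow> complex) \<Rightarrow> complex \<Rightarrow> complex \<Rightarrow> complex" where
  "lift_hom \<tau> b z = \<tau> (c0 z) + \<tau> (c1 z) * b"

lemma lift_hom_coords [simp]:
  "u \<in> F \<Longrightarrow> v \<in> F \<Longrightarrow> lift_hom \<tau> b (u + v * \<rho>) = \<tau> u + \<tau> v * b"
  by (simp add: lift_hom_def)

lemma lift_hom:
  assumes "complex_hom F \<tau>" "b\<^sup>2 = \<tau> (\<rho>\<^sup>2)"
  shows "complex_hom E (lift_hom \<tau> b)"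
    and "x \<in> F \<Longrightarrow> lift_hom \<tau> b x = \<tau> x"
    and "lift_hom \<tau> b \<rho> = b"
proof -
  interpret t: complex_hom F \<tau> by fact
  show base: "x \<in> F \<Longrightarrow> lift_hom \<tau> b x = \<tau> x" for x by (simp add: lift_hom_def)
  show "lift_hom \<tau> b \<rho> = b" by (simp add: lift_hom_def)
  show "complex_hom E (lift_hom \<tau> b)"
  proof
    show "lift_hom \<tau> b 1 = 1" by (simp add: base)
    fix x y assume "x \<in> E" "y \<in> E"
    then obtain u v u' v'
      where *: "x = u + v * \<rho>" "y = u' + v' * \<rho>" "u \<in> F" "v \<in> F" "u' \<in> F" "v' \<in> F"
      by (auto simp: E_def)
    have "lift_hom \<tau> b (x + y) = lift_hom \<tau> b ((u + u') + (v + v') * \<rho>)"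
      using * by (simp add: algebra_simps)
    also have "\<dots> = \<tau> (u + u') + \<tau> (v + v') * b" using * by (intro lift_hom_coords) auto
    also have "\<dots> = lift_hom \<tau> b x + lift_hom \<tau> b y"
      unfolding *(1,2) using * by (simp only: lift_hom_coords t.hom_add) (simp add: algebra_simps)
    finally show "lift_hom \<tau> b (x + y) = lift_hom \<tau> b x + lift_hom \<tau> b y" .
    have "lift_hom \<tau> b (x * y) = \<tau> (u * u' + v * v' * \<rho>\<^sup>2) + \<tau> (u * v' + v * u') * b"
      unfolding *(1,2) mult_coords using * gen_square by (intro lift_hom_coords) auto
    also have "\<dots> = (\<tau> u + \<tau> v * b) * (\<tau> u' + \<tau> v' * b)"
    proof -
      have "\<tau> (u * u' + v * v' * \<rho>\<^sup>2) = \<tau> u * \<tau> u' + \<tau> v * \<tau> v' * b\<^sup>2"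
        "\<tau> (u * v' + v * u') = \<tau> u * \<tau> v' + \<tau> v * \<tau> u'"
        using * gen_square by (simp_all only: t.hom_add t.hom_mult mult_in assms(2))
      then show ?thesis by (simp add: algebra_simps power2_eq_square)
    qed
    finally show "lift_hom \<tau> b (x * y) = lift_hom \<tau> b x * lift_hom \<tau> b y"
      using * by simp
  qed
qed

lemma hom_eq_on_E:
  assumes "complex_hom E \<tau>" "complex_hom E \<sigma>" "\<And>x. x \<in> F \<Longrightarrow> \<tau> x = \<sigma> x" "\<tau> \<rho> = \<sigma> \<rho>" "z \<in> E"
  shows "\<tau> z = \<sigma> z"
proof -
  interpret t: complex_hom E \<tau> by fact
  interpret s: complex_hom E \<sigma> by fact
  obtain u v where uv: "z = u + v * \<rho>" "u \<in> F" "v \<in> F" using assms(5) by (auto simp: E_def)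
  have "u \<in> E" "v \<in> E" "\<rho> \<in> E" using uv base_sub gen_in by auto
  then show ?thesis using assms(3,4) uv
    by (simp add: t.hom_add t.hom_mult s.hom_add s.hom_mult)
qed

definition conj :: "complex \<Rightarrow> complex" where "conj = lift_hom (\<lambda>x. x) (- \<rho>)"

lemma conj_coords [simp]: "u \<in> F \<Longrightarrow> v \<in> F \<Longrightarrow> conj (u + v * \<rho>) = u - v * \<rho>"
  by (simp add: conj_def)

sublocale conj: complex_hom E conj
  unfolding conj_def by (rule lift_hom(1)[OF complex_hom_id]) (auto intro: complex_subfield_axioms)

lemma conj_base [simp]: "x \<in> F \<Longrightarrow> conj x = x"
  using conj_coords[of x 0] by simp

lemma conj_gen [simp]: "conj \<rho> = - \<rho>"
  using conj_coords[of 0 1] by simp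

lemma conj_in [simp]: "z \<in> E \<Longrightarrow> conj z \<in> E"
  using E_I[of _ "- _"] by (auto simp: E_def)

lemma conj_conj [simp]: "z \<in> E \<Longrightarrow> conj (conj z) = z"
  using conj_coords[of _ "- _"] by (auto simp: E_def)

lemma conj_fixed: "z \<in> E \<Longrightarrow> conj z = z \<Longrightarrow> z \<in> F"
proof -
  assume z: "z \<in> E" "conj z = z"
  then obtain u v where uv: "z = u + v * \<rho>" "u \<in> F" "v \<in> F" by (auto simp: E_def)
  with z gen_nz have "v = 0" by simp
  with uv show ?thesis by simp
qed

text \<open>The square of \<open>u + v * \<rho>\<close> has second coordinate
  \<open>2 * u * v\<close>. This is used to show that \<open>s\<close> is not in \<open>K\<close>
  and to compare the radicands of two equal quadratic fields.\<close>

lemma square_in_ext: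
  assumes "x \<in> E" "x\<^sup>2 \<in> F"
  shows "x \<in> F \<or> x / \<rho> \<in> F"
proof -
  obtain u v where uv: "x = u + v * \<rho>" "u \<in> F" "v \<in> F" using assms by (auto simp: E_def)
  have "x\<^sup>2 = (u * u + v * v * \<rho>\<^sup>2) + (2 * u * v) * \<rho>"
    unfolding uv(1) by (simp add: algebra_simps power2_eq_square)
  moreover have "x\<^sup>2 = x\<^sup>2 + 0 * \<rho>" by simp
  ultimately have "2 * u * v = 0"
    using coord_unique[of "x\<^sup>2" 0 "u * u + v * v * \<rho>\<^sup>2" "2 * u * v"] uv assms gen_square by simp
  thus ?thesis using uv gen_nz by auto
qed

end

subsection \<open>Rings of integers and their ideals\<close>

abbreviation integers_of :: "complex set \<Rightarrow> complex set" where
  "integers_of F \<equiv> {x \<in> F. algebraic_int x}"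

lemma ring_of_integers_simps [simp]:
  "carrier (ring_of_integers F) = integers_of F"
  "x \<otimes>\<^bsub>ring_of_integers F\<^esub> y = x * y"
  "x \<oplus>\<^bsub>ring_of_integers F\<^esub> y = x + y"
  "\<one>\<^bsub>ring_of_integers F\<^esub> = 1"
  "\<zero>\<^bsub>ring_of_integers F\<^esub> = 0"
  by (simp_all add: ring_of_integers_def)

context complex_subfield
begin

lemma integers_closed:
  "x \<in> integers_of F \<Longrightarrow> y \<in> integers_of F \<Longrightarrow> x + y \<in> integers_of F"
  "x \<in> integers_of F \<Longrightarrow> y \<in> integers_of F \<Longrightarrow> x * y \<in> integers_of F"
  "x \<in> integers_of F \<Longrightarrow> y \<in> integers_of F \<Longrightarrow> x - y \<in> integers_of F"
  "x \<in> integers_of F \<Longrightarrow> - x \<in> integers_of F"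
  "of_int n \<in> integers_of F" "0 \<in> integers_of F" "1 \<in> integers_of F"
  by (auto intro: algebraic_int_plus_times algebraic_int_diff)

lemma cring_ring_of_integers: "cring (ring_of_integers F)"
proof -
  have "subring (integers_of F) complex_field"
    by (rule cf.subringI) (use integers_closed in auto)
  hence "subcring (integers_of F) complex_field"
    by (rule cf.subcringI')
  thus ?thesis
    unfolding ring_of_integers_def by (simp add: cf.subcring_iff)
qed

lemma ideal_ring_of_integers_iff:
  "ideal J (ring_of_integers F) \<longleftrightarrow>
     J \<subseteq> integers_of F \<and> 0 \<in> J \<and> (\<forall>x\<in>J. \<forall>y\<in>J. x + y \<in> J) \<and> (\<forall>c\<in>integers_of F. \<forall>x\<in>J. c * x \<in> J)"
proof -
  interpret O: cring "ring_of_integers F" by (rule cring_ring_of_integers)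
  show ?thesis
  proof
    assume "ideal J (ring_of_integers F)"
    then interpret ideal J "ring_of_integers F" .
    show "J \<subseteq> integers_of F \<and> 0 \<in> J \<and> (\<forall>x\<in>J. \<forall>y\<in>J. x + y \<in> J) \<and>
        (\<forall>c\<in>integers_of F. \<forall>x\<in>J. c * x \<in> J)"
      using a_subset zero_closed a_closed I_l_closed by simp
  next
    assume J: "J \<subseteq> integers_of F \<and> 0 \<in> J \<and> (\<forall>x\<in>J. \<forall>y\<in>J. x + y \<in> J) \<and>
        (\<forall>c\<in>integers_of F. \<forall>x\<in>J. c * x \<in> J)"
    have neg: "- x \<in> J" if "x \<in> J" for x
      using bspec[OF bspec[OF conjunct2[OF conjunct2[OF conjunct2[OF J]]]], of "of_int (-1)" x]
        integers_closed(5)[of "-1"] that by simp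
    show "ideal J (ring_of_integers F)"
    proof (rule idealI)
      show "ring (ring_of_integers F)" by (rule O.ring_axioms)
      show "subgroup J (add_monoid (ring_of_integers F))"
      proof (rule subgroup.intro)
        fix x assume x: "x \<in> J"
        have "x \<in> integers_of F" using x J by blast
        hence "\<ominus>\<^bsub>ring_of_integers F\<^esub> x = - x"
          using integers_closed(4)[of x] by (intro O.minus_equality) auto
        thus "inv\<^bsub>add_monoid (ring_of_integers F)\<^esub> x \<in> J"
          using neg[OF x] by (simp add: a_inv_def)
      qed (use J in auto)
    next
      fix a x assume "a \<in> J" "x \<in> carrier (ring_of_integers F)"
      thus "x \<otimes>\<^bsub>ring_of_integers F\<^esub> a \<in> J" "a \<otimes>\<^bsub>ring_of_integers F\<^esub> x \<in> J"
        using J by (simp_all add: mult.commute[of a])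
    qed
  qed
qed

lemma idealD:
  assumes "ideal J (ring_of_integers F)"
  shows "x \<in> J \<Longrightarrow> x \<in> integers_of F" "0 \<in> J"
    "x \<in> J \<Longrightarrow> y \<in> J \<Longrightarrow> x + y \<in> J"
    "c \<in> integers_of F \<Longrightarrow> x \<in> J \<Longrightarrow> c * x \<in> J"
    "x \<in> J \<Longrightarrow> - x \<in> J" "x \<in> J \<Longrightarrow> y \<in> J \<Longrightarrow> x - y \<in> J"
    "x \<in> J \<Longrightarrow> of_int n * x \<in> J"
proof -
  have J: "J \<subseteq> integers_of F" "0 \<in> J" "\<And>x y. x \<in> J \<Longrightarrow> y \<in> J \<Longrightarrow> x + y \<in> J"
      "\<And>c x. c \<in> integers_of F \<Longrightarrow> x \<in> J \<Longrightarrow> c * x \<in> J"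
    using assms unfolding ideal_ring_of_integers_iff by auto
  show n: "x \<in> J \<Longrightarrow> of_int n * x \<in> J" for x n
    using J(4) integers_closed(5) by blast
  show m: "x \<in> J \<Longrightarrow> - x \<in> J" for x
    using n[of x "-1"] by simp
  show "x \<in> J \<Longrightarrow> y \<in> J \<Longrightarrow> x - y \<in> J"
    using J(3)[of x "- y"] m by simp
  show "x \<in> J \<Longrightarrow> x \<in> integers_of F" using J(1) by blast
qed (use assms in \<open>auto simp: ideal_ring_of_integers_iff\<close>)

lemma primeidealD:
  assumes "primeideal Q (ring_of_integers F)"
  shows "ideal Q (ring_of_integers F)" "1 \<notin> Q"
    "x \<in> integers_of F \<Longrightarrow> y \<in> integers_of F \<Longrightarrow> x * y \<in> Q \<Longrightarrow> x \<in> Q \<or> y \<in> Q"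
proof -
  interpret primeideal Q "ring_of_integers F" by fact
  show "ideal Q (ring_of_integers F)" by (rule is_ideal)
  note Q = idealD[OF this]
  show "1 \<notin> Q"
  proof
    assume "1 \<in> Q"
    hence "integers_of F \<subseteq> Q" using Q(4)[of _ 1] by auto
    thus False using I_notcarr Q(1) by auto
  qed
  show "x \<in> integers_of F \<Longrightarrow> y \<in> integers_of F \<Longrightarrow> x * y \<in> Q \<Longrightarrow> x \<in> Q \<or> y \<in> Q"
    using I_prime by simp
qed

lemma primeideal_restrict:
  assumes "primeideal Q (ring_of_integers L)" "complex_subfield L" "F \<subseteq> L"
  shows "primeideal (Q \<inter> F) (ring_of_integers F)"
proof -
  interpret L: complex_subfield L by fact
  note Q = L.idealD[OF L.primeidealD(1)[OF assms(1)]] L.primeidealD[OF assms(1)]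
  have sub: "integers_of F \<subseteq> integers_of L" using assms(3) by auto
  show ?thesis
  proof (rule primeidealI)
    show "ideal (Q \<inter> F) (ring_of_integers F)"
      unfolding ideal_ring_of_integers_iff using Q sub by auto
    show "carrier (ring_of_integers F) \<noteq> Q \<inter> F" using Q(9) integers_closed(7) by auto
  qed (use Q(10) sub cring_ring_of_integers in auto)
qed

end

subsection \<open>Linear combinations and Nakayama's lemma\<close>

text \<open>The coefficient set is a parameter because the Nakayama argument alternates between
  coefficients in the ring and coefficients in the prime \<open>Q\<close>.\<close>

definition lincomb :: "complex set \<Rightarrow> complex set \<Rightarrow> complex set" where
  "lincomb C S = {\<Sum>s\<in>S. c s * s | c. \<forall>s\<in>S. c s \<in> C}"

lemma lincomb_add:
  assumes "\<And>a b. a \<in> C \<Longrightarrow> b \<in> C \<Longrightarrow> a + b \<in> C" "x \<in> lincomb C S" "y \<in> lincomb C S"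
  shows "x + y \<in> lincomb C S"
proof -
  obtain c d where "x = (\<Sum>s\<in>S. c s * s)" "\<forall>s\<in>S. c s \<in> C" "y = (\<Sum>s\<in>S. d s * s)" "\<forall>s\<in>S. d s \<in> C"
    using assms(2,3) by (auto simp: lincomb_def)
  thus ?thesis unfolding lincomb_def using assms(1)
    by (intro CollectI exI[of _ "\<lambda>s. c s + d s"]) (auto simp: sum.distrib distrib_right)
qed

lemma lincomb_scale:
  assumes "\<And>b. b \<in> C \<Longrightarrow> a * b \<in> C'" "x \<in> lincomb C S"
  shows "a * x \<in> lincomb C' S"
proof -
  obtain c where "x = (\<Sum>s\<in>S. c s * s)" "\<forall>s\<in>S. c s \<in> C"
    using assms(2) by (auto simp: lincomb_def)
  thus ?thesis unfolding lincomb_def using assms(1)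
    by (intro CollectI exI[of _ "\<lambda>s. a * c s"]) (auto simp: sum_distrib_left mult.assoc)
qed

lemma lincomb_single:
  assumes "finite S" "s \<in> S" "a \<in> C" "0 \<in> C"
  shows "a * s \<in> lincomb C S"
proof -
  have "(\<Sum>x\<in>S. (if x = s then a else 0) * x) = (\<Sum>x\<in>S. if x = s then a * x else 0)"
    by (intro sum.cong) auto
  also have "\<dots> = a * s" using assms(1,2) by simp
  finally show ?thesis
    unfolding lincomb_def using assms(3,4)
    by (intro CollectI exI[of _ "\<lambda>x. if x = s then a else 0"]) simp
qed

lemma lincomb_insertE:
  assumes "x \<in> lincomb C (insert s S)" "finite S" "s \<notin> S"
  obtains a y where "a \<in> C" "y \<in> lincomb C S" "x = a * s + y"
  using assms by (auto simp: lincomb_def)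

context complex_subfield
begin

text \<open>For a product \<open>i * j\<close> of elements of \<open>Q\<close>, clear the
  denominator of \<open>j\<close>; the factor \<open>i\<close> then pushes all coefficients into
  \<open>Q\<close>. A sum takes the product of two denominators, which stays outside
  \<open>Q\<close> because \<open>Q\<close> is prime.\<close>

lemma nakayama_step:
  assumes Q: "primeideal Q (ring_of_integers F)"
    and loc: "\<And>x. x \<in> Q \<Longrightarrow> \<exists>u\<in>integers_of F - Q. u * x \<in> lincomb (integers_of F) S"
    and z: "z \<in> ideal_prod (ring_of_integers F) Q Q"
  shows "\<exists>u\<in>integers_of F - Q. u * z \<in> lincomb Q S"
  using z
proof (induction rule: ideal_prod.induct)
  note I = idealD[OF primeidealD(1)[OF Q]] and P = primeidealD[OF Q]
  case (prod i j)
  obtain u where u: "u \<in> integers_of F - Q" "u * j \<in> lincomb (integers_of F) S"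
    using loc[OF prod(2)] by blast
  have "i * (u * j) \<in> lincomb Q S"
    by (rule lincomb_scale[OF _ u(2)]) (use I(4) prod in \<open>simp add: mult.commute\<close>)
  thus ?case using u by (intro bexI[of _ u]) (simp_all add: mult_ac)
next
  note I = idealD[OF primeidealD(1)[OF Q]] and P = primeidealD[OF Q]
  case (sum s t)
  then obtain u v where u: "u \<in> integers_of F - Q" "u * s \<in> lincomb Q S"
      and v: "v \<in> integers_of F - Q" "v * t \<in> lincomb Q S" by blast
  have "v * (u * s) \<in> lincomb Q S" "u * (v * t) \<in> lincomb Q S"
    using I(4) u v by (auto intro: lincomb_scale)
  hence "v * (u * s) + u * (v * t) \<in> lincomb Q S"
    using I(3) by (intro lincomb_add) auto
  moreover have "v * (u * s) + u * (v * t) = (u * v) * (s \<oplus>\<^bsub>ring_of_integers F\<^esub> t)"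
    by (simp add: algebra_simps)
  moreover have "u * v \<in> integers_of F - Q"
    using P(3)[of u v] integers_closed(2)[of u v] u v by blast
  ultimately show ?case by metis
qed

text \<open>Nakayama's lemma for the localization at \<open>Q\<close>, with denominators cleared.
  Generators are discarded one at a time until none is left; then each element of \<open>Q\<close>
  is annihilated by an element outside \<open>Q\<close>, hence is zero.\<close>

lemma nakayama:
  assumes Q: "primeideal Q (ring_of_integers F)" and "finite S"
    and "S \<subseteq> ideal_prod (ring_of_integers F) Q Q"
    and "\<And>x. x \<in> Q \<Longrightarrow> \<exists>u\<in>integers_of F - Q. u * x \<in> lincomb (integers_of F) S"
  shows "Q = {0}"
  using assms(2-)
proof (induction S rule: finite_induct)
  note I = idealD[OF primeidealD(1)[OF Q]] and P = primeidealD[OF Q]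
  case empty
  have "x = 0" if x: "x \<in> Q" for x
  proof -
    obtain u where "u \<in> integers_of F - Q" "u * x = 0"
      using empty(2)[OF x] by (auto simp: lincomb_def)
    thus ?thesis using I(2) by auto
  qed
  thus ?case using I(2) by auto
next
  note I = idealD[OF primeidealD(1)[OF Q]] and P = primeidealD[OF Q]
  case (insert s S)
  obtain u where u: "u \<in> integers_of F - Q" "u * s \<in> lincomb Q (insert s S)"
    using nakayama_step[OF Q insert.prems(2), of s] insert.prems(1) by blast
  obtain a y where ay: "a \<in> Q" "y \<in> lincomb Q S" "u * s = a * s + y"
    using lincomb_insertE[OF u(2) insert.hyps] by blast
  \<comment> \<open>\<open>a\<close> is in \<open>Q\<close> and \<open>u\<close> is not, so
    \<open>w\<close> is a local unit; moving \<open>a * s\<close> to the left expresses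
    \<open>s\<close> locally by the other generators.\<close>
  define w where "w = u - a"
  have w: "w \<in> integers_of F - Q" "w * s = y"
  proof -
    have "w \<notin> Q" using u(1) ay(1) I(3)[of w a] by (auto simp: w_def)
    thus "w \<in> integers_of F - Q" using u(1) ay(1) I(1)[of a] integers_closed(3)[of u a] by (auto simp: w_def)
    show "w * s = y" using ay(3) by (simp add: w_def algebra_simps)
  qed
  have y: "y \<in> lincomb (integers_of F) S"
    using lincomb_scale[of Q 1 "integers_of F" y S] ay(2) I(1) by auto
  show ?case
  proof (rule insert.IH)
    show "S \<subseteq> ideal_prod (ring_of_integers F) Q Q" using insert.prems by auto
    fix x assume "x \<in> Q"
    then obtain v where v: "v \<in> integers_of F - Q" "v * x \<in> lincomb (integers_of F) (insert s S)"
      using insert.prems(2) by blast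
    obtain b t where bt: "b \<in> integers_of F" "t \<in> lincomb (integers_of F) S" "v * x = b * s + t"
      using lincomb_insertE[OF v(2) insert.hyps] by blast
    have "(w * v) * x = b * y + w * t"
      using bt(3) w(2) by (metis distrib_left mult.assoc mult.left_commute)
    also have "\<dots> \<in> lincomb (integers_of F) S"
    proof (rule lincomb_add)
      show "b * y \<in> lincomb (integers_of F) S"
        by (rule lincomb_scale[OF _ y]) (rule integers_closed(2)[OF bt(1)])
      show "w * t \<in> lincomb (integers_of F) S"
        by (rule lincomb_scale[OF _ bt(2)]) (rule integers_closed(2), use w in auto)
    qed (rule integers_closed(1))
    finally have "(w * v) * x \<in> lincomb (integers_of F) S" .
    moreover have "w * v \<in> integers_of F - Q"
      using P(3)[of w v] integers_closed(2)[of w v] w v by blast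
    ultimately show "\<exists>u\<in>integers_of F - Q. u * x \<in> lincomb (integers_of F) S" by blast
  qed
qed

text \<open>An exponent of at least 2 would put the finite set \<open>S\<close>, which generates
  \<open>Q\<close> locally, inside the product of \<open>Q\<close> with itself; Nakayama's lemma
  then gives \<open>Q = {0}\<close>, against its subset \<open>P\<close>.\<close>

lemma ramification_index_eq_1:
  assumes Q: "primeideal Q (ring_of_integers F)" and P: "P \<subseteq> Q" "P \<noteq> {0}" "P \<noteq> {}"
    and S: "finite S" "S \<subseteq> P"
    and loc: "\<And>x. x \<in> Q \<Longrightarrow> \<exists>u\<in>integers_of F - Q. u * x \<in> lincomb (integers_of F) S"
  shows "ramification_index F P Q = 1"
  unfolding ramification_index_def
proof (rule Greatest_equality)
  interpret O: cring "ring_of_integers F" by (rule cring_ring_of_integers)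
  interpret Is: comm_monoid "ideals_set (ring_of_integers F)" by (rule O.ideals_set_is_comm_monoid)
  have Qi: "ideal Q (ring_of_integers F)" by (rule primeidealD(1)[OF Q])
  hence Qc: "Q \<in> carrier (ideals_set (ring_of_integers F))" by (simp add: ideals_set_def)
  have mult: "A \<otimes>\<^bsub>ideals_set (ring_of_integers F)\<^esub> B = ideal_prod (ring_of_integers F) A B" for A B
    by (simp add: ideals_set_def)
  have "Idl\<^bsub>ring_of_integers F\<^esub> P \<subseteq> Q" by (rule O.genideal_minimal[OF Qi P(1)])
  thus "Idl\<^bsub>ring_of_integers F\<^esub> P \<subseteq> Q [^]\<^bsub>ideals_set (ring_of_integers F)\<^esub> (1::nat)"
    using Qc by simp
  fix e :: nat
  assume e: "Idl\<^bsub>ring_of_integers F\<^esub> P \<subseteq> Q [^]\<^bsub>ideals_set (ring_of_integers F)\<^esub> e"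
  show "e \<le> 1"
  proof (rule ccontr)
    assume "\<not> e \<le> 1"
    then obtain k where k: "e = Suc (Suc k)" by (metis One_nat_def not0_implies_Suc le_SucI le_zero_eq not_less_eq_eq Suc_le_mono)
    define B where "B = Q [^]\<^bsub>ideals_set (ring_of_integers F)\<^esub> k"
    have "ideal B (ring_of_integers F)" using Is.nat_pow_closed[OF Qc, of k] by (simp add: B_def ideals_set_def)
    hence BQ: "ideal_prod (ring_of_integers F) B Q \<subseteq> Q" using O.ideal_prod_inter[OF _ Qi] by blast
    have "Q [^]\<^bsub>ideals_set (ring_of_integers F)\<^esub> e =
        ideal_prod (ring_of_integers F) (ideal_prod (ring_of_integers F) B Q) Q"
      by (simp add: k mult B_def)
    also have "\<dots> \<subseteq> ideal_prod (ring_of_integers F) Q Q"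
    proof
      fix x assume "x \<in> ideal_prod (ring_of_integers F) (ideal_prod (ring_of_integers F) B Q) Q"
      thus "x \<in> ideal_prod (ring_of_integers F) Q Q"
        by induction (use BQ in \<open>blast intro: ideal_prod.intros\<close>)+
    qed
    finally have "Idl\<^bsub>ring_of_integers F\<^esub> P \<subseteq> ideal_prod (ring_of_integers F) Q Q" using e by simp
    moreover have "P \<subseteq> Idl\<^bsub>ring_of_integers F\<^esub> P"
      unfolding genideal_def by blast
    ultimately have "S \<subseteq> ideal_prod (ring_of_integers F) Q Q" using S(2) by blast
    from nakayama[OF Q S(1) this loc] P show False by blast
  qed
qed

end

subsection \<open>Local generation in towers of quadratic extensions\<close>

text \<open>After localization at \<open>Q\<close>, the prime \<open>Q\<close> is generated by \<open>Q \<inter> F\<close>.\<close>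

definition locally_generated :: "complex set \<Rightarrow> complex set \<Rightarrow> complex set \<Rightarrow> bool" where
  "locally_generated F E Q \<longleftrightarrow> (\<forall>x\<in>Q. \<exists>u\<in>integers_of E - Q. \<exists>a\<in>Q \<inter> F. \<exists>b\<in>Q \<inter> F. \<exists>\<theta>\<in>integers_of E.
     u * x = a + b * \<theta>)"

context quadratic_extension
begin

text \<open>Cramer's rule: for \<open>y\<close> and its conjugate \<open>y'\<close> in
  \<open>Q\<close>, \<open>(\<theta> - \<theta>') * y = (\<theta> * y' - \<theta>' * y) + (y - y') *
  \<theta>\<close>. Both coefficients lie in \<open>Q\<close> and change sign under conjugation. A
  second factor \<open>\<theta> - \<theta>'\<close>, again a local unit, makes them invariant and so
  puts them into \<open>F\<close>.\<close>

lemma locally_generated_if_discriminant: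
  assumes Q: "primeideal Q (ring_of_integers E)"
    and \<theta>: "\<theta> \<in> integers_of E" and disc: "\<theta> - conj \<theta> \<notin> Q"
  shows "locally_generated F E Q"
  unfolding locally_generated_def
proof
  note I = ext.idealD[OF ext.primeidealD(1)[OF Q]] and P = ext.primeidealD[OF Q]
  fix x assume x: "x \<in> Q"
  have cint: "conj z \<in> integers_of E" if "z \<in> integers_of E" for z
    using that conj.hom_algebraic_int by auto
  \<comment> \<open>\<open>Q\<close> need not be stable under conjugation. If some \<open>z\<close>
    in \<open>Q\<close> has its conjugate outside \<open>Q\<close>, that conjugate serves as
    \<open>w\<close>, since conjugating \<open>w * x\<close> brings back the factor
    \<open>z\<close>.\<close>
  obtain w where w: "w \<in> integers_of E - Q" "conj (w * x) \<in> Q"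
  proof (cases "\<forall>z\<in>Q. conj z \<in> Q")
    case True
    then show ?thesis using that[of 1] x P(2) ext.integers_closed(7) by auto
  next
    case False
    then obtain z where z: "z \<in> Q" "conj z \<notin> Q" by auto
    have zi: "z \<in> integers_of E" and xi: "x \<in> integers_of E" using I(1) z x by auto
    have "conj (conj z * x) = conj x * z"
      using conj.hom_mult[of "conj z" x] zi xi by simp
    moreover have "conj x * z \<in> Q" by (rule I(4)[OF cint[OF xi] z(1)])
    ultimately show ?thesis using that[of "conj z"] z cint[OF zi] by simp
  qed
  define y where "y = w * x"
  define y' where "y' = conj y"
  define \<theta>' where "\<theta>' = conj \<theta>"
  define \<delta> where "\<delta> = \<theta> - \<theta>'"
  have y: "y \<in> Q" using w x I(4) by (auto simp: y_def)
  have y': "y' \<in> Q" using w by (simp add: y'_def y_def)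
  have yE: "y \<in> E" using I(1)[OF y] by simp
  have \<theta>': "\<theta>' \<in> integers_of E" using cint[OF \<theta>] by (simp add: \<theta>'_def)
  have \<delta>: "\<delta> \<in> integers_of E" "\<delta> \<notin> Q"
    using ext.integers_closed(3)[OF \<theta> \<theta>'] disc by (auto simp: \<delta>_def \<theta>'_def)
  have cc: "conj y' = y" "conj \<theta>' = \<theta>" "conj \<delta> = - \<delta>"
    using yE \<theta> \<theta>' by (auto simp: y'_def \<theta>'_def \<delta>_def conj.hom_diff)
  define a where "a = (\<theta> * y' - \<theta>' * y) * \<delta>"
  define b where "b = (y - y') * \<delta>"
  have aQ: "a \<in> Q" "b \<in> Q"
    using I(4)[OF \<delta>(1), of "\<theta> * y' - \<theta>' * y"] I(4)[OF \<delta>(1), of "y - y'"]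
      I(6)[OF I(4)[OF \<theta> y'] I(4)[OF \<theta>' y]] I(6)[OF y y']
    by (simp_all add: a_def b_def mult.commute)
  have E: "\<theta> \<in> E" "\<theta>' \<in> E" "y \<in> E" "y' \<in> E" "\<delta> \<in> E" using \<theta> \<theta>' \<delta> I(1)[OF y] I(1)[OF y'] by auto
  have "conj y = y'" "conj \<theta> = \<theta>'" by (simp_all add: y'_def \<theta>'_def)
  hence "conj a = a" "conj b = b"
    using E by (simp_all add: a_def b_def conj.hom_mult conj.hom_diff cc algebra_simps)
  hence aF: "a \<in> F" "b \<in> F"
    using conj_fixed aQ I(1) by auto
  have "\<delta> * \<delta> * w * x = a + b * \<theta>"
    by (simp add: a_def b_def \<delta>_def y_def algebra_simps)
  moreover have "\<delta> * \<delta> * w \<in> integers_of E - Q"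
  proof -
    have "\<delta> * \<delta> \<in> integers_of E" by (rule ext.integers_closed(2)[OF \<delta>(1) \<delta>(1)])
    thus ?thesis using P(3)[OF \<delta>(1) \<delta>(1)] P(3)[of "\<delta> * \<delta>" w] \<delta> w ext.integers_closed(2)[of "\<delta> * \<delta>" w]
      by blast
  qed
  ultimately show "\<exists>u\<in>integers_of E - Q. \<exists>a\<in>Q \<inter> F. \<exists>b\<in>Q \<inter> F. \<exists>\<theta>\<in>integers_of E. u * x = a + b * \<theta>"
    using aQ aF \<theta> by blast
qed

end

text \<open>Denominators are cleared once for each step of the tower, and elements of
  \<open>Q \<inter> K\<close> are integer combinations of two generators. The pair is the same for
  all \<open>x\<close>, as Nakayama's lemma requires.\<close>

lemma locally_generated_tower:
  assumes L: "complex_subfield L" and M: "complex_subfield M" "M \<subseteq> L"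
    and Q: "primeideal Q (ring_of_integers L)"
    and LM: "locally_generated M L Q" and MK: "locally_generated K M (Q \<inter> M)"
    and gen: "\<And>x. x \<in> Q \<inter> K \<Longrightarrow> \<exists>m n. x = of_int m * \<alpha> + of_int n * \<beta>"
    and x: "x \<in> Q"
  shows "\<exists>u\<in>integers_of L - Q. u * x \<in> lincomb (integers_of L) {\<alpha>, \<beta>}"
proof -
  interpret L: complex_subfield L by fact
  note P = L.primeidealD[OF Q]
  let ?G = "lincomb (integers_of L) {\<alpha>, \<beta>}"
  have scale: "c * y \<in> ?G" if "c \<in> integers_of L" "y \<in> ?G" for c y
    by (rule lincomb_scale[OF _ that(2)]) (rule L.integers_closed(2)[OF that(1)])
  have add: "y + z \<in> ?G" if "y \<in> ?G" "z \<in> ?G" for y z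
    using that by (intro lincomb_add) (rule L.integers_closed(1))
  have base: "y \<in> ?G" if y: "y \<in> Q \<inter> K" for y
  proof -
    obtain m n where mn: "y = of_int m * \<alpha> + of_int n * \<beta>" using gen[OF y] by blast
    show ?thesis unfolding mn by (intro add lincomb_single L.integers_closed) auto
  qed
  have mid: "\<exists>u\<in>integers_of L - Q. u * a \<in> ?G" if a: "a \<in> Q \<inter> M" for a
  proof -
    obtain u b c \<theta> where *: "u \<in> integers_of M - (Q \<inter> M)" "b \<in> Q \<inter> M \<inter> K" "c \<in> Q \<inter> M \<inter> K"
        "\<theta> \<in> integers_of M" "u * a = b + c * \<theta>"
      using MK a unfolding locally_generated_def by blast
    have "\<theta> * c \<in> ?G" by (rule scale) (use * M(2) base in auto)
    hence "u * a \<in> ?G" using *(5) add[of b "\<theta> * c"] base[of b] *(2) by (simp add: mult.commute)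
    moreover have "u \<in> integers_of L - Q" using *(1) M(2) by auto
    ultimately show ?thesis by blast
  qed
  obtain u a b \<theta> where *: "u \<in> integers_of L - Q" "a \<in> Q \<inter> M" "b \<in> Q \<inter> M"
      "\<theta> \<in> integers_of L" "u * x = a + b * \<theta>"
    using LM x unfolding locally_generated_def by blast
  obtain v where v: "v \<in> integers_of L - Q" "v * a \<in> ?G" using mid[OF *(2)] by blast
  obtain w where w: "w \<in> integers_of L - Q" "w * b \<in> ?G" using mid[OF *(3)] by blast
  have "(u * v * w) * x = v * w * (u * x)" by simp
  also have "\<dots> = w * (v * a) + (v * \<theta>) * (w * b)" unfolding *(5) by (simp add: algebra_simps)
  also have "\<dots> \<in> ?G"
  proof (rule add)
    show "w * (v * a) \<in> ?G" by (rule scale) (use v w in auto)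
    show "(v * \<theta>) * (w * b) \<in> ?G"
      by (rule scale, rule L.integers_closed(2)) (use v w *(4) in auto)
  qed
  finally have "(u * v * w) * x \<in> ?G" .
  moreover have "u * v * w \<in> integers_of L - Q"
    using P(3)[of u v] P(3)[of "u * v" w] L.integers_closed(2)[of u v]
      L.integers_closed(2)[of "u * v" w] * v w by blast
  ultimately show ?thesis by blast
qed

subsection \<open>The ideal class group of a quadratic field\<close>

lemma int_subgroup_generator:
  fixes T :: "int set"
  assumes "0 \<in> T" "\<And>x y. x \<in> T \<Longrightarrow> y \<in> T \<Longrightarrow> x - y \<in> T"
  shows "\<exists>g\<in>T. \<forall>x\<in>T. g dvd x"
proof (cases "T = {0}")
  case False
  then obtain z where z: "z \<in> T" "z \<noteq> 0" using assms(1) by auto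
  have neg: "- x \<in> T" if "x \<in> T" for x using assms(2)[OF assms(1) that] by simp
  have add: "x + y \<in> T" if "x \<in> T" "y \<in> T" for x y using assms(2)[OF that(1) neg[OF that(2)]] by simp
  have mult: "k * x \<in> T" if x: "x \<in> T" for k x
  proof (induction k rule: int_induct[of _ 0])
    case (step1 i)
    then show ?case using add[of "i * x" x] x by (simp add: distrib_right)
  next
    case (step2 i)
    then show ?case using assms(2)[of "i * x" x] x by (simp add: left_diff_distrib)
  qed (use assms(1) in simp)
  define g where "g = (LEAST n::nat. n > 0 \<and> int n \<in> T)"
  have "\<exists>n::nat. n > 0 \<and> int n \<in> T"
    using z neg by (intro exI[of _ "nat \<bar>z\<bar>"]) (auto simp: abs_if)
  hence g: "g > 0" "int g \<in> T" unfolding g_def by (metis (mono_tags, lifting) LeastI_ex)+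
  have "int g dvd x" if x: "x \<in> T" for x
  proof (rule ccontr)
    assume "\<not> int g dvd x"
    hence *: "x mod int g > 0" using g(1) by (metis dvd_eq_mod_eq_0 of_nat_0_less_iff order_le_less pos_mod_sign)
    have "x mod int g = x - (x div int g) * int g" by (simp add: minus_div_mult_eq_mod)
    hence "x mod int g \<in> T" using assms(2)[OF x mult[OF g(2)]] by simp
    hence "0 < nat (x mod int g) \<and> int (nat (x mod int g)) \<in> T" using * by simp
    hence "(LEAST n::nat. n > 0 \<and> int n \<in> T) \<le> nat (x mod int g)" by (rule Least_le)
    hence "g \<le> nat (x mod int g)" by (simp only: g_def)
    moreover have "x mod int g < int g" using g(1) by simp
    ultimately show False using * by linarith
  qed
  thus ?thesis using g(2) by blast
qed auto

text \<open>Dirichlet's pigeonhole argument for two numbers at once. The bounded quantity is the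
  norm of (n x - a) + (n y - b) sqrt D; it replaces division with remainder when ideal classes are
  bounded.\<close>

lemma simultaneous_approximation:
  fixes D :: int
  obtains M :: nat where "M > 0"
    "\<And>x y :: real. \<exists>n::nat. \<exists>a b::int. 0 < n \<and> n \<le> M \<and>
       \<bar>(real n * x - of_int a)\<^sup>2 - of_int D * (real n * y - of_int b)\<^sup>2\<bar> < 1"
proof
  \<comment> \<open>Both errors are below \<open>1 / k\<close>, so the norm form is at most
    \<open>(1 + \<bar>D\<bar>) / k\<^sup>2\<close>; the summand 2 makes this less than 1.\<close>
  define k where "k = nat \<bar>D\<bar> + 2"
  have k: "k > 0" by (simp add: k_def)
  show "k * k > 0" using k by simp
  fix x y :: real
  define f where "f n = (\<lfloor>real k * frac (real n * x)\<rfloor>, \<lfloor>real k * frac (real n * y)\<rfloor>)" for n :: nat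
  have bnd: "0 \<le> \<lfloor>real k * frac z\<rfloor>" "\<lfloor>real k * frac z\<rfloor> < int k" for z
    using k frac_lt_1[of z] by (auto simp: floor_less_iff)
  have "f ` {0..k * k} \<subseteq> {0..<int k} \<times> {0..<int k}"
    using bnd by (auto simp: f_def)
  hence "card (f ` {0..k * k}) \<le> card ({0..<int k} \<times> {0..<int k})"
    by (intro card_mono) auto
  also have "\<dots> < card {0..k * k}" by simp
  finally have "\<not> inj_on f {0..k * k}" by (rule pigeonhole)
  then obtain m n where mn: "m \<le> k * k" "n \<le> k * k" "m < n" "f m = f n"
    unfolding inj_on_def by (metis atLeastAtMost_iff nat_neq_iff)
  define N where "N = n - m"
  have diff: "\<bar>frac u - frac v\<bar> < 1 / real k" if "\<lfloor>real k * frac u\<rfloor> = \<lfloor>real k * frac v\<rfloor>" for u v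
  proof -
    have "\<bar>real k * frac u - real k * frac v\<bar> < 1" using that by linarith
    hence "real k * \<bar>frac u - frac v\<bar> < 1" using k by (simp add: abs_mult flip: right_diff_distrib)
    thus ?thesis using k by (simp add: field_simps)
  qed
  have eq: "\<exists>a. real N * z - of_int a = frac (real n * z) - frac (real m * z)" for z
    using mn(3) by (intro exI[of _ "\<lfloor>real n * z\<rfloor> - \<lfloor>real m * z\<rfloor>"])
      (simp add: N_def frac_def algebra_simps of_nat_diff)
  obtain a b where ab: "real N * x - of_int a = frac (real n * x) - frac (real m * x)"
      "real N * y - of_int b = frac (real n * y) - frac (real m * y)"
    using eq by blast
  let ?u = "real N * x - of_int a" and ?v = "real N * y - of_int b"
  have uv: "\<bar>?u\<bar> < 1 / real k" "\<bar>?v\<bar> < 1 / real k"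
    unfolding ab using diff mn(4) by (auto simp: f_def)
  have sq: "w\<^sup>2 \<le> 1 / (real k)\<^sup>2" if "\<bar>w\<bar> < 1 / real k" for w
    using power_mono[of "\<bar>w\<bar>" "1 / real k" 2] that by (simp add: power_divide)
  have "\<bar>?u\<^sup>2 - of_int D * ?v\<^sup>2\<bar> \<le> ?u\<^sup>2 + \<bar>of_int D\<bar> * ?v\<^sup>2"
    by (rule order_trans[OF abs_triangle_ineq4]) (simp add: abs_mult)
  also have "\<dots> \<le> 1 / (real k)\<^sup>2 + \<bar>of_int D\<bar> * (1 / (real k)\<^sup>2)"
    using sq[OF uv(1)] sq[OF uv(2)] by (intro add_mono mult_left_mono) auto
  also have "\<dots> = (1 + \<bar>of_int D\<bar>) / (real k)\<^sup>2" by (simp add: add_divide_distrib)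
  also have "\<dots> < 1"
  proof -
    have "1 + \<bar>of_int D\<bar> < real k" by (simp add: k_def)
    also have "real k \<le> (real k)\<^sup>2" using k by (simp add: power2_eq_square)
    finally show ?thesis using k by simp
  qed
  finally show "\<exists>n::nat. \<exists>a b::int. 0 < n \<and> n \<le> k * k \<and>
      \<bar>(real n * x - of_int a)\<^sup>2 - of_int D * (real n * y - of_int b)\<^sup>2\<bar> < 1"
    using mn by (intro exI[of _ N] exI[of _ a] exI[of _ b]) (auto simp: N_def)
qed

lemma complex_rat_cases:
  fixes x :: complex
  assumes "x \<in> \<rat>"
  obtains y where "x = of_real y"
proof -
  from assms obtain a b :: int where "x = of_int a / of_int b" by (auto elim: Rats_cases')
  thus ?thesis using that[of "of_int a / of_int b"] by simp
qed

section \<open>Products of sets of complex numbers\<close>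

abbreviation set_prod :: "complex set \<Rightarrow> complex set \<Rightarrow> complex set" where
  "set_prod \<equiv> ideal_prod complex_field"

lemma set_prod_intros:
  "i \<in> I \<Longrightarrow> j \<in> J \<Longrightarrow> i * j \<in> set_prod I J"
  "s \<in> set_prod I J \<Longrightarrow> t \<in> set_prod I J \<Longrightarrow> s + t \<in> set_prod I J"
  using ideal_prod.intros[where R = complex_field] by simp_all

lemma set_prod_subset:
  assumes "\<And>i j. i \<in> I \<Longrightarrow> j \<in> J \<Longrightarrow> i * j \<in> T" "\<And>x y. x \<in> T \<Longrightarrow> y \<in> T \<Longrightarrow> x + y \<in> T"
  shows "set_prod I J \<subseteq> T"
proof
  fix x assume "x \<in> set_prod I J"
  thus "x \<in> T" by induction (use assms in auto)
qed

lemma set_prod_comm: "set_prod I J = set_prod J I"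
proof -
  have "set_prod I J \<subseteq> set_prod J I" for I J
  proof (rule set_prod_subset)
    fix i j assume "i \<in> I" "j \<in> J"
    thus "i * j \<in> set_prod J I" using set_prod_intros(1)[of j J i I] by (simp add: mult.commute)
  qed (rule set_prod_intros)
  thus ?thesis by blast
qed

lemma set_prod_assoc: "set_prod (set_prod I J) K = set_prod I (set_prod J K)"
proof -
  have *: "set_prod (set_prod I J) K \<subseteq> set_prod I (set_prod J K)" for I J K
  proof (rule set_prod_subset)
    fix x k assume "x \<in> set_prod I J" "k \<in> K"
    hence "set_prod I J \<subseteq> {x. x * k \<in> set_prod I (set_prod J K)}"
      by (intro set_prod_subset) (auto simp: mult.assoc distrib_right intro: set_prod_intros)
    thus "x * k \<in> set_prod I (set_prod J K)" using \<open>x \<in> set_prod I J\<close> by auto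
  qed (rule set_prod_intros)
  have "set_prod I (set_prod J K) = set_prod (set_prod K J) I" by (simp add: set_prod_comm)
  also have "\<dots> \<subseteq> set_prod K (set_prod J I)" by (rule *)
  also have "\<dots> = set_prod (set_prod I J) K" by (simp add: set_prod_comm)
  finally show ?thesis using * by blast
qed

lemma set_prod_scale:
  "set_prod ((\<lambda>x. a * x) ` I) ((\<lambda>x. b * x) ` J) = (\<lambda>x. a * b * x) ` set_prod I J"
proof
  show "set_prod ((\<lambda>x. a * x) ` I) ((\<lambda>x. b * x) ` J) \<subseteq> (\<lambda>x. a * b * x) ` set_prod I J"
  proof (rule set_prod_subset)
    fix x y assume "x \<in> (\<lambda>x. a * b * x) ` set_prod I J" "y \<in> (\<lambda>x. a * b * x) ` set_prod I J"
    thus "x + y \<in> (\<lambda>x. a * b * x) ` set_prod I J"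
      by (auto simp flip: distrib_left intro!: imageI set_prod_intros)
  next
    fix i j assume "i \<in> (\<lambda>x. a * x) ` I" "j \<in> (\<lambda>x. b * x) ` J"
    then obtain i' j' where "i = a * i'" "j = b * j'" "i' \<in> I" "j' \<in> J" by auto
    thus "i * j \<in> (\<lambda>x. a * b * x) ` set_prod I J"
      by (intro image_eqI[of _ _ "i' * j'"] set_prod_intros) auto
  qed
  have "set_prod I J \<subseteq> {x. a * b * x \<in> set_prod ((\<lambda>x. a * x) ` I) ((\<lambda>x. b * x) ` J)}"
  proof (rule set_prod_subset)
    fix i j assume "i \<in> I" "j \<in> J"
    hence "(a * i) * (b * j) \<in> set_prod ((\<lambda>x. a * x) ` I) ((\<lambda>x. b * x) ` J)"
      by (intro set_prod_intros) auto
    thus "i * j \<in> {x. a * b * x \<in> set_prod ((\<lambda>x. a * x) ` I) ((\<lambda>x. b * x) ` J)}"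
      by (simp add: mult_ac)
  qed (auto simp: distrib_left intro: set_prod_intros)
  thus "(\<lambda>x. a * b * x) ` set_prod I J \<subseteq> set_prod ((\<lambda>x. a * x) ` I) ((\<lambda>x. b * x) ` J)" by auto
qed

lemma complex_subfield_Rats: "complex_subfield \<rat>"
  by unfold_locales auto

section \<open>Integers and ideals of a quadratic field\<close>

locale quad_field = quadratic_extension \<rat> r for r +
  fixes D :: int
  assumes gen_sq: "r\<^sup>2 = of_int D"
begin

abbreviation "OK \<equiv> integers_of E"

lemma D_nz: "D \<noteq> 0"
  using gen_sq gen_nz by auto

lemma conj_OK: "z \<in> OK \<Longrightarrow> conj z \<in> OK"
  using conj.hom_algebraic_int by auto

lemma trace_eq: "z \<in> E \<Longrightarrow> z + conj z = 2 * c0 z"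
  by (auto simp: E_def)

lemma norm_eq: "z \<in> E \<Longrightarrow> z * conj z = (c0 z)\<^sup>2 - of_int D * (c1 z)\<^sup>2"
  by (auto simp: E_def algebra_simps power2_eq_square simp flip: gen_sq[unfolded power2_eq_square])

lemma r_OK: "r \<in> OK"
  using gen_in algebraic_int_quadratic[of 0 "of_int (- D)" r] gen_sq by simp

lemma trace_int:
  assumes "z \<in> OK"
  obtains a where "z + conj z = of_int a"
proof (rule algebraic_int_rational[of "z + conj z"])
  show "algebraic_int (z + conj z)" using ext.integers_closed(1)[OF assms conj_OK[OF assms]] by simp
  show "z + conj z \<in> \<rat>" using assms trace_eq[of z] coord_in[of z] by auto
qed

lemma norm_int:
  assumes "z \<in> OK"
  obtains n where "z * conj z = of_int n"
proof (rule algebraic_int_rational[of "z * conj z"])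
  show "algebraic_int (z * conj z)" using ext.integers_closed(2)[OF assms conj_OK[OF assms]] by simp
  show "z * conj z \<in> \<rat>" using assms norm_eq[of z] coord_in[of z] by auto
qed

text \<open>The traces of \<open>z\<close> and of \<open>z * r\<close> are integers.
  \<open>D\<close> may have square factors, so instead of an explicit integral basis the coordinates
  are only bounded in denominator, by 2 and \<open>2 * D\<close>.\<close>

lemma coords_OK:
  assumes "z \<in> OK"
  obtains a b where "2 * c0 z = of_int a" "2 * of_int D * c1 z = of_int b"
proof -
  have z: "z \<in> E" using assms by simp
  obtain a where a: "z + conj z = of_int a" using trace_int[OF assms] .
  have zr: "z * r \<in> OK" by (rule ext.integers_closed(2)[OF assms r_OK])
  obtain b where b: "z * r + conj (z * r) = of_int b" using trace_int[OF zr] .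
  have "z * r = of_int D * c1 z + c0 z * r"
    using coord_eq[OF z] gen_sq by (metis add.commute distrib_right mult.assoc mult.commute power2_eq_square)
  hence "c0 (z * r) = of_int D * c1 z"
    using coord_in[OF z] coords(1)[of "of_int D * c1 z" "c0 z"] by simp
  hence "2 * of_int D * c1 z = of_int b" using b trace_eq[of "z * r"] zr by simp
  moreover have "2 * c0 z = of_int a" using a trace_eq[OF z] by simp
  ultimately show ?thesis using that by blast
qed

lemma OK_I: "of_int a + of_int b * r \<in> OK"
  by (intro ext.integers_closed(1) ext.integers_closed(2) ext.integers_closed(5) r_OK)

text \<open>Triangular basis: \<open>\<beta>\<close> generates the group of second coordinates, and
  \<open>\<alpha>\<close> the elements whose second coordinate is zero. Scaled as in
  \<open>coords_OK\<close>, both become subgroups of the integers.\<close>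

lemma two_generators:
  assumes A: "A \<subseteq> OK" "0 \<in> A" "\<And>x y. x \<in> A \<Longrightarrow> y \<in> A \<Longrightarrow> x - y \<in> A"
  obtains \<alpha> \<beta> where "\<alpha> \<in> A" "\<beta> \<in> A" "\<And>x. x \<in> A \<Longrightarrow> \<exists>m n. x = of_int m * \<alpha> + of_int n * \<beta>"
proof -
  have c0d: "c0 (x - y) = c0 x - c0 y" and c1d: "c1 (x - y) = c1 x - c1 y" if "x \<in> A" "y \<in> A" for x y
  proof -
    have "x \<in> E" "y \<in> E" using that A by auto
    hence "x - y = (c0 x - c0 y) + (c1 x - c1 y) * r"
      using coord_eq[of x] coord_eq[of y] by (simp add: algebra_simps)
    moreover have "c0 x - c0 y \<in> \<rat>" "c1 x - c1 y \<in> \<rat>"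
      using coord_in \<open>x \<in> E\<close> \<open>y \<in> E\<close> by auto
    ultimately show "c0 (x - y) = c0 x - c0 y" "c1 (x - y) = c1 x - c1 y"
      using coords by metis+
  qed
  define T where "T = {b::int. \<exists>x\<in>A. 2 * of_int D * c1 x = of_int b}"
  have "0 \<in> T" using A(2) by (auto simp: T_def intro!: bexI[of _ 0])
  moreover have "x - y \<in> T" if "x \<in> T" "y \<in> T" for x y
  proof -
    from that obtain u v where "u \<in> A" "v \<in> A"
        "2 * of_int D * c1 u = of_int x" "2 * of_int D * c1 v = of_int y" by (auto simp: T_def)
    thus ?thesis using A(3) c1d unfolding T_def
      by (intro CollectI bexI[of _ "u - v"]) (simp_all add: right_diff_distrib)
  qed
  ultimately obtain g where g: "g \<in> T" "\<And>x. x \<in> T \<Longrightarrow> g dvd x"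
    using int_subgroup_generator by metis
  then obtain \<beta> where \<beta>: "\<beta> \<in> A" "2 * of_int D * c1 \<beta> = of_int g" by (auto simp: T_def)
  define S where "S = {a::int. \<exists>x\<in>A. c1 x = 0 \<and> 2 * c0 x = of_int a}"
  have "0 \<in> S" using A(2) by (auto simp: S_def intro!: bexI[of _ 0])
  moreover have "x - y \<in> S" if "x \<in> S" "y \<in> S" for x y
  proof -
    from that obtain u v where "u \<in> A" "v \<in> A" "c1 u = 0" "c1 v = 0"
        "2 * c0 u = of_int x" "2 * c0 v = of_int y" by (auto simp: S_def)
    thus ?thesis using A(3) c1d c0d unfolding S_def
      by (intro CollectI bexI[of _ "u - v"]) (simp_all add: right_diff_distrib)
  qed
  ultimately obtain h where h: "h \<in> S" "\<And>x. x \<in> S \<Longrightarrow> h dvd x"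
    using int_subgroup_generator by metis
  then obtain \<alpha> where \<alpha>: "\<alpha> \<in> A" "c1 \<alpha> = 0" "2 * c0 \<alpha> = of_int h" by (auto simp: S_def)
  have neg: "- x \<in> A" if "x \<in> A" for x using A(3)[OF A(2) that] by simp
  have add: "x + y \<in> A" if "x \<in> A" "y \<in> A" for x y using A(3)[OF that(1) neg[OF that(2)]] by simp
  have mult: "of_int k * x \<in> A" if x: "x \<in> A" for k x
  proof (induction k rule: int_induct[of _ 0])
    case (step1 i)
    then show ?case using add[of "of_int i * x" x] x by (simp add: distrib_right)
  next
    case (step2 i)
    then show ?case using A(3)[of "of_int i * x" x] x by (simp add: left_diff_distrib)
  qed (use A(2) in simp)
  have "\<exists>m n. x = of_int m * \<alpha> + of_int n * \<beta>" if x: "x \<in> A" for x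
  proof -
    have xO: "x \<in> OK" and xE: "x \<in> E" and \<beta>E: "\<beta> \<in> E" and \<alpha>E: "\<alpha> \<in> E" using x \<beta>(1) \<alpha>(1) A(1) by auto
    obtain b where b: "2 * of_int D * c1 x = of_int b" using coords_OK[OF xO] by metis
    hence "b \<in> T" using x by (auto simp: T_def)
    then obtain n where n: "b = g * n" using g(2) by blast
    define y where "y = x - of_int n * \<beta>"
    have yA: "y \<in> A" unfolding y_def by (rule A(3)[OF x mult[OF \<beta>(1)]])
    hence yO: "y \<in> OK" and yE: "y \<in> E" using A(1) by auto
    have "of_int n * \<beta> = of_int n * c0 \<beta> + (of_int n * c1 \<beta>) * r"
      using coord_eq[OF \<beta>E] by (metis distrib_left mult.assoc)
    hence "c1 (of_int n * \<beta>) = of_int n * c1 \<beta>"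
      using coord_in[OF \<beta>E] by (metis coords(2) of_int_in mult_in)
    hence "c1 y = c1 x - of_int n * c1 \<beta>" using c1d[OF x mult[OF \<beta>(1)], of n] by (simp add: y_def)
    hence "2 * of_int D * c1 y = 2 * of_int D * (c1 x - of_int n * c1 \<beta>)" by (simp only:)
    also have "\<dots> = 2 * of_int D * c1 x - of_int n * (2 * of_int D * c1 \<beta>)"
      by (simp only: right_diff_distrib mult_ac)
    also have "\<dots> = 0" unfolding b \<beta>(2) n by simp
    finally have "2 * of_int D * c1 y = 0" .
    hence y1: "c1 y = 0" using D_nz by simp
    obtain a where a: "2 * c0 y = of_int a" using coords_OK[OF yO] by metis
    hence "a \<in> S" using yA y1 by (auto simp: S_def)
    then obtain m where m: "a = h * m" using h(2) by blast
    have "2 * c0 y = of_int m * (2 * c0 \<alpha>)" unfolding a \<alpha>(3) m by simp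
    hence "c0 y = of_int m * c0 \<alpha>" by simp
    hence "y = of_int m * \<alpha>" using coord_eq[OF yE] coord_eq[OF \<alpha>E] y1 \<alpha>(2) by simp
    thus ?thesis by (intro exI[of _ m] exI[of _ n]) (simp add: y_def algebra_simps)
  qed
  thus ?thesis using that \<alpha>(1) \<beta>(1) by blast
qed

lemma ideal_two_generators:
  assumes "ideal J (ring_of_integers E)"
  obtains \<alpha> \<beta> where "\<alpha> \<in> J" "\<beta> \<in> J" "\<And>x. x \<in> J \<Longrightarrow> \<exists>m n. x = of_int m * \<alpha> + of_int n * \<beta>"
  using two_generators[of J] ext.idealD[OF assms] by blast

lemma ideal_conj:
  assumes "ideal J (ring_of_integers E)"
  shows "ideal (conj ` J) (ring_of_integers E)"
proof -
  note J = ext.idealD[OF assms]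
  have JE: "x \<in> J \<Longrightarrow> x \<in> E" for x using J(1) by auto
  show ?thesis
    unfolding ext.ideal_ring_of_integers_iff
  proof (intro conjI ballI)
    show "conj ` J \<subseteq> OK" using J(1) conj_OK by blast
    show "0 \<in> conj ` J" using J(2) by (metis conj.hom_zero image_eqI)
    fix x y assume "x \<in> conj ` J" "y \<in> conj ` J"
    thus "x + y \<in> conj ` J"
      using J(3) JE by (auto simp flip: conj.hom_add)
  next
    fix c x assume c: "c \<in> OK" and "x \<in> conj ` J"
    then obtain y where y: "y \<in> J" "x = conj y" by auto
    have "c * x = conj (conj c * y)" using c y JE by (simp add: conj.hom_mult)
    thus "c * x \<in> conj ` J" using J(4)[OF conj_OK[OF c] y(1)] by blast
  qed
qed

lemma ideal_set_prod:
  assumes "ideal I (ring_of_integers E)" "ideal J (ring_of_integers E)"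
  shows "ideal (set_prod I J) (ring_of_integers E)"
proof -
  note I = ext.idealD[OF assms(1)] and J = ext.idealD[OF assms(2)]
  show ?thesis
    unfolding ext.ideal_ring_of_integers_iff
  proof (intro conjI ballI)
    show "set_prod I J \<subseteq> OK"
      by (rule set_prod_subset) (use I(1) J(1) ext.integers_closed in blast)+
    show "0 \<in> set_prod I J" using set_prod_intros(1)[OF I(2) J(2)] by simp
    fix c x assume c: "c \<in> OK" "x \<in> set_prod I J"
    have "set_prod I J \<subseteq> {x. c * x \<in> set_prod I J}"
      by (rule set_prod_subset)
         (auto simp: distrib_left mult.assoc[symmetric] intro!: set_prod_intros I(4) c)
    thus "c * x \<in> set_prod I J" using c by blast
  qed (rule set_prod_intros)
qed

text \<open>The generator \<open>g\<close> is the gcd of the norms of two generators and the trace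
  of \<open>\<alpha> * conj \<beta>\<close>. This provides inverses of ideals without unique
  factorization.\<close>

lemma ideal_mult_conj:
  assumes "ideal J (ring_of_integers E)" "J \<noteq> {0}"
  obtains g :: int where "g \<noteq> 0" "set_prod J (conj ` J) = (\<lambda>x. of_int g * x) ` OK"
proof -
  note J = ext.idealD[OF assms(1)]
  obtain \<alpha> \<beta> where ab: "\<alpha> \<in> J" "\<beta> \<in> J" "\<And>x. x \<in> J \<Longrightarrow> \<exists>m n. x = of_int m * \<alpha> + of_int n * \<beta>"
    using ideal_two_generators[OF assms(1)] by blast
  have O: "\<alpha> \<in> OK" "\<beta> \<in> OK" using J(1) ab by auto
  hence Em: "\<alpha> \<in> E" "\<beta> \<in> E" by auto
  obtain A where A: "\<alpha> * conj \<alpha> = of_int A" using norm_int[OF O(1)] .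
  obtain B where B: "\<beta> * conj \<beta> = of_int B" using norm_int[OF O(2)] .
  have abO: "\<alpha> * conj \<beta> \<in> OK" by (rule ext.integers_closed(2)[OF O(1) conj_OK[OF O(2)]])
  have cab: "conj (\<alpha> * conj \<beta>) = \<beta> * conj \<alpha>" using Em by (simp add: conj.hom_mult)
  obtain t where t: "\<alpha> * conj \<beta> + \<beta> * conj \<alpha> = of_int t" using trace_int[OF abO] unfolding cab .
  define g where "g = gcd (gcd A B) t"
  have gnz: "g \<noteq> 0"
  proof
    assume "g = 0"
    hence "A = 0" "B = 0" by (auto simp: g_def)
    hence "\<alpha> = 0" "\<beta> = 0" using A B Em conj.hom_nonzero by auto
    hence "J \<subseteq> {0}" using ab(3) by fastforce
    thus False using J(2) assms(2) by auto
  qed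
  have dv: "g dvd A" "g dvd B" "g dvd t" unfolding g_def by (meson gcd_dvd1 gcd_dvd2 dvd_trans)+
  obtain A' B' t' where q: "A = g * A'" "B = g * B'" "t = g * t'" using dv by (auto elim!: dvdE)
  \<comment> \<open>\<open>\<gamma>\<close> has trace \<open>t'\<close> and norm
    \<open>A' * B'\<close>, so it is a root of a monic integral quadratic. Hence the mixed products,
    too, are divisible by \<open>g\<close> in \<open>OK\<close>.\<close>
  define \<gamma> where "\<gamma> = \<alpha> * conj \<beta> / of_int g"
  have \<gamma>: "\<alpha> * conj \<beta> = of_int g * \<gamma>" using gnz by (simp add: \<gamma>_def)
  have \<gamma>E: "\<gamma> \<in> E" using Em by (auto simp: \<gamma>_def)
  have "algebraic_int \<gamma>"
  proof (rule algebraic_int_quadratic[of "of_int (- t')" "of_int (A' * B')"])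
    have "(\<alpha> * conj \<beta>) * (\<beta> * conj \<alpha>) = (\<alpha> * conj \<alpha>) * (\<beta> * conj \<beta>)"
      by (simp add: mult_ac)
    hence "(\<alpha> * conj \<beta>) * (\<beta> * conj \<alpha>) = of_int (A * B)" by (simp add: A B)
    moreover have "\<beta> * conj \<alpha> = of_int t - \<alpha> * conj \<beta>" using t by (simp add: algebra_simps)
    ultimately have "of_int g * \<gamma> * (of_int (g * t') - of_int g * \<gamma>) = of_int (g * A' * (g * B'))"
      using \<gamma> q by simp
    moreover have "of_int g * of_int g * (\<gamma>\<^sup>2 + of_int (- t') * \<gamma> + of_int (A' * B')) =
        of_int (g * A' * (g * B')) - of_int g * \<gamma> * (of_int (g * t') - of_int g * \<gamma>)"
    proof -
      have "x * x * (z\<^sup>2 + - s * z + a * b) = x * a * (x * b) - x * z * (x * s - x * z)"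
        for x z s a b :: complex by (simp add: algebra_simps power2_eq_square)
      thus ?thesis unfolding of_int_mult of_int_minus .
    qed
    ultimately have "of_int g * of_int g * (\<gamma>\<^sup>2 + of_int (- t') * \<gamma> + of_int (A' * B')) = 0"
      by (simp only: diff_self)
    thus "\<gamma>\<^sup>2 + of_int (- t') * \<gamma> + of_int (A' * B') = 0" using gnz by simp
  qed auto
  hence \<gamma>O: "\<gamma> \<in> OK" using \<gamma>E by simp
  have \<gamma>': "\<beta> * conj \<alpha> = of_int g * (of_int t' - \<gamma>)"
    using t \<gamma> q(3) by (simp add: algebra_simps)
  have "set_prod J (conj ` J) = (\<lambda>x. of_int g * x) ` OK"
  proof
    show "set_prod J (conj ` J) \<subseteq> (\<lambda>x. of_int g * x) ` OK"
    proof (rule set_prod_subset)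
      fix i j assume "i \<in> J" "j \<in> conj ` J"
      then obtain m n m' n' where i: "i = of_int m * \<alpha> + of_int n * \<beta>"
          and j: "j = conj (of_int m' * \<alpha> + of_int n' * \<beta>)" using ab(3) by blast
      have "j = of_int m' * conj \<alpha> + of_int n' * conj \<beta>"
        unfolding j using Em by (simp add: conj.hom_add conj.hom_mult)
      hence "i * j = of_int (m * m') * (\<alpha> * conj \<alpha>) + of_int (n * n') * (\<beta> * conj \<beta>)
          + of_int (m * n') * (\<alpha> * conj \<beta>) + of_int (n * m') * (\<beta> * conj \<alpha>)"
        unfolding i of_int_mult by (simp only: distrib_left distrib_right mult_ac add_ac)
      also have "\<dots> = of_int g * (of_int (m * m' * A' + n * n' * B') + of_int (m * n') * \<gamma>
          + of_int (n * m') * (of_int t' - \<gamma>))"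
        unfolding A B \<gamma> \<gamma>' q of_int_mult of_int_add
        by (simp only: distrib_left distrib_right right_diff_distrib mult_ac)
      also have "\<dots> \<in> (\<lambda>x. of_int g * x) ` OK"
        by (intro imageI ext.integers_closed(1-3,5) \<gamma>O)
      finally show "i * j \<in> (\<lambda>x. of_int g * x) ` OK" .
    next
      fix x y assume "x \<in> (\<lambda>x. of_int g * x) ` OK" "y \<in> (\<lambda>x. of_int g * x) ` OK"
      then obtain x' y' where "x = of_int g * x'" "y = of_int g * y'" "x' \<in> OK" "y' \<in> OK" by auto
      thus "x + y \<in> (\<lambda>x. of_int g * x) ` OK"
        using ext.integers_closed(1) by (intro image_eqI[of _ _ "x' + y'"]) (auto simp: distrib_left)
    qed
    have prod: "ideal (set_prod J (conj ` J)) (ring_of_integers E)"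
      by (rule ideal_set_prod[OF assms(1) ideal_conj[OF assms(1)]])
    note P = ext.idealD[OF prod]
    have mem: "of_int A \<in> set_prod J (conj ` J)" "of_int B \<in> set_prod J (conj ` J)"
        "of_int t \<in> set_prod J (conj ` J)"
      unfolding A[symmetric] B[symmetric] t[symmetric] using ab by (auto intro!: set_prod_intros)
    \<comment> \<open>Conversely, Bezout coefficients express \<open>g\<close> by the two norms and
      the trace, all of which lie in the product.\<close>
    obtain u v where uv: "u * A + v * B = gcd A B" using bezout_int by blast
    obtain u' v' where uv': "u' * gcd A B + v' * t = g" unfolding g_def using bezout_int by blast
    have "g = (u' * u) * A + (u' * v) * B + v' * t" using uv uv' by (simp add: algebra_simps flip: uv)
    hence "of_int g = of_int (u' * u) * of_int A + of_int (u' * v) * of_int B + of_int v' * (of_int t :: complex)"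
      by (metis of_int_add of_int_mult)
    hence "of_int g \<in> set_prod J (conj ` J)"
      using P(3)[OF P(3)[OF P(7)[OF mem(1)] P(7)[OF mem(2)]] P(7)[OF mem(3)]] by metis
    thus "(\<lambda>x. of_int g * x) ` OK \<subseteq> set_prod J (conj ` J)"
      using P(4) by (auto simp: mult.commute[of "of_int g"])
  qed
  thus ?thesis using that gnz by blast
qed

lemma coord_diff: "x \<in> E \<Longrightarrow> y \<in> E \<Longrightarrow> x - y = (c0 x - c0 y) + (c1 x - c1 y) * r"
  by (auto simp: E_def algebra_simps)

lemma denominator:
  assumes "z \<in> E"
  obtains m :: int where "m \<noteq> 0" "of_int m * z \<in> OK"
proof -
  obtain x y where xy: "z = x + y * r" "x \<in> \<rat>" "y \<in> \<rat>" using assms by (auto simp: E_def)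
  obtain a b :: int where ab: "b > 0" "x = of_int a / of_int b" using Rats_cases'[OF xy(2)] by metis
  obtain c d :: int where cd: "d > 0" "y = of_int c / of_int d" using Rats_cases'[OF xy(3)] by metis
  have "of_int (b * d) * z = of_int (a * d) + of_int (c * b) * r"
    using ab cd by (simp add: xy(1) field_simps)
  also have "\<dots> \<in> OK" by (rule OK_I)
  finally show ?thesis using that[of "b * d"] ab cd by simp
qed

lemma ideal_OK: "ideal OK (ring_of_integers E)"
  unfolding ext.ideal_ring_of_integers_iff using ext.integers_closed by blast

lemma ideal_scale:
  assumes "ideal J (ring_of_integers E)" "c \<in> OK"
  shows "ideal ((\<lambda>x. c * x) ` J) (ring_of_integers E)"
proof -
  note J = ext.idealD[OF assms(1)]
  show ?thesis
    unfolding ext.ideal_ring_of_integers_iff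
  proof (intro conjI ballI)
    show "(\<lambda>x. c * x) ` J \<subseteq> OK" using J(1) ext.integers_closed(2)[OF assms(2)] by blast
    show "0 \<in> (\<lambda>x. c * x) ` J" using J(2) by (metis image_eqI mult_zero_right)
    fix x y assume "x \<in> (\<lambda>x. c * x) ` J" "y \<in> (\<lambda>x. c * x) ` J"
    thus "x + y \<in> (\<lambda>x. c * x) ` J" using J(3) by (auto simp flip: distrib_left)
  next
    fix a x assume "a \<in> OK" "x \<in> (\<lambda>x. c * x) ` J"
    thus "a * x \<in> (\<lambda>x. c * x) ` J" using J(4) by (auto simp: mult.left_commute[of a c])
  qed
qed

lemma scale_scale: "(\<lambda>x. a * x) ` (\<lambda>x. b * x) ` J = (\<lambda>x. (a * b) * x) ` (J :: complex set)"
  by (simp add: image_image mult.assoc)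

lemma scale_nonzero: "a \<noteq> 0 \<Longrightarrow> J \<noteq> {0} \<Longrightarrow> (\<lambda>x. a * x) ` J \<noteq> {0 :: complex}"
proof
  assume a: "a \<noteq> 0" "J \<noteq> {0}" "(\<lambda>x. a * x) ` J = {0}"
  have "x = 0" if "x \<in> J" for x
  proof -
    have "a * x \<in> {0}" using that by (metis (no_types) a(3) imageI)
    thus ?thesis using a(1) by simp
  qed
  moreover have "J \<noteq> {}" using a(3) by auto
  ultimately show False using a(2) by blast
qed

text \<open>Trading the integral denominator for an arbitrary nonzero factor from the field makes
  scaling and products immediate; back again, a rational integer clears the denominator of that
  factor.\<close>

lemma fractional_ideal_iff:
  "fractional_ideal E I \<longleftrightarrow>
     (\<exists>J a. ideal J (ring_of_integers E) \<and> J \<noteq> {0} \<and> a \<in> E \<and> a \<noteq> 0 \<and> I = (\<lambda>x. a * x) ` J)"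
proof
  assume "fractional_ideal E I"
  then obtain J d where *: "ideal J (ring_of_integers E)" "J \<noteq> {0}" "d \<in> OK" "d \<noteq> 0" "I = (\<lambda>x. x / d) ` J"
    unfolding fractional_ideal_def by auto
  have "I = (\<lambda>x. inverse d * x) ` J" using * by (simp add: divide_inverse mult.commute)
  thus "\<exists>J a. ideal J (ring_of_integers E) \<and> J \<noteq> {0} \<and> a \<in> E \<and> a \<noteq> 0 \<and> I = (\<lambda>x. a * x) ` J"
    using * by (intro exI[of _ J] exI[of _ "inverse d"]) auto
next
  assume "\<exists>J a. ideal J (ring_of_integers E) \<and> J \<noteq> {0} \<and> a \<in> E \<and> a \<noteq> 0 \<and> I = (\<lambda>x. a * x) ` J"
  then obtain J a where *: "ideal J (ring_of_integers E)" "J \<noteq> {0}" "a \<in> E" "a \<noteq> 0" "I = (\<lambda>x. a * x) ` J"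
    by auto
  obtain m :: int where m: "m \<noteq> 0" "of_int m * a \<in> OK" using denominator[OF *(3)] .
  have "I = (\<lambda>x. x / of_int m) ` (\<lambda>x. (of_int m * a) * x) ` J"
    using m(1) *(5) by (simp add: image_image)
  moreover have "ideal ((\<lambda>x. (of_int m * a) * x) ` J) (ring_of_integers E)"
    by (rule ideal_scale[OF *(1) m(2)])
  moreover have "(\<lambda>x. (of_int m * a) * x) ` J \<noteq> {0}"
    by (rule scale_nonzero) (use * m in auto)
  ultimately show "fractional_ideal E I"
    unfolding fractional_ideal_def using m(1) ext.integers_closed(5)[of m]
    by (intro exI[of _ "(\<lambda>x. (of_int m * a) * x) ` J"] exI[of _ "of_int m"]) auto
qed

lemma set_prod_OK:
  assumes "ideal J (ring_of_integers E)"
  shows "set_prod OK J = J"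
proof
  note J = ext.idealD[OF assms]
  show "set_prod OK J \<subseteq> J" by (rule set_prod_subset) (use J(3,4) in blast)+
  show "J \<subseteq> set_prod OK J"
  proof
    fix x assume "x \<in> J"
    thus "x \<in> set_prod OK J" using set_prod_intros(1)[OF ext.integers_closed(7), of x J] by simp
  qed
qed

lemma set_prod_principal:
  assumes "ideal J (ring_of_integers E)"
  shows "set_prod ((\<lambda>x. a * x) ` OK) ((\<lambda>x. b * x) ` J) = (\<lambda>x. a * b * x) ` J"
  by (simp add: set_prod_scale set_prod_OK[OF assms])

lemma set_prod_nonzero:
  assumes "ideal I (ring_of_integers E)" "ideal J (ring_of_integers E)" "I \<noteq> {0}" "J \<noteq> {0}"
  shows "set_prod I J \<noteq> {0}"
proof -
  obtain x y where "x \<in> I" "x \<noteq> 0" "y \<in> J" "y \<noteq> 0"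
    using assms(3,4) ext.idealD(2)[OF assms(1)] ext.idealD(2)[OF assms(2)] by auto
  hence "x * y \<in> set_prod I J" "x * y \<noteq> 0" by (simp_all add: set_prod_intros(1))
  thus ?thesis by (metis singletonD)
qed

section \<open>The group of fractional ideals\<close>

abbreviation "IG \<equiv> fractional_ideal_group E"
abbreviation "PI \<equiv> principal_fractional_ideals E"

lemma IG_simps [simp]:
  "carrier IG = {I. fractional_ideal E I}" "I \<otimes>\<^bsub>IG\<^esub> J = set_prod I J" "\<one>\<^bsub>IG\<^esub> = OK"
  by (simp_all add: fractional_ideal_group_def)

lemma fractional_ideal_ideal:
  "ideal J (ring_of_integers E) \<Longrightarrow> J \<noteq> {0} \<Longrightarrow> fractional_ideal E J"
  unfolding fractional_ideal_iff by (intro exI[of _ J] exI[of _ 1]) auto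

lemma OK_nonzero: "OK \<noteq> {0}"
  using ext.integers_closed(7) by (metis singletonD zero_neq_one)

lemma comm_group_IG: "comm_group IG"
proof (rule comm_groupI)
  fix I assume "I \<in> carrier IG"
  then obtain J a where *: "ideal J (ring_of_integers E)" "J \<noteq> {0}" "a \<in> E" "a \<noteq> 0" "I = (\<lambda>x. a * x) ` J"
    by (auto simp: fractional_ideal_iff)
  show "\<one>\<^bsub>IG\<^esub> \<otimes>\<^bsub>IG\<^esub> I = I"
    using set_prod_principal[OF *(1), of 1 a] *(5) by simp
  obtain g :: int where g: "g \<noteq> 0" "set_prod J (conj ` J) = (\<lambda>x. of_int g * x) ` OK"
    using ideal_mult_conj[OF *(1,2)] by blast
  \<comment> \<open>The inverse of \<open>a J\<close> is the conjugate of \<open>J\<close> divided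
    by \<open>a g\<close>, because \<open>J\<close> times its conjugate is generated by
    \<open>g\<close>.\<close>
  define I' where "I' = (\<lambda>x. inverse (a * of_int g) * x) ` conj ` J"
  have "conj ` J \<noteq> {0}"
  proof
    assume "conj ` J = {0}"
    hence "set_prod J (conj ` J) \<subseteq> {0}" by (intro set_prod_subset) auto
    moreover have "of_int g * 1 \<in> set_prod J (conj ` J)"
      unfolding g(2) using ext.integers_closed(7) by (rule imageI)
    ultimately show False using g(1) by auto
  qed
  hence "fractional_ideal E I'"
    unfolding fractional_ideal_iff I'_def
    using ideal_conj[OF *(1)] *(3,4) g(1)
    by (intro exI[of _ "conj ` J"] exI[of _ "inverse (a * of_int g)"]) auto
  moreover have "set_prod I' I = OK"
  proof -
    have "set_prod I' I = (\<lambda>x. inverse (a * of_int g) * a * x) ` (\<lambda>x. of_int g * x) ` OK"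
      unfolding I'_def *(5) set_prod_scale set_prod_comm[of "conj ` J"] g(2) ..
    also have "\<dots> = (\<lambda>x. 1 * x) ` OK"
    proof -
      have "inverse (a * of_int g) * a * of_int g = 1" using *(4) g(1) by (simp add: field_simps)
      thus ?thesis unfolding scale_scale by (simp only:)
    qed
    finally show ?thesis by simp
  qed
  ultimately show "\<exists>I'\<in>carrier IG. I' \<otimes>\<^bsub>IG\<^esub> I = \<one>\<^bsub>IG\<^esub>" by auto
next
  fix I J assume "I \<in> carrier IG" "J \<in> carrier IG"
  then obtain A a B b where *: "ideal A (ring_of_integers E)" "A \<noteq> {0}" "a \<in> E" "a \<noteq> 0" "I = (\<lambda>x. a * x) ` A"
     "ideal B (ring_of_integers E)" "B \<noteq> {0}" "b \<in> E" "b \<noteq> 0" "J = (\<lambda>x. b * x) ` B"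
    by (auto simp: fractional_ideal_iff)
  hence "fractional_ideal E (set_prod I J)"
    unfolding fractional_ideal_iff *(5,10) set_prod_scale
    by (intro exI[of _ "set_prod A B"] exI[of _ "a * b"]) (auto intro: ideal_set_prod simp: set_prod_nonzero)
  thus "I \<otimes>\<^bsub>IG\<^esub> J \<in> carrier IG" by simp
  show "I \<otimes>\<^bsub>IG\<^esub> J = J \<otimes>\<^bsub>IG\<^esub> I" using set_prod_comm by simp
next
  show "\<one>\<^bsub>IG\<^esub> \<in> carrier IG" using fractional_ideal_ideal[OF ideal_OK OK_nonzero] by simp
qed (simp add: set_prod_assoc)

sublocale IG: comm_group IG by (rule comm_group_IG)

lemma principal_I: "a \<in> E \<Longrightarrow> a \<noteq> 0 \<Longrightarrow> (\<lambda>x. a * x) ` OK \<in> PI"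
  unfolding principal_fractional_ideals_def by auto

lemma principal_E:
  assumes "I \<in> PI"
  obtains a where "a \<in> E" "a \<noteq> 0" "I = (\<lambda>x. a * x) ` OK"
  using assms unfolding principal_fractional_ideals_def by auto

lemma subgroup_PI: "subgroup PI IG"
proof (rule IG.subgroupI)
  show "PI \<subseteq> carrier IG"
    by (auto elim!: principal_E simp: fractional_ideal_iff intro!: exI[of _ OK] ideal_OK OK_nonzero)
  show "PI \<noteq> {}" using principal_I[of 1] by auto
  fix I assume "I \<in> PI"
  then obtain a where a: "a \<in> E" "a \<noteq> 0" "I = (\<lambda>x. a * x) ` OK" by (rule principal_E)
  have inv: "(\<lambda>x. inverse a * x) ` OK \<in> PI" using a by (intro principal_I) auto
  have "inv\<^bsub>IG\<^esub> I = (\<lambda>x. inverse a * x) ` OK"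
  proof (rule IG.inv_equality)
    show "(\<lambda>x. inverse a * x) ` OK \<otimes>\<^bsub>IG\<^esub> I = \<one>\<^bsub>IG\<^esub>"
      using set_prod_principal[OF ideal_OK, of "inverse a" a] a by simp
  qed (use \<open>PI \<subseteq> carrier IG\<close> inv \<open>I \<in> PI\<close> in auto)
  thus "inv\<^bsub>IG\<^esub> I \<in> PI" using inv by simp
  fix J assume "J \<in> PI"
  then obtain b where b: "b \<in> E" "b \<noteq> 0" "J = (\<lambda>x. b * x) ` OK" by (rule principal_E)
  show "I \<otimes>\<^bsub>IG\<^esub> J \<in> PI"
    using set_prod_principal[OF ideal_OK, of a b] a b principal_I[of "a * b"] by simp
qed

lemma normal_PI: "PI \<lhd> IG"
  using subgroup_PI IG.normal_iff_subgroup by blast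

lemma comm_group_class_group: "comm_group (ideal_class_group E)"
  unfolding ideal_class_group_def by (rule IG.abelian_FactGroup[OF subgroup_PI])

section \<open>Finiteness of the class group\<close>

lemma finite_ideals_containing:
  assumes "M \<noteq> (0::int)"
  shows "finite {J. ideal J (ring_of_integers E) \<and> of_int M \<in> J}"
proof -
  \<comment> \<open>An ideal containing \<open>M\<close> is recorded by the scaled coordinates of
    its elements modulo \<open>N\<close>. Elements with equal residues differ by \<open>M\<close>
    times an integer combination of 1 and \<open>r\<close>, the factor \<open>\<bar>D\<bar>\<close>
    absorbing the denominator \<open>2 * D\<close>; so equal records mean equal ideals.\<close>
  define N where "N = 2 * \<bar>D * M\<bar>"
  have N: "N > 0" using assms D_nz by (simp add: N_def)
  define f where "f J = {(a mod N, b mod N) | a b. \<exists>z\<in>J. 2 * c0 z = of_int a \<and> 2 * of_int D * c1 z = of_int b}"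
    for J
  have sub: "I \<subseteq> J" if I: "ideal I (ring_of_integers E)" and J: "ideal J (ring_of_integers E)" "of_int M \<in> J"
      and eq: "f I = f J" for I J
  proof
    note ID = ext.idealD[OF I] and JD = ext.idealD[OF J(1)]
    fix x assume x: "x \<in> I"
    hence xO: "x \<in> OK" by (rule ID(1))
    obtain a b where ab: "2 * c0 x = of_int a" "2 * of_int D * c1 x = of_int b" by (rule coords_OK[OF xO])
    hence "(a mod N, b mod N) \<in> f I" using x by (auto simp: f_def)
    hence "(a mod N, b mod N) \<in> f J" by (simp only: eq)
    then obtain y a' b' where y: "y \<in> J" "2 * c0 y = of_int a'" "2 * of_int D * c1 y = of_int b'"
        "a mod N = a' mod N" "b mod N = b' mod N" by (auto simp: f_def)
    obtain k l where kl: "a - a' = N * k" "b - b' = N * l" using y(4,5) by (metis mod_eq_dvd_iff dvdE)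
    have yO: "y \<in> OK" using JD(1) y(1) .
    define s where "s = sgn (D * M)"
    have s: "\<bar>D * M\<bar> = s * (D * M)" unfolding s_def by (simp add: abs_sgn mult.commute)
    have "c0 x = of_int a / 2" "c0 y = of_int a' / 2" using ab(1) y(2) by (simp_all add: field_simps)
    hence "c0 x - c0 y = of_int (a - a') / 2" by (simp only: diff_divide_distrib of_int_diff)
    hence c0': "c0 x - c0 y = of_int (s * (D * M) * k)" unfolding kl N_def s by simp
    have "2 * of_int D * (c1 x - c1 y) = of_int (b - b')" unfolding right_diff_distrib ab(2) y(3) by simp
    moreover have "b - b' = 2 * D * (s * M * l)" unfolding kl N_def s by (simp only: mult_ac)
    ultimately have "2 * of_int D * (c1 x - c1 y) = 2 * of_int D * of_int (s * M * l)" by simp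
    hence c1': "c1 x - c1 y = of_int (s * M * l)" using D_nz by simp
    have "x - y = (c0 x - c0 y) + (c1 x - c1 y) * r"
      using coord_diff xO yO by blast
    also have "\<dots> = (of_int (s * D * k) + of_int (s * l) * r) * of_int M"
      unfolding c0' c1' by (simp only: of_int_mult distrib_left distrib_right mult_ac)
    also have "\<dots> \<in> J" by (rule JD(4)[OF OK_I J(2)])
    finally have "x - y \<in> J" .
    hence "(x - y) + y \<in> J" by (rule JD(3)[OF _ y(1)])
    thus "x \<in> J" by simp
  qed
  have "inj_on f {J. ideal J (ring_of_integers E) \<and> of_int M \<in> J}"
    using sub by (intro inj_onI equalityI) auto
  moreover have "f J \<in> Pow ({0..<N} \<times> {0..<N})" for J
    using N by (auto simp: f_def)
  hence "f ` {J. ideal J (ring_of_integers E) \<and> of_int M \<in> J} \<subseteq> Pow ({0..<N} \<times> {0..<N})" by blast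
  hence "finite (f ` {J. ideal J (ring_of_integers E) \<and> of_int M \<in> J})"
    by (rule finite_subset) simp
  ultimately show ?thesis by (rule finite_imageD[rotated])
qed

text \<open>Hurwitz's argument. Let \<open>\<beta>\<close> be a nonzero element of \<open>A\<close>
  of least absolute norm. For \<open>\<alpha>\<close> in \<open>A\<close> some
  \<open>n * \<alpha> / \<beta>\<close> with bounded \<open>n\<close> differs from an integer
  combination of 1 and \<open>r\<close> by an element of absolute norm below 1. Minimality forces
  the difference to vanish, so a common multiple of all these \<open>n\<close> carries
  \<open>A\<close> into the multiples of \<open>\<beta>\<close>.\<close>

lemma equivalent_ideal_containing:
  "\<exists>M::int. M \<noteq> 0 \<and> (\<forall>A. ideal A (ring_of_integers E) \<longrightarrow> A \<noteq> {0} \<longrightarrow>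
       (\<exists>\<beta> B. \<beta> \<in> OK \<and> \<beta> \<noteq> 0 \<and> ideal B (ring_of_integers E) \<and> of_int M \<in> B \<and>
         (\<lambda>x. of_int M * x) ` A = (\<lambda>x. \<beta> * x) ` B))"
proof -
  obtain M :: nat where M: "M > 0" "\<And>x y :: real. \<exists>n::nat. \<exists>a b::int. 0 < n \<and> n \<le> M \<and>
       \<bar>(real n * x - of_int a)\<^sup>2 - of_int D * (real n * y - of_int b)\<^sup>2\<bar> < 1"
    using simultaneous_approximation[of D] by blast
  \<comment> \<open>The factorial is divisible by every \<open>n\<close> up to
    \<open>M\<close>.\<close>
  define m where "m = (fact M :: int)"
  define nm where "nm z = nat \<bar>THE n::int. z * conj z = of_int n\<bar>" for z
  have nm: "of_int n = z * conj z \<Longrightarrow> nm z = nat \<bar>n\<bar>" for z and n :: int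
    unfolding nm_def by (metis (mono_tags, lifting) of_int_eq_iff the_equality)
  have "\<exists>\<beta> B. \<beta> \<in> OK \<and> \<beta> \<noteq> 0 \<and> ideal B (ring_of_integers E) \<and> of_int m \<in> B \<and>
         (\<lambda>x. of_int m * x) ` A = (\<lambda>x. \<beta> * x) ` B"
    if A: "ideal A (ring_of_integers E)" "A \<noteq> {0}" for A
  proof -
    note AD = ext.idealD[OF A(1)]
    have "\<exists>x. x \<in> A \<and> x \<noteq> 0" using A(2) AD(2) by auto
    then obtain \<beta> where \<beta>: "\<beta> \<in> A" "\<beta> \<noteq> 0" and min: "\<And>x. x \<in> A \<Longrightarrow> x \<noteq> 0 \<Longrightarrow> nm \<beta> \<le> nm x"
      using ex_has_least_nat[of "\<lambda>x. x \<in> A \<and> x \<noteq> 0" _ nm] by blast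
    have \<beta>O: "\<beta> \<in> OK" and \<beta>E: "\<beta> \<in> E" using AD(1)[OF \<beta>(1)] by auto
    have key: "of_int m * \<alpha> / \<beta> \<in> OK" if \<alpha>: "\<alpha> \<in> A" for \<alpha>
    proof -
      have \<alpha>E: "\<alpha> \<in> E" using AD(1)[OF \<alpha>] by simp
      define q where "q = \<alpha> / \<beta>"
      have qE: "q \<in> E" using \<alpha>E \<beta>E by (simp add: q_def)
      obtain x where x: "c0 q = of_real x" using complex_rat_cases coord_in(1)[OF qE] by blast
      obtain y where y: "c1 q = of_real y" using complex_rat_cases coord_in(2)[OF qE] by blast
      obtain n :: nat and a b :: int where n: "0 < n" "n \<le> M"
         and lt: "\<bar>(real n * x - of_int a)\<^sup>2 - of_int D * (real n * y - of_int b)\<^sup>2\<bar> < 1"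
        using M(2) by blast
      let ?u = "real n * x - of_int a" and ?v = "real n * y - of_int b"
      \<comment> \<open>\<open>\<gamma>\<close> lies in \<open>A\<close>, and its norm is that of
        \<open>\<beta>\<close> times a number below 1 in absolute value, so it is zero.\<close>
      define \<gamma> where "\<gamma> = of_nat n * \<alpha> - (of_int a + of_int b * r) * \<beta>"
      have \<gamma>A: "\<gamma> \<in> A"
        unfolding \<gamma>_def using AD(7)[OF \<alpha>, of "int n"] by (intro AD(6) AD(4)[OF OK_I \<beta>(1)]) simp
      define s where "s = of_real ?u + of_real ?v * r"
      have q: "q = of_real x + of_real y * r" using coord_eq[OF qE] x y by simp
      have "\<gamma> = \<beta> * (of_nat n * q - (of_int a + of_int b * r))"
        using \<beta>(2) by (simp add: \<gamma>_def q_def field_simps)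
      also have "of_nat n * q - (of_int a + of_int b * r) = s"
        by (simp add: s_def q algebra_simps)
      finally have \<gamma>s: "\<gamma> = \<beta> * s" .
      have rat: "complex_of_real ?u \<in> \<rat>" "complex_of_real ?v \<in> \<rat>"
        using coord_in[OF qE] unfolding x y by simp_all
      have sE: "s \<in> E" unfolding s_def using rat by (rule E_I)
      have "s * conj s = of_real (?u\<^sup>2 - of_int D * ?v\<^sup>2)"
        using norm_eq[OF sE] unfolding s_def coords[OF rat] by simp
      moreover have "\<gamma> * conj \<gamma> = (\<beta> * conj \<beta>) * (s * conj s)"
        unfolding \<gamma>s using \<beta>E sE by (simp add: conj.hom_mult)
      moreover obtain g where g: "\<gamma> * conj \<gamma> = of_int g" using norm_int AD(1)[OF \<gamma>A] by blast
      moreover obtain h where h: "\<beta> * conj \<beta> = of_int h" using norm_int[OF \<beta>O] .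
      ultimately have "complex_of_real (of_int g) = of_real (of_int h * (?u\<^sup>2 - of_int D * ?v\<^sup>2))"
        by simp
      hence "of_int g = of_int h * (?u\<^sup>2 - of_int D * ?v\<^sup>2)" unfolding of_real_eq_iff .
      from arg_cong[OF this, of abs]
      have "\<bar>of_int g :: real\<bar> = \<bar>of_int h\<bar> * \<bar>?u\<^sup>2 - of_int D * ?v\<^sup>2\<bar>" unfolding abs_mult .
      moreover have hnz: "h \<noteq> 0" using h \<beta>(2) \<beta>E conj.hom_nonzero by auto
      ultimately have "\<bar>of_int g :: real\<bar> < \<bar>of_int h\<bar>"
        using lt by simp
      hence "\<bar>g\<bar> < \<bar>h\<bar>" by linarith
      hence "nm \<gamma> < nm \<beta>" using nm[OF g[symmetric]] nm[OF h[symmetric]] by simp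
      hence "\<gamma> = 0" using min[OF \<gamma>A] by fastforce
      hence n\<alpha>: "of_nat n * \<alpha> = (of_int a + of_int b * r) * \<beta>" by (simp add: \<gamma>_def)
      have "n dvd fact M" using n dvd_fact[of n M] by simp
      then obtain c' :: nat where "fact M = n * c'" by (rule dvdE)
      hence c: "m = int n * int c'" unfolding m_def by (metis of_nat_fact of_nat_mult)
      have "of_int m * \<alpha> = of_int (int c') * (of_nat n * \<alpha>)" unfolding c by simp
      hence "of_int m * \<alpha> / \<beta> = of_int (int c') * (of_int a + of_int b * r)"
        unfolding n\<alpha> using \<beta>(2) by simp
      also have "\<dots> \<in> OK" by (rule ext.integers_closed(2)[OF ext.integers_closed(5) OK_I])
      finally show ?thesis .
    qed
    define B where "B = (\<lambda>\<alpha>. of_int m * \<alpha> / \<beta>) ` A"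
    have "ideal B (ring_of_integers E)"
      unfolding ext.ideal_ring_of_integers_iff
    proof (intro conjI ballI)
      show "B \<subseteq> OK" using key by (auto simp: B_def)
      show "0 \<in> B" using AD(2) by (auto simp: B_def image_iff intro!: bexI[of _ 0])
      fix x y assume "x \<in> B" "y \<in> B"
      then obtain x' y' where "x = of_int m * x' / \<beta>" "y = of_int m * y' / \<beta>" "x' \<in> A" "y' \<in> A"
        by (auto simp: B_def)
      thus "x + y \<in> B" unfolding B_def using AD(3)
        by (intro image_eqI[of _ _ "x' + y'"]) (auto simp: distrib_left add_divide_distrib)
    next
      fix c x assume "c \<in> OK" "x \<in> B"
      then obtain x' where "x = of_int m * x' / \<beta>" "x' \<in> A" by (auto simp: B_def)
      thus "c * x \<in> B" unfolding B_def using AD(4)[OF \<open>c \<in> OK\<close>]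
        by (intro image_eqI[of _ _ "c * x'"]) (auto simp: mult.left_commute[of c])
    qed
    moreover have "of_int m \<in> B"
      unfolding B_def using \<beta> by (intro image_eqI[of _ _ \<beta>]) auto
    moreover have "(\<lambda>x. of_int m * x) ` A = (\<lambda>x. \<beta> * x) ` B"
      using \<beta>(2) by (simp add: B_def image_image)
    ultimately show ?thesis using \<beta>O \<beta>(2) by blast
  qed
  moreover have "m \<noteq> 0" by (simp add: m_def)
  ultimately show ?thesis by blast
qed

lemma finite_class_group: "finite (carrier (ideal_class_group E))"
proof -
  obtain M :: int where M: "M \<noteq> 0"
    "\<And>A. ideal A (ring_of_integers E) \<Longrightarrow> A \<noteq> {0} \<Longrightarrow>
       \<exists>\<beta> B. \<beta> \<in> OK \<and> \<beta> \<noteq> 0 \<and> ideal B (ring_of_integers E) \<and> of_int M \<in> B \<and>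
         (\<lambda>x. of_int M * x) ` A = (\<lambda>x. \<beta> * x) ` B"
    using equivalent_ideal_containing by meson
  have "carrier (ideal_class_group E) \<subseteq>
      (\<lambda>B. PI #>\<^bsub>IG\<^esub> B) ` {J. ideal J (ring_of_integers E) \<and> of_int M \<in> J}"
  proof
    fix c assume "c \<in> carrier (ideal_class_group E)"
    then obtain I where I: "I \<in> carrier IG" "c = PI #>\<^bsub>IG\<^esub> I"
      unfolding ideal_class_group_def carrier_FactGroup by auto
    then obtain J a where J: "ideal J (ring_of_integers E)" "J \<noteq> {0}" "a \<in> E" "a \<noteq> 0" "I = (\<lambda>x. a * x) ` J"
      by (auto simp: fractional_ideal_iff)
    obtain \<beta> B where B: "\<beta> \<in> OK" "\<beta> \<noteq> 0" "ideal B (ring_of_integers E)" "of_int M \<in> B"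
         "(\<lambda>x. of_int M * x) ` J = (\<lambda>x. \<beta> * x) ` B" using M(2)[OF J(1,2)] by blast
    have "B \<noteq> {0}" using B(4) M(1) by auto
    hence BI: "B \<in> carrier IG" using fractional_ideal_ideal[OF B(3)] by simp
    define e where "e = a / of_int M * \<beta>"
    have e: "e \<in> E" "e \<noteq> 0" using J B M(1) by (auto simp: e_def)
    have "I = (\<lambda>x. a / of_int M * x) ` (\<lambda>x. of_int M * x) ` J"
      unfolding scale_scale J(5) using M(1) by simp
    also have "\<dots> = (\<lambda>x. e * 1 * x) ` B" unfolding B(5) scale_scale by (simp add: e_def)
    also have "\<dots> = set_prod ((\<lambda>x. e * x) ` OK) ((\<lambda>x. 1 * x) ` B)"
      by (rule set_prod_principal[OF B(3), symmetric])
    finally have "I = set_prod ((\<lambda>x. e * x) ` OK) B" by simp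
    hence "I \<in> PI #>\<^bsub>IG\<^esub> B" using principal_I[OF e] unfolding r_coset_def by auto
    hence "PI #>\<^bsub>IG\<^esub> B = c" using IG.repr_independence[OF _ BI subgroup_PI] I(2) by simp
    thus "c \<in> (\<lambda>B. PI #>\<^bsub>IG\<^esub> B) ` {J. ideal J (ring_of_integers E) \<and> of_int M \<in> J}"
      using B by blast
  qed
  thus ?thesis using finite_ideals_containing[OF M(1)] finite_surj by blast
qed

lemma class_pow:
  assumes "I \<in> carrier IG"
  shows "(PI #>\<^bsub>IG\<^esub> I) [^]\<^bsub>ideal_class_group E\<^esub> (n::nat) = PI #>\<^bsub>IG\<^esub> (I [^]\<^bsub>IG\<^esub> n)"
proof -
  interpret C: comm_group "ideal_class_group E" by (rule comm_group_class_group)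
  have hom: "(\<lambda>a. PI #>\<^bsub>IG\<^esub> a) \<in> hom IG (ideal_class_group E)"
    unfolding ideal_class_group_def by (rule normal.r_coset_hom_Mod[OF normal_PI])
  have one: "PI #>\<^bsub>IG\<^esub> \<one>\<^bsub>IG\<^esub> = \<one>\<^bsub>ideal_class_group E\<^esub>"
    unfolding ideal_class_group_def one_FactGroup
    using IG.coset_join2[OF IG.one_closed subgroup_PI subgroup.one_closed[OF subgroup_PI]] .
  show ?thesis
  proof (induction n)
    case 0
    then show ?case using one by simp
  next
    case (Suc n)
    then show ?case using hom_mult[OF hom IG.nat_pow_closed[OF assms] assms, of n] by simp
  qed
qed

text \<open>Finiteness makes the order of the class of \<open>I\<close> positive. That order is then
  \<open>4 * k\<close>, and the \<open>k\<close>-th power has order 4.\<close>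

lemma exists_class_of_order_4:
  assumes I: "I \<in> carrier IG"
    and pow: "\<And>n. n > 0 \<Longrightarrow> I [^]\<^bsub>IG\<^esub> (n::nat) \<in> PI \<Longrightarrow> 4 dvd n"
  shows "\<exists>c\<in>carrier (ideal_class_group E). group.ord (ideal_class_group E) c = 4"
proof -
  interpret C: comm_group "ideal_class_group E" by (rule comm_group_class_group)
  define c where "c = PI #>\<^bsub>IG\<^esub> I"
  have c: "c \<in> carrier (ideal_class_group E)"
    using I unfolding c_def ideal_class_group_def carrier_FactGroup by blast
  have pos: "C.ord c > 0" using C.ord_ge_1[OF finite_class_group c] by simp
  have "PI #>\<^bsub>IG\<^esub> (I [^]\<^bsub>IG\<^esub> C.ord c) = PI"
    using C.pow_ord_eq_1[OF c] class_pow[OF I, of "C.ord c"]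
    unfolding c_def[symmetric] by (simp add: ideal_class_group_def)
  hence "I [^]\<^bsub>IG\<^esub> C.ord c \<in> PI"
    by (rule IG.coset_join1[OF _ IG.nat_pow_closed[OF I] subgroup_PI])
  hence "4 dvd C.ord c" using pow pos by blast
  then obtain k where k: "C.ord c = 4 * k" by blast
  have "C.ord (c [^]\<^bsub>ideal_class_group E\<^esub> k) = 4"
    using C.ord_pow[OF c, of k] k pos by simp
  thus ?thesis using C.nat_pow_closed[OF c] by blast
qed

section \<open>Conjugates and powers of ideals; the ideal over 3\<close>

lemma conj_set_prod:
  assumes "A \<subseteq> E" "B \<subseteq> E"
  shows "conj ` set_prod A B = set_prod (conj ` A) (conj ` B)"
proof
  have sub: "set_prod A B \<subseteq> E" by (rule set_prod_subset) (use assms in auto)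
  have "set_prod A B \<subseteq> {x \<in> E. conj x \<in> set_prod (conj ` A) (conj ` B)}"
  proof (rule set_prod_subset)
    fix i j assume "i \<in> A" "j \<in> B"
    hence "i \<in> E" "j \<in> E" "conj i * conj j \<in> set_prod (conj ` A) (conj ` B)"
      using assms by (auto intro: set_prod_intros(1))
    thus "i * j \<in> {x \<in> E. conj x \<in> set_prod (conj ` A) (conj ` B)}" by (simp add: conj.hom_mult)
  next
    fix x y assume "x \<in> {x \<in> E. conj x \<in> set_prod (conj ` A) (conj ` B)}"
       "y \<in> {x \<in> E. conj x \<in> set_prod (conj ` A) (conj ` B)}"
    thus "x + y \<in> {x \<in> E. conj x \<in> set_prod (conj ` A) (conj ` B)}"
      using set_prod_intros(2) by (simp add: conj.hom_add)
  qed
  thus "conj ` set_prod A B \<subseteq> set_prod (conj ` A) (conj ` B)" by blast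
  show "set_prod (conj ` A) (conj ` B) \<subseteq> conj ` set_prod A B"
  proof (rule set_prod_subset)
    fix i j assume "i \<in> conj ` A" "j \<in> conj ` B"
    then obtain i' j' where "i = conj i'" "j = conj j'" "i' \<in> A" "j' \<in> B" by blast
    moreover from this have "i' \<in> E" "j' \<in> E" using assms by auto
    ultimately have "i * j = conj (i' * j')" "i' \<in> A" "j' \<in> B" by (simp_all add: conj.hom_mult)
    thus "i * j \<in> conj ` set_prod A B" using set_prod_intros(1) by (metis image_eqI)
  next
    fix x y assume "x \<in> conj ` set_prod A B" "y \<in> conj ` set_prod A B"
    then obtain x' y' where "x = conj x'" "y = conj y'" "x' \<in> set_prod A B" "y' \<in> set_prod A B" by blast
    moreover from this have "x' \<in> E" "y' \<in> E" using sub by auto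
    ultimately have "x + y = conj (x' + y')" "x' \<in> set_prod A B" "y' \<in> set_prod A B"
      by (simp_all add: conj.hom_add)
    thus "x + y \<in> conj ` set_prod A B" using set_prod_intros(2) by (metis image_eqI)
  qed
qed

lemma IG_pow_ideal:
  assumes "ideal J (ring_of_integers E)" "J \<noteq> {0}"
  shows "ideal (J [^]\<^bsub>IG\<^esub> (n::nat)) (ring_of_integers E)"
proof (induction n)
  case 0
  show ?case using ideal_OK by simp
next
  case (Suc n)
  show ?case using ideal_set_prod[OF Suc assms(1)] by simp
qed

lemma IG_pow_mem: "a \<in> J \<Longrightarrow> a ^ n \<in> J [^]\<^bsub>IG\<^esub> (n::nat)"
  by (induction n) (auto simp: mult.commute[of a] simp del: power_Suc simp add: power_Suc2 intro: set_prod_intros(1))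

lemma IG_pow_conj:
  assumes "ideal J (ring_of_integers E)" "J \<noteq> {0}"
  shows "conj ` (J [^]\<^bsub>IG\<^esub> (n::nat)) = (conj ` J) [^]\<^bsub>IG\<^esub> n"
proof (induction n)
  case 0
  have "conj ` OK = OK"
  proof
    show "conj ` OK \<subseteq> OK" using conj_OK by blast
    show "OK \<subseteq> conj ` OK"
    proof
      fix x assume "x \<in> OK"
      thus "x \<in> conj ` OK" using conj_OK[of x] conj_conj[of x] by (metis (no_types, lifting) image_eqI mem_Collect_eq)
    qed
  qed
  thus ?case by simp
next
  case (Suc n)
  have "J [^]\<^bsub>IG\<^esub> n \<subseteq> E" "J \<subseteq> E"
    using ext.idealD(1)[OF IG_pow_ideal[OF assms]] ext.idealD(1)[OF assms(1)] by auto
  thus ?case using Suc conj_set_prod by simp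
qed

lemma IG_pow_principal:
  "((\<lambda>x. c * x) ` OK) [^]\<^bsub>IG\<^esub> (n::nat) = (\<lambda>x. c ^ n * x) ` OK"
proof (induction n)
  case (Suc n)
  thus ?case using set_prod_principal[OF ideal_OK, of "c ^ n" c] by (simp add: mult.commute[of c])
qed simp

lemma conj_nonzero_ideal:
  assumes "ideal J (ring_of_integers E)" "J \<noteq> {0}"
  shows "conj ` J \<noteq> {0}"
proof -
  obtain x where x: "x \<in> J" "x \<noteq> 0" using assms(2) ext.idealD(2)[OF assms(1)] by auto
  hence "conj x \<noteq> 0" using conj.hom_nonzero[of x] ext.idealD(1)[OF assms(1)] by auto
  thus ?thesis using x(1) by (metis image_eqI singletonD)
qed

text \<open>The ideal generated by 3 and \<open>1 + r\<close>. When \<open>D\<close> is 1 modulo 3,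
  its product with its conjugate is generated by 3, and neither is the whole ring.\<close>

definition prime3 :: "complex set" where
  "prime3 = {3 * x + (1 + r) * y | x y. x \<in> OK \<and> y \<in> OK}"

lemma prime3_I: "x \<in> OK \<Longrightarrow> y \<in> OK \<Longrightarrow> 3 * x + (1 + r) * y \<in> prime3"
  by (auto simp: prime3_def)

lemma ideal_prime3: "ideal prime3 (ring_of_integers E)"
  unfolding ext.ideal_ring_of_integers_iff
proof (intro conjI ballI)
  have "3 * x + (1 + r) * y \<in> OK" if "x \<in> OK" "y \<in> OK" for x y
  proof -
    have "of_int 3 * x + (of_int 1 + of_int 1 * r) * y \<in> OK"
      by (intro ext.integers_closed(1) ext.integers_closed(2) ext.integers_closed(5) r_OK that)
    thus ?thesis by simp
  qed
  thus "prime3 \<subseteq> OK" unfolding prime3_def by blast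
  show "0 \<in> prime3" using prime3_I[of 0 0] ext.integers_closed(6) by simp
  fix u v assume "u \<in> prime3" "v \<in> prime3"
  then obtain x y x' y' where *: "u = 3 * x + (1 + r) * y" "v = 3 * x' + (1 + r) * y'"
    "x \<in> OK" "y \<in> OK" "x' \<in> OK" "y' \<in> OK" unfolding prime3_def by blast
  have "u + v = 3 * (x + x') + (1 + r) * (y + y')" unfolding * by (simp only: distrib_left add_ac)
  moreover have "3 * (x + x') + (1 + r) * (y + y') \<in> prime3"
    by (intro prime3_I ext.integers_closed(1) *)
  ultimately show "u + v \<in> prime3" by (simp only:)
next
  fix c u assume c: "c \<in> OK" and "u \<in> prime3"
  then obtain x y where *: "u = 3 * x + (1 + r) * y" "x \<in> OK" "y \<in> OK" unfolding prime3_def by blast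
  have "c * u = 3 * (c * x) + (1 + r) * (c * y)" unfolding * by (simp only: distrib_left mult.left_commute[of c])
  moreover have "3 * (c * x) + (1 + r) * (c * y) \<in> prime3"
    by (intro prime3_I ext.integers_closed(2) * c)
  ultimately show "c * u \<in> prime3" by (simp only:)
qed

lemma three_in_prime3: "3 \<in> prime3"
  using prime3_I[of 1 0] ext.integers_closed(6,7) by simp

lemma prime3_nonzero: "prime3 \<noteq> {0}"
  using three_in_prime3 by auto

lemma conj_prime3: "conj ` prime3 = {3 * x + (1 - r) * y | x y. x \<in> OK \<and> y \<in> OK}"
proof
  have *: "conj (3 * x + (1 + r) * y) = 3 * conj x + (1 - r) * conj y" if "x \<in> OK" "y \<in> OK" for x y
    using that gen_in by (simp add: conj.hom_add conj.hom_mult)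
  show "conj ` prime3 \<subseteq> {3 * x + (1 - r) * y | x y. x \<in> OK \<and> y \<in> OK}"
    using * conj_OK unfolding prime3_def by blast
  show "{3 * x + (1 - r) * y | x y. x \<in> OK \<and> y \<in> OK} \<subseteq> conj ` prime3"
  proof
    fix u assume "u \<in> {3 * x + (1 - r) * y | x y. x \<in> OK \<and> y \<in> OK}"
    then obtain x y where xy: "u = 3 * x + (1 - r) * y" "x \<in> OK" "y \<in> OK" by blast
    hence "u = conj (3 * conj x + (1 + r) * conj y)" using *[OF conj_OK conj_OK, of x y] by simp
    thus "u \<in> conj ` prime3" using prime3_I[OF conj_OK conj_OK, of x y] xy by blast
  qed
qed

text \<open>The generator \<open>z\<close> times its conjugate generates the same ideal as
  \<open>3 ^ n\<close>, which fixes the norm up to sign. The trace statement expresses that powers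
  of the ideal stay coprime to its conjugate: if 3 divided the trace, \<open>z * z\<close> would be
  a multiple of 3, hence in the conjugate ideal.\<close>

lemma gen_power_principal:
  assumes D: "[D = 1] (mod 3)" and n: "n > 0" and pow: "prime3 [^]\<^bsub>IG\<^esub> (n::nat) \<in> PI"
  obtains z a where "z \<in> OK" "z + conj z = of_int a" "\<not> 3 dvd a"
    "z * conj z = 3 ^ n \<or> z * conj z = - (3 ^ n)"
proof -
  obtain k where k: "1 - D = 3 * k"
    using D by (metis cong_iff_dvd_diff cong_sym dvdE)
  have rr: "(1 + r) * (1 - r) = 3 * of_int k"
  proof -
    have "(1 + r) * (1 - r) = of_int (1 - D)"
      using gen_sq by (simp add: algebra_simps power2_eq_square)
    thus ?thesis unfolding k by simp
  qed
  define J where "J = conj ` prime3"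
  have J_eq: "J = {3 * x + (1 - r) * y | x y. x \<in> OK \<and> y \<in> OK}"
    unfolding J_def by (rule conj_prime3)
  have J: "ideal J (ring_of_integers E)" unfolding J_def by (rule ideal_conj[OF ideal_prime3])
  note JD = ext.idealD[OF J]
  have JI: "3 * x + (1 - r) * y \<in> J" if "x \<in> OK" "y \<in> OK" for x y
    unfolding J_eq using that by blast
  have r1: "1 - r \<in> OK" "1 + r \<in> OK" using OK_I[of 1 "-1"] OK_I[of 1 1] by simp_all
  have nat_OK: "numeral w \<in> OK" for w using ext.integers_closed(5)[of "numeral w"] by simp
  note cl = ext.integers_closed
  \<comment> \<open>If 1 were in the conjugate ideal, multiplication by \<open>1 + r\<close> would
    make \<open>1 + r\<close> a multiple of 3 in \<open>OK\<close>, but the trace of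
    \<open>(1 + r) / 3\<close> is 2/3.\<close>
  have notin: "1 \<notin> J"
  proof
    assume "1 \<in> J"
    then obtain x y where xy: "1 = 3 * x + (1 - r) * y" "x \<in> OK" "y \<in> OK"
      unfolding J_eq by blast
    define w where "w = (1 + r) * x + of_int k * y"
    have w: "w \<in> OK" unfolding w_def by (intro cl(1) cl(2) cl(5) r1 xy)
    have "1 + r = (1 + r) * (3 * x + (1 - r) * y)" using xy(1) by simp
    also have "\<dots> = 3 * ((1 + r) * x) + ((1 + r) * (1 - r)) * y"
    proof -
      have "p * (3 * x + q * y) = 3 * (p * x) + (p * q) * y" for p q :: complex
        by (simp add: algebra_simps)
      thus ?thesis .
    qed
    also have "\<dots> = 3 * w" unfolding rr w_def by (simp only: distrib_left mult_ac)
    finally have "w = 1 / 3 + 1 / 3 * r" by (simp add: field_simps)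
    moreover have "c0 (1 / 3 + 1 / 3 * r) = 1 / 3" by (rule coords) auto
    ultimately have "c0 w = 1 / 3" by (simp only:)
    moreover obtain a where "w + conj w = of_int a" using trace_int[OF w] .
    ultimately have "of_int a = 2 * (1 / 3 :: complex)" using trace_eq[of w] w
      by (metis (no_types, lifting) mem_Collect_eq)
    hence "of_int (3 * a) = (of_int 2 :: complex)" by (simp add: mult.commute)
    hence "3 * a = 2" unfolding of_int_eq_iff .
    thus False by presburger
  qed
  have prod: "set_prod prime3 J = (\<lambda>x. 3 * x) ` OK"
  proof
    show "set_prod prime3 J \<subseteq> (\<lambda>x. 3 * x) ` OK"
    proof (rule set_prod_subset)
      fix i j assume "i \<in> prime3" "j \<in> J"
      then obtain x y x' y' where *: "i = 3 * x + (1 + r) * y" "j = 3 * x' + (1 - r) * y'"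
        "x \<in> OK" "y \<in> OK" "x' \<in> OK" "y' \<in> OK" unfolding J_eq prime3_def by blast
      have "i * j = 3 * (3 * (x * x')) + 3 * (x * (1 - r) * y') + 3 * ((1 + r) * y * x')
          + ((1 + r) * (1 - r)) * (y * y')"
      proof -
        have "(3 * x + p * y) * (3 * x' + q * y') =
            3 * (3 * (x * x')) + 3 * (x * q * y') + 3 * (p * y * x') + (p * q) * (y * y')" for p q :: complex
          by (simp add: algebra_simps)
        thus ?thesis unfolding *(1,2) .
      qed
      also have "\<dots> = 3 * (3 * (x * x') + x * (1 - r) * y' + (1 + r) * y * x' + of_int k * (y * y'))"
        unfolding rr by (simp only: distrib_left mult_ac)
      also have "\<dots> \<in> (\<lambda>x. 3 * x) ` OK"
        by (intro imageI cl(1) cl(2) cl(5) r1 * nat_OK)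
      finally show "i * j \<in> (\<lambda>x. 3 * x) ` OK" .
    next
      fix x y assume "x \<in> (\<lambda>x. 3 * x) ` OK" "y \<in> (\<lambda>x. 3 * x) ` OK"
      then obtain x' y' where "x = 3 * x'" "y = 3 * y'" "x' \<in> OK" "y' \<in> OK" by blast
      thus "x + y \<in> (\<lambda>x. 3 * x) ` OK" using cl(1)[of x' y'] by (intro image_eqI[of _ _ "x' + y'"]) auto
    qed
    note P = ext.idealD[OF ideal_set_prod[OF ideal_prime3 J]]
    have m: "3 \<in> prime3" "1 + r \<in> prime3" "3 \<in> J" "1 - r \<in> J"
      using prime3_I[of 0 1] JI[of 1 0] JI[of 0 1] three_in_prime3 cl(6,7) by simp_all
    \<comment> \<open>The sum of \<open>1 - r\<close> and \<open>1 + r\<close> is 2, so 9 and 6 lie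
      in the product, and with them 3.\<close>
    have "3 * 3 - (3 * (1 - r) + (1 + r) * 3) \<in> set_prod prime3 J"
      by (intro P(6) P(3) set_prod_intros(1) m)
    also have "3 * 3 - (3 * (1 - r) + (1 + r) * 3) = 3" by (simp add: algebra_simps)
    finally have "3 \<in> set_prod prime3 J" .
    thus "(\<lambda>x. 3 * x) ` OK \<subseteq> set_prod prime3 J"
      using P(4) by (auto simp: mult.commute[of 3])
  qed
  obtain z where z: "z \<in> E" "z \<noteq> 0" "prime3 [^]\<^bsub>IG\<^esub> n = (\<lambda>x. z * x) ` OK"
    using pow by (rule principal_E)
  have "z * 1 \<in> prime3 [^]\<^bsub>IG\<^esub> n" unfolding z(3) using cl(7) by (rule imageI)
  hence zO: "z \<in> OK" using ext.idealD(1)[OF IG_pow_ideal[OF ideal_prime3 prime3_nonzero], of z n] by simp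
  have "conj ` (prime3 [^]\<^bsub>IG\<^esub> n) = (\<lambda>x. conj z * x) ` OK"
  proof -
    have "conj ` (\<lambda>x. z * x) ` OK = (\<lambda>x. conj z * x) ` conj ` OK"
      unfolding image_image using z(1) by (intro image_cong) (auto simp: conj.hom_mult)
    also have "conj ` OK = OK"
      using IG_pow_conj[OF ideal_OK OK_nonzero, of 0] by simp
    finally show ?thesis unfolding z(3) .
  qed
  hence Jn: "J [^]\<^bsub>IG\<^esub> n = (\<lambda>x. conj z * x) ` OK"
    unfolding J_def IG_pow_conj[OF ideal_prime3 prime3_nonzero] .
  have IGc: "prime3 \<in> carrier IG" "J \<in> carrier IG"
    using fractional_ideal_ideal ideal_prime3 prime3_nonzero J conj_nonzero_ideal[OF ideal_prime3 prime3_nonzero]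
    by (auto simp: J_def)
  have "(\<lambda>x. z * conj z * x) ` OK = set_prod (prime3 [^]\<^bsub>IG\<^esub> n) (J [^]\<^bsub>IG\<^esub> n)"
    unfolding z(3) Jn by (rule set_prod_principal[OF ideal_OK, symmetric])
  also have "\<dots> = (prime3 \<otimes>\<^bsub>IG\<^esub> J) [^]\<^bsub>IG\<^esub> n"
    using IG.nat_pow_distrib[OF IGc, of n] by simp
  also have "\<dots> = (\<lambda>x. 3 ^ n * x) ` OK"
    using IG_pow_principal[of 3 n] prod by simp
  finally have eq: "(\<lambda>x. z * conj z * x) ` OK = (\<lambda>x. 3 ^ n * x) ` OK" .
  obtain e where e: "z * conj z = of_int e" using norm_int[OF zO] .
  have dvdI: "a dvd b" if b: "of_int b = of_int a * c" and c: "c \<in> OK" and "a \<noteq> 0" for a b :: int and c :: complex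
  proof -
    have "c = of_int b / of_int a" using that by simp
    hence "c \<in> \<rat>" by simp
    then obtain m where "c = of_int m" using c algebraic_int_rational[of c] by blast
    hence "(of_int b :: complex) = of_int (a * m)" using b by simp
    hence "b = a * m" unfolding of_int_eq_iff .
    thus ?thesis by simp
  qed
  have enz: "e \<noteq> 0" using e z conj.hom_nonzero[of z] by auto
  have "of_int e * 1 \<in> (\<lambda>x. 3 ^ n * x) ` OK" unfolding eq[symmetric] e using cl(7) by (rule imageI)
  then obtain c where "of_int e = of_int (3 ^ n) * c" "c \<in> OK" by auto
  hence d1: "3 ^ n dvd e" by (rule dvdI) simp
  have "3 ^ n * 1 \<in> (\<lambda>x. of_int e * x) ` OK" unfolding eq[unfolded e] using cl(7) by (rule imageI)
  then obtain c where "of_int (3 ^ n) = of_int e * c" "c \<in> OK" by auto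
  hence d2: "e dvd 3 ^ n" using enz by (rule dvdI)
  have "\<bar>e\<bar> = 3 ^ n" using zdvd_antisym_abs[OF d1 d2] by (simp add: power_abs)
  hence e_cases: "e = 3 ^ n \<or> e = - (3 ^ n)" by linarith
  obtain a where a: "z + conj z = of_int a" using trace_int[OF zO] .
  have "\<not> 3 dvd a"
  proof
    assume "3 dvd a"
    then obtain b where b: "a = 3 * b" by blast
    obtain m where m: "n = Suc m" using n by (cases n) auto
    have "e = 3 * (3 ^ m) \<or> e = 3 * (- (3 ^ m))" using e_cases unfolding m by simp
    then obtain f where f: "e = 3 * f" by blast
    have "z * z = z * (z + conj z) - z * conj z" by (simp add: algebra_simps)
    also have "\<dots> = 3 * (of_int b * z - of_int f)" unfolding a e b f by (simp add: algebra_simps)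
    finally have zz: "z * z = 3 * (of_int b * z - of_int f)" .
    \<comment> \<open>\<open>2 - r = 3 - (1 + r)\<close> lies in the ideal and is 1 modulo the
      conjugate ideal. So are all its powers, which contradicts that one of them lies in the
      conjugate ideal.\<close>
    define a0 where "a0 = 2 - r"
    have "a0 \<in> prime3" using prime3_I[OF cl(7) cl(4)[OF cl(7)]] by (simp add: a0_def)
    hence "a0 ^ n \<in> prime3 [^]\<^bsub>IG\<^esub> n" by (rule IG_pow_mem)
    then obtain c where c: "a0 ^ n = z * c" "c \<in> OK" unfolding z(3) by blast
    have "(a0 ^ n)\<^sup>2 = (z * z) * (c * c)" unfolding c(1) by (simp add: power2_eq_square mult_ac)
    also have "\<dots> = 3 * ((of_int b * z - of_int f) * (c * c)) + (1 - r) * 0" unfolding zz by simp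
    also have "\<dots> \<in> J" by (intro JI cl(2) cl(3) cl(5) cl(6) zO c(2))
    finally have mem: "a0 ^ (n * 2) \<in> J" unfolding power_mult .
    have a0O: "a0 \<in> OK" using OK_I[of 2 "-1"] by (simp add: a0_def)
    have "3 * 0 + (1 - r) * of_int (-1) \<in> J" by (intro JI cl(5) cl(6))
    hence s: "1 - a0 \<in> J" by (simp add: a0_def)
    have "1 - a0 ^ m \<in> J" for m
    proof (induction m)
      case (Suc m)
      have "(1 - a0) + a0 * (1 - a0 ^ m) \<in> J" by (intro JD(3) JD(4) s a0O Suc)
      thus ?case by (simp add: algebra_simps)
    qed (use JD(2) in simp)
    hence "(1 - a0 ^ (n * 2)) + a0 ^ (n * 2) \<in> J" using mem by (intro JD(3))
    thus False using notin by simp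
  qed
  moreover have "z * conj z = 3 ^ n \<or> z * conj z = - (3 ^ n)" using e e_cases by auto
  ultimately show ?thesis using that zO a by blast
qed

end

subsection \<open>Galois groups\<close>

lemma galois_group_carrier:
  assumes "complex_subfield L"
  shows "f \<in> carrier (galois_group K L) \<longleftrightarrow>
    f \<in> extensional L \<and> bij_betw f L L \<and> complex_hom L f \<and> (\<forall>x\<in>K. f x = x)"
  by (auto simp: galois_group_def Bij_def ring_hom_subfield_iff[OF assms] bij_betw_def)

lemma galois_group_mult:
  assumes "f \<in> carrier (galois_group K L)" "h \<in> carrier (galois_group K L)"
  shows "f \<otimes>\<^bsub>galois_group K L\<^esub> h = compose L f h"
  using assms by (simp add: galois_group_def BijGroup_def)

lemma group_galois_group:
  assumes L: "complex_subfield L" and K: "K \<subseteq> L"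
  shows "Group.group (galois_group K L)"
proof -
  interpret B: Group.group "BijGroup L" by (rule group_BijGroup)
  interpret L: complex_subfield L by (rule L)
  define H where "H = carrier (galois_group K L)"
  note car = galois_group_carrier[OF L, of _ K, folded H_def]
  have inB: "f \<in> H \<Longrightarrow> f \<in> Bij L" for f by (simp add: car Bij_def)
  have "subgroup H (BijGroup L)"
  proof (rule B.subgroupI)
    show "H \<subseteq> carrier (BijGroup L)" using inB by (auto simp: BijGroup_def)
    have "(\<lambda>x\<in>L. x) \<in> H" unfolding car using K
      by (auto simp: bij_betw_def inj_on_def complex_hom_def complex_hom_axioms_def L)
    thus "H \<noteq> {}" by blast
    fix f assume f: "f \<in> H"
    note F = f[unfolded car]
    interpret f: complex_hom L f using F by blast
    have bij: "bij_betw f L L" using F by blast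
    define h where "h = (\<lambda>x\<in>L. inv_into L f x)"
    have hB: "bij_betw h L L"
      unfolding h_def using bij_betw_inv_into[OF bij] by (simp cong: bij_betw_cong)
    have hL: "x \<in> L \<Longrightarrow> h x \<in> L" for x using hB bij_betwE by blast
    have fh: "x \<in> L \<Longrightarrow> f (h x) = x" for x
      unfolding h_def using bij by (simp add: bij_betw_inv_into_right)
    have uniq: "h x = y" if "f y = x" "y \<in> L" "x \<in> L" for x y
      using f.hom_inj[of "h x" y] that fh hL by simp
    have "complex_hom L h"
    proof
      show "h 1 = 1" by (rule uniq) auto
      fix x y assume xy: "x \<in> L" "y \<in> L"
      show "h (x + y) = h x + h y" by (rule uniq) (use xy fh hL in \<open>auto simp: f.hom_add\<close>)
      show "h (x * y) = h x * h y" by (rule uniq) (use xy fh hL in \<open>auto simp: f.hom_mult\<close>)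
    qed
    moreover have "\<forall>x\<in>K. h x = x" using uniq F K by blast
    ultimately have "h \<in> H" unfolding car using hB by (simp add: h_def)
    moreover have "inv\<^bsub>BijGroup L\<^esub> f = h"
      unfolding h_def using inB[OF f] by (rule inv_BijGroup)
    ultimately show "inv\<^bsub>BijGroup L\<^esub> f \<in> H" by simp
    fix h assume h: "h \<in> H"
    note G = h[unfolded car]
    interpret h: complex_hom L h using G by blast
    have hL: "x \<in> L \<Longrightarrow> h x \<in> L" for x using G bij_betwE by blast
    have "complex_hom L (compose L f h)"
      by unfold_locales (use hL in \<open>auto simp: compose_def f.hom_add f.hom_mult h.hom_add h.hom_mult\<close>)
    moreover have "\<forall>x\<in>K. compose L f h x = x" using F G K by (auto simp: compose_def)
    ultimately have "compose L f h \<in> H"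
      unfolding car using bij_betw_compose[of h L L f L] F G by (simp add: compose_def)
    thus "f \<otimes>\<^bsub>BijGroup L\<^esub> h \<in> H"
      using inB[OF f] inB[OF h] by (simp add: BijGroup_def)
  qed
  hence "Group.group (BijGroup L\<lparr>carrier := H\<rparr>)"
    by (rule B.subgroup_imp_group)
  thus ?thesis unfolding H_def by (simp add: galois_group_def)
qed

subsection \<open>The cyclic quartic extension\<close>

lemma odd_square_mod_8: "odd (n::int) \<Longrightarrow> n\<^sup>2 mod 8 = 1"
proof -
  assume "odd n"
  hence "n mod 8 \<in> {1, 3, 5, 7}" by simp presburger
  moreover have "n\<^sup>2 mod 8 = (n mod 8)\<^sup>2 mod 8" by (simp add: power_mod)
  ultimately show ?thesis by auto
qed

lemma rational_sqrt_int:
  fixes z :: complex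
  assumes "z \<in> \<rat>" "z\<^sup>2 = of_int n"
  obtains m where "n = m\<^sup>2"
proof -
  have "algebraic_int z" by (rule algebraic_int_quadratic[of 0 "of_int (- n)"]) (use assms in auto)
  then obtain m where "z = of_int m" using algebraic_int_rational assms(1) by blast
  hence "(of_int n :: complex) = of_int (m\<^sup>2)" using assms(2) by simp
  thus ?thesis using that unfolding of_int_eq_iff by blast
qed

lemma coprime_mult_square:
  fixes a b n :: int
  assumes "Rings.coprime a b" "a * b = n\<^sup>2"
  obtains m where "\<bar>a\<bar> = m\<^sup>2"
proof -
  have "nat \<bar>a\<bar> * nat \<bar>b\<bar> = (nat \<bar>n\<bar>)\<^sup>2"
    using assms(2) by (metis abs_mult nat_abs_mult_distrib nat_power_eq abs_ge_zero power_abs)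
  hence "is_nth_power 2 (nat \<bar>a\<bar> * nat \<bar>b\<bar>)" by (auto simp: is_nth_power_def)
  moreover have "Rings.coprime (nat \<bar>a\<bar>) (nat \<bar>b\<bar>)" using assms(1) by (simp flip: coprime_int_iff)
  ultimately have "is_nth_power 2 (nat \<bar>a\<bar>)"
    using is_nth_power_mult_coprime_nat_iff by blast
  then obtain m where "nat \<bar>a\<bar> = m\<^sup>2" by (auto simp: is_nth_power_def)
  hence "\<bar>a\<bar> = (int m)\<^sup>2" by (metis abs_ge_zero nat_0_le of_nat_power)
  thus ?thesis by (rule that)
qed

text \<open>Oddness makes \<open>4 * t + 9\<close> and \<open>t * (t - 4)\<close> both 5 modulo 8,
  which yields irrationality and integrality of halves; coprimality keeps \<open>s\<close> and
  \<open>g\<close> from lying in a common prime.\<close>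

locale c4_family =
  fixes t :: int
  assumes odd_t: "odd t" and coprime_t: "Rings.coprime (t * (t - 4)) (4 * t + 9)"
begin

definition D :: int where "D = t * (t - 4) * (4 * t + 9)"
definition r :: complex where "r = csqrt (of_int D)"
definition s :: complex where "s = csqrt (of_int (4 * t + 9))"
text \<open>\<open>g\<close> and \<open>\<rho>\<^sub>2\<close> are quotients instead of principal
  square roots, so that \<open>g * s = r\<close> and
  \<open>\<rho>\<^sub>1 * \<rho>\<^sub>2 = g\<close> hold without a choice of signs.\<close>

definition g :: complex where "g = r / s"
definition \<rho>\<^sub>1 :: complex where "\<rho>\<^sub>1 = csqrt ((of_int (2 * t - 3) + s) / 2)"
definition \<rho>\<^sub>2 :: complex where "\<rho>\<^sub>2 = g / \<rho>\<^sub>1"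

lemma r_sq: "r\<^sup>2 = of_int D" and s_sq: "s\<^sup>2 = of_int (4 * t + 9)"
  and \<rho>\<^sub>1_sq: "\<rho>\<^sub>1\<^sup>2 = (of_int (2 * t - 3) + s) / 2"
  unfolding r_def s_def \<rho>\<^sub>1_def by (rule power2_csqrt)+

lemma mod_8: "(4 * t + 9) mod 8 = 5" "(t * (t - 4)) mod 8 = 5" "D mod 8 = 1"
proof -
  show a: "(4 * t + 9) mod 8 = 5" using odd_t by presburger
  have "t * (t - 4) = (t - 2)\<^sup>2 - 4" by (simp add: power2_eq_square algebra_simps)
  moreover have "(t - 2)\<^sup>2 mod 8 = 1" using odd_t by (intro odd_square_mod_8) simp
  ultimately show b: "(t * (t - 4)) mod 8 = 5" by presburger
  have "D mod 8 = ((t * (t - 4)) mod 8 * ((4 * t + 9) mod 8)) mod 8"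
    unfolding D_def by (rule mod_mult_eq[symmetric])
  thus "D mod 8 = 1" unfolding a b by simp
qed

lemma not_square_mod_8:
  assumes "n mod 8 = (5::int)" shows "n \<noteq> m\<^sup>2"
proof
  assume n: "n = m\<^sup>2"
  show False
  proof (cases "odd m")
    case True
    then show ?thesis using odd_square_mod_8[of m] n assms by simp
  next
    case False
    hence "even n" using n by simp
    then show ?thesis using assms by presburger
  qed
qed

lemma nonzero: "s \<noteq> 0" "g \<noteq> 0" "\<rho>\<^sub>1 \<noteq> 0" "\<rho>\<^sub>2 \<noteq> 0" "r \<noteq> 0"
  and g_sq: "g\<^sup>2 = of_int (t * (t - 4))" and \<rho>\<^sub>2_sq: "\<rho>\<^sub>2\<^sup>2 = (of_int (2 * t - 3) - s) / 2"
proof -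
  have d: "4 * t + 9 \<noteq> 0" "t * (t - 4) \<noteq> 0" using mod_8 by fastforce+
  show s: "s \<noteq> 0" using s_sq d(1) by (metis of_int_0_eq_iff power_zero_numeral)
  have "g\<^sup>2 * s\<^sup>2 = of_int (t * (t - 4)) * s\<^sup>2"
    using s unfolding g_def by (simp add: power_divide r_sq s_sq D_def)
  thus g: "g\<^sup>2 = of_int (t * (t - 4))" using s by simp
  thus gnz: "g \<noteq> 0" using d(2) by (metis of_int_0_eq_iff power_zero_numeral)
  show "r \<noteq> 0" using gnz by (auto simp: g_def)
  have *: "((of_int (2 * t - 3) + s) / 2) * ((of_int (2 * t - 3) - s) / 2) = g\<^sup>2"
  proof -
    have "((a + b) / 2) * ((a - b) / 2) = (a\<^sup>2 - b\<^sup>2) / 4" for a b :: complex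
      by (simp add: power2_eq_square algebra_simps)
    hence "((of_int (2 * t - 3) + s) / 2) * ((of_int (2 * t - 3) - s) / 2) =
        ((of_int (2 * t - 3))\<^sup>2 - s\<^sup>2) / 4" .
    also have "\<dots> = of_int ((2 * t - 3)\<^sup>2 - (4 * t + 9)) / 4"
      unfolding s_sq of_int_diff[symmetric] of_int_power[symmetric] ..
    also have "(2 * t - 3)\<^sup>2 - (4 * t + 9) = 4 * (t * (t - 4))"
      by (simp add: power2_eq_square algebra_simps)
    finally show ?thesis unfolding g by simp
  qed
  hence **: "\<rho>\<^sub>1\<^sup>2 * ((of_int (2 * t - 3) - s) / 2) = g\<^sup>2" unfolding \<rho>\<^sub>1_sq .
  thus \<rho>: "\<rho>\<^sub>1 \<noteq> 0" using gnz by auto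
  show "\<rho>\<^sub>2 \<noteq> 0" using \<rho> gnz by (simp add: \<rho>\<^sub>2_def)
  show "\<rho>\<^sub>2\<^sup>2 = (of_int (2 * t - 3) - s) / 2"
    using ** \<rho> unfolding \<rho>\<^sub>2_def power_divide by (metis nonzero_mult_div_cancel_left power_not_zero)
qed

lemma prods: "\<rho>\<^sub>1 * \<rho>\<^sub>2 = g" "g * s = r" "\<rho>\<^sub>1\<^sup>2 - \<rho>\<^sub>2\<^sup>2 = s"
proof -
  show "\<rho>\<^sub>1 * \<rho>\<^sub>2 = g" using nonzero(3) by (simp add: \<rho>\<^sub>2_def)
  show "g * s = r" using nonzero(1) by (simp add: g_def)
  have "(a + b) / 2 - (a - b) / 2 = b" for a b :: complex by (simp add: field_simps)
  thus "\<rho>\<^sub>1\<^sup>2 - \<rho>\<^sub>2\<^sup>2 = s" unfolding \<rho>\<^sub>1_sq \<rho>\<^sub>2_sq .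
qed

lemma g_irrational: "g \<notin> \<rat>"
  using rational_sqrt_int[OF _ g_sq] not_square_mod_8[OF mod_8(2)] by metis

text \<open>Otherwise the coprime factors of \<open>D\<close> are squares up to sign; but plus or
  minus \<open>4 * t + 9\<close> is 5 or 3 modulo 8.\<close>

lemma r_irrational: "r \<notin> \<rat>"
proof
  assume "r \<in> \<rat>"
  then obtain n where n: "D = n\<^sup>2" using rational_sqrt_int r_sq by blast
  have "(4 * t + 9) * (t * (t - 4)) = n\<^sup>2" using n by (simp add: D_def mult.commute)
  moreover have "Rings.coprime (4 * t + 9) (t * (t - 4))" using coprime_t by (simp add: coprime_commute)
  ultimately obtain m where m: "\<bar>4 * t + 9\<bar> = m\<^sup>2" using coprime_mult_square by blast
  show False
  proof (cases "4 * t + 9 \<ge> 0")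
    case True
    then show ?thesis using not_square_mod_8[OF mod_8(1)] m by simp
  next
    case False
    hence *: "m\<^sup>2 = - (4 * t + 9)" using m by simp
    have "odd m"
    proof
      assume "even m"
      hence "even (m\<^sup>2)" by simp
      thus False unfolding * by simp
    qed
    hence "m\<^sup>2 mod 8 = 1" by (rule odd_square_mod_8)
    then show ?thesis using * mod_8(1) by presburger
  qed
qed

sublocale K: quad_field r D
  by (intro quad_field.intro quadratic_extension.intro complex_subfield_Rats
      quadratic_extension_axioms.intro quad_field_axioms.intro r_irrational r_sq)
    (simp add: r_sq)

abbreviation "K \<equiv> K.E"

lemma s_notin_K: "s \<notin> K"
proof
  assume s: "s \<in> K"
  have "s \<in> \<rat> \<or> s / r \<in> \<rat>" by (rule K.square_in_ext[OF s]) (simp add: s_sq)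
  thus False
  proof
    assume "s \<in> \<rat>"
    thus False using rational_sqrt_int[OF _ s_sq] not_square_mod_8[OF mod_8(1)] by metis
  next
    assume "s / r \<in> \<rat>"
    hence "inverse (s / r) \<in> \<rat>" by (rule Rats_inverse)
    thus False using g_irrational unfolding inverse_divide g_def by contradiction
  qed
qed

sublocale M: quadratic_extension K s
  by (intro quadratic_extension.intro K.ext.complex_subfield_axioms
      quadratic_extension_axioms.intro s_notin_K) (simp add: s_sq)

abbreviation "M \<equiv> M.E"

lemma r_K: "r \<in> K" by (rule K.gen_in)

lemma g_M: "g \<in> M"
  unfolding g_def using M.gen_in M.base_sub r_K by auto

lemma conj_g: "M.conj g = - g"
proof -
  have "M.conj (r / s) = M.conj r / M.conj s"
    using M.base_sub r_K M.gen_in by (intro M.conj.hom_divide) auto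
  thus ?thesis using r_K by (simp add: g_def)
qed

lemma \<beta>_M: "\<rho>\<^sub>1\<^sup>2 \<in> M" "M.conj (\<rho>\<^sub>1\<^sup>2) = \<rho>\<^sub>2\<^sup>2"
  unfolding \<rho>\<^sub>1_sq \<rho>\<^sub>2_sq using M.gen_in
  by (auto simp: M.conj.hom_divide M.conj.hom_add simp del: of_int_add of_int_diff of_int_mult)

text \<open>If \<open>\<rho>\<^sub>1\<close> were in \<open>M\<close>, its norm to \<open>K\<close>
  would be \<open>g\<close> or \<open>- g\<close>, but conjugation negates \<open>g\<close>.\<close>

lemma \<rho>_notin_M: "\<rho>\<^sub>1 \<notin> M"
proof
  assume \<rho>: "\<rho>\<^sub>1 \<in> M"
  define n where "n = \<rho>\<^sub>1 * M.conj \<rho>\<^sub>1"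
  have n: "n \<in> M" using \<rho> by (simp add: n_def)
  have "M.conj n = n" using \<rho> by (simp add: n_def M.conj.hom_mult mult.commute)
  moreover have "n\<^sup>2 = g\<^sup>2"
  proof -
    have "n\<^sup>2 = \<rho>\<^sub>1\<^sup>2 * M.conj (\<rho>\<^sub>1\<^sup>2)" using \<rho> by (simp add: n_def M.conj.hom_power power_mult_distrib)
    thus ?thesis unfolding \<beta>_M by (simp add: prods(1) flip: power_mult_distrib)
  qed
  hence "n = g \<or> n = - g" by (simp add: power2_eq_iff)
  hence "M.conj n = - n" using conj_g g_M by (auto simp: M.conj.hom_uminus)
  ultimately have "n = 0" by simp
  with \<open>n\<^sup>2 = g\<^sup>2\<close> nonzero show False by simp
qed

sublocale L: quadratic_extension M \<rho>\<^sub>1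
  by (intro quadratic_extension.intro M.ext.complex_subfield_axioms
      quadratic_extension_axioms.intro \<rho>_notin_M \<beta>_M)

abbreviation "L \<equiv> L.E"

lemma subs: "K \<subseteq> M" "M \<subseteq> L" "K \<subseteq> L"
  using M.base_sub L.base_sub by auto

lemma in_L: "s \<in> L" "g \<in> L" "\<rho>\<^sub>1 \<in> L" "\<rho>\<^sub>2 \<in> L" "r \<in> L"
  using g_M M.gen_in L.gen_in subs r_K by (auto simp: \<rho>\<^sub>2_def)

lemma hom_eq_L:
  assumes "complex_hom L \<tau>" "complex_hom L \<sigma>" "\<And>x. x \<in> K \<Longrightarrow> \<tau> x = \<sigma> x" "\<tau> s = \<sigma> s" "\<tau> \<rho>\<^sub>1 = \<sigma> \<rho>\<^sub>1" "z \<in> L"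
  shows "\<tau> z = \<sigma> z"
proof -
  have *: "complex_hom M \<tau>" if "complex_hom L \<tau>" for \<tau>
  proof -
    interpret complex_hom L \<tau> by fact
    show ?thesis by unfold_locales (auto intro!: hom_add hom_mult subsetD[OF subs(2)])
  qed
  have "\<tau> x = \<sigma> x" if "x \<in> M" for x
    by (rule M.hom_eq_on_E[OF *[OF assms(1)] *[OF assms(2)]]) (use assms(3,4) that in auto)
  thus ?thesis using L.hom_eq_on_E[OF assms(1,2) _ assms(5,6)] by blast
qed

definition \<sigma> :: "complex \<Rightarrow> complex" where "\<sigma> = L.lift_hom M.conj \<rho>\<^sub>2"

lemma \<sigma>_hom: "complex_hom L \<sigma>"
  and \<sigma>_M: "x \<in> M \<Longrightarrow> \<sigma> x = M.conj x" and \<sigma>_\<rho>\<^sub>1: "\<sigma> \<rho>\<^sub>1 = \<rho>\<^sub>2"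
  unfolding \<sigma>_def using L.lift_hom[OF M.conj.complex_hom_axioms, of \<rho>\<^sub>2] \<beta>_M(2) by simp_all

sublocale \<sigma>: complex_hom L \<sigma> by (rule \<sigma>_hom)

lemma \<sigma>_K: "x \<in> K \<Longrightarrow> \<sigma> x = x"
  using \<sigma>_M subs by auto

lemma \<sigma>_s: "\<sigma> s = - s"
  using \<sigma>_M M.gen_in by simp

lemma \<sigma>_\<rho>\<^sub>2: "\<sigma> \<rho>\<^sub>2 = - \<rho>\<^sub>1"
proof -
  have "\<sigma> \<rho>\<^sub>2 = \<sigma> g / \<sigma> \<rho>\<^sub>1" unfolding \<rho>\<^sub>2_def using in_L by (intro \<sigma>.hom_divide)
  also have "\<dots> = - g / \<rho>\<^sub>2" using \<sigma>_M g_M conj_g \<sigma>_\<rho>\<^sub>1 by simp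
  also have "\<dots> = - \<rho>\<^sub>1" using nonzero prods(1) by (simp add: field_simps)
  finally show ?thesis .
qed

lemma \<sigma>_L: "z \<in> L \<Longrightarrow> \<sigma> z \<in> L"
proof -
  assume "z \<in> L"
  then obtain u v where uv: "z = u + v * \<rho>\<^sub>1" "u \<in> M" "v \<in> M" by (auto simp: L.E_def)
  hence "u \<in> L" "v \<in> L" "\<rho>\<^sub>1 \<in> L" using subs in_L by auto
  hence "\<sigma> z = M.conj u + M.conj v * \<rho>\<^sub>2" using uv by (simp add: \<sigma>.hom_add \<sigma>.hom_mult \<sigma>_M \<sigma>_\<rho>\<^sub>1)
  moreover have "M.conj u \<in> L" "M.conj v \<in> L" using uv subs M.conj_in by auto
  ultimately show ?thesis using in_L by auto
qed

lemma complex_hom_comp: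
  assumes "complex_hom L f" "complex_hom L h" "\<And>x. x \<in> L \<Longrightarrow> h x \<in> L"
  shows "complex_hom L (\<lambda>x. f (h x))"
proof -
  interpret f: complex_hom L f by fact
  interpret h: complex_hom L h by fact
  show ?thesis by unfold_locales (use assms(3) in \<open>auto simp: f.hom_add f.hom_mult h.hom_add h.hom_mult\<close>)
qed

lemma \<sigma>2_hom: "complex_hom L (\<lambda>x. \<sigma> (\<sigma> x))"
  by (rule complex_hom_comp[OF \<sigma>_hom \<sigma>_hom \<sigma>_L])

lemma \<sigma>3_hom: "complex_hom L (\<lambda>x. \<sigma> (\<sigma> (\<sigma> x)))"
  by (rule complex_hom_comp[OF \<sigma>2_hom \<sigma>_hom \<sigma>_L])

lemma \<sigma>4_hom: "complex_hom L (\<lambda>x. \<sigma> (\<sigma> (\<sigma> (\<sigma> x))))"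
  by (rule complex_hom_comp[OF \<sigma>3_hom \<sigma>_hom \<sigma>_L])

lemma \<sigma>_uminus: "\<sigma> (- s) = s" "\<sigma> (- \<rho>\<^sub>1) = - \<rho>\<^sub>2" "\<sigma> (- \<rho>\<^sub>2) = \<rho>\<^sub>1"
  using in_L by (simp_all add: \<sigma>.hom_uminus \<sigma>_s \<sigma>_\<rho>\<^sub>1 \<sigma>_\<rho>\<^sub>2)

lemma \<sigma>4: "z \<in> L \<Longrightarrow> \<sigma> (\<sigma> (\<sigma> (\<sigma> z))) = z"
  by (rule hom_eq_L[OF \<sigma>4_hom complex_hom_id])
     (auto simp: \<sigma>_K \<sigma>_s \<sigma>_\<rho>\<^sub>1 \<sigma>_\<rho>\<^sub>2 \<sigma>_uminus L.ext.complex_subfield_axioms)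

lemma \<sigma>2: "z \<in> L \<Longrightarrow> \<sigma> (\<sigma> z) = L.conj z"
  by (rule hom_eq_L[OF \<sigma>2_hom L.conj.complex_hom_axioms])
     (use subs M.gen_in in \<open>auto simp: \<sigma>_K \<sigma>_s \<sigma>_\<rho>\<^sub>1 \<sigma>_\<rho>\<^sub>2 \<sigma>_uminus\<close>)

abbreviation "G \<equiv> galois_group K L"

definition \<sigma>' where "\<sigma>' = restrict \<sigma> L"

lemma \<sigma>'_G: "\<sigma>' \<in> carrier G"
proof -
  have "bij_betw \<sigma>' L L"
    unfolding \<sigma>'_def bij_betw_def
  proof
    show "inj_on (restrict \<sigma> L) L" using \<sigma>.hom_inj by (auto simp: inj_on_def)
    show "restrict \<sigma> L ` L = L"
    proof
      show "restrict \<sigma> L ` L \<subseteq> L" using \<sigma>_L by auto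
      show "L \<subseteq> restrict \<sigma> L ` L"
      proof
        fix z assume z: "z \<in> L"
        have "z = restrict \<sigma> L (\<sigma> (\<sigma> (\<sigma> z)))" using \<sigma>4[OF z] \<sigma>_L z by simp
        thus "z \<in> restrict \<sigma> L ` L" using \<sigma>_L z by blast
      qed
    qed
  qed
  moreover have "complex_hom L \<sigma>'"
    by unfold_locales (auto simp: \<sigma>'_def \<sigma>.hom_add \<sigma>.hom_mult)
  ultimately show ?thesis
    unfolding galois_group_carrier[OF L.ext.complex_subfield_axioms]
    using \<sigma>_K subs by (auto simp: \<sigma>'_def)
qed

text \<open>An automorphism sends \<open>s\<close> to \<open>s\<close> or \<open>- s\<close>, and
  \<open>\<rho>\<^sub>1\<close> accordingly to a square root of
  \<open>\<rho>\<^sub>1\<^sup>2\<close> or \<open>\<rho>\<^sub>2\<^sup>2\<close>. The four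
  combinations are realised by the powers of \<open>\<sigma>'\<close> with exponents 0 to 3.\<close>

lemma cyclic_G: "cyclic_group G"
proof -
  interpret G: Group.group G by (rule group_galois_group[OF L.ext.complex_subfield_axioms subs(3)])
  have one: "\<one>\<^bsub>G\<^esub> = (\<lambda>x\<in>L. x)" by (simp add: galois_group_def BijGroup_def)
  note mult = galois_group_mult[of _ K L]
  have p1: "\<sigma>' [^]\<^bsub>G\<^esub> (1::nat) = restrict \<sigma> L" using \<sigma>'_G by (simp add: \<sigma>'_def)
  have p2: "\<sigma>' [^]\<^bsub>G\<^esub> (2::nat) = (\<lambda>x\<in>L. \<sigma> (\<sigma> x))"
  proof -
    have "\<sigma>' [^]\<^bsub>G\<^esub> (2::nat) = \<sigma>' \<otimes>\<^bsub>G\<^esub> \<sigma>'" using \<sigma>'_G by (simp add: numeral_2_eq_2)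
    also have "\<dots> = compose L \<sigma>' \<sigma>'" by (rule mult[OF \<sigma>'_G \<sigma>'_G])
    also have "\<dots> = (\<lambda>x\<in>L. \<sigma> (\<sigma> x))"
      unfolding compose_def \<sigma>'_def by (rule restrict_ext) (simp add: \<sigma>_L)
    finally show ?thesis .
  qed
  have p3: "\<sigma>' [^]\<^bsub>G\<^esub> (3::nat) = (\<lambda>x\<in>L. \<sigma> (\<sigma> (\<sigma> x)))"
  proof -
    have "\<sigma>' [^]\<^bsub>G\<^esub> (3::nat) = \<sigma>' [^]\<^bsub>G\<^esub> (2::nat) \<otimes>\<^bsub>G\<^esub> \<sigma>'" by (simp add: numeral_3_eq_3 numeral_2_eq_2)
    also have "\<dots> = compose L (\<sigma>' [^]\<^bsub>G\<^esub> (2::nat)) \<sigma>'"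
      by (rule mult[OF G.nat_pow_closed[OF \<sigma>'_G] \<sigma>'_G])
    also have "\<dots> = (\<lambda>x\<in>L. \<sigma> (\<sigma> (\<sigma> x)))"
      unfolding compose_def p2 unfolding \<sigma>'_def by (rule restrict_ext) (simp add: \<sigma>_L)
    finally show ?thesis .
  qed
  have "\<tau> \<in> range (\<lambda>n::int. \<sigma>' [^]\<^bsub>G\<^esub> n)" if "\<tau> \<in> carrier G" for \<tau>
  proof -
    have \<tau>: "\<tau> \<in> extensional L" "complex_hom L \<tau>" "\<And>x. x \<in> K \<Longrightarrow> \<tau> x = x"
      using that unfolding galois_group_carrier[OF L.ext.complex_subfield_axioms] by auto
    interpret \<tau>: complex_hom L \<tau> by (rule \<tau>(2))
    have eqI: "\<tau> = restrict f L" if "complex_hom L f" "\<And>x. x \<in> K \<Longrightarrow> f x = x" "\<tau> s = f s" "\<tau> \<rho>\<^sub>1 = f \<rho>\<^sub>1" for f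
    proof (rule extensionalityI[OF \<tau>(1)])
      fix x assume "x \<in> L"
      thus "\<tau> x = restrict f L x" using hom_eq_L[OF \<tau>(2) that(1) _ that(3,4)] that(2) \<tau>(3) by simp
    qed simp
    have "(\<tau> s)\<^sup>2 = s\<^sup>2" by (metis \<tau>.hom_power \<tau>.hom_of_int in_L(1) s_sq)
    hence s_cases: "\<tau> s = s \<or> \<tau> s = - s" by (simp add: power2_eq_iff)
    have "(\<tau> \<rho>\<^sub>1)\<^sup>2 = \<tau> ((of_int (2 * t - 3) + s) / 2)"
      using in_L by (simp only: \<rho>\<^sub>1_sq flip: \<tau>.hom_power)
    also have "\<dots> = (of_int (2 * t - 3) + \<tau> s) / 2"
      using in_L by (simp add: \<tau>.hom_divide \<tau>.hom_add del: of_int_add of_int_diff of_int_mult)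
    finally have \<rho>: "(\<tau> \<rho>\<^sub>1)\<^sup>2 = (of_int (2 * t - 3) + \<tau> s) / 2" .
    have "\<exists>n::nat. \<tau> = \<sigma>' [^]\<^bsub>G\<^esub> n"
    proof (cases "\<tau> s = s")
      case True
      hence "(\<tau> \<rho>\<^sub>1)\<^sup>2 = \<rho>\<^sub>1\<^sup>2" by (simp only: \<rho> \<rho>\<^sub>1_sq)
      hence "\<tau> \<rho>\<^sub>1 = \<rho>\<^sub>1 \<or> \<tau> \<rho>\<^sub>1 = - \<rho>\<^sub>1" by (simp add: power2_eq_iff)
      thus ?thesis
      proof
        assume "\<tau> \<rho>\<^sub>1 = \<rho>\<^sub>1"
        hence "\<tau> = restrict (\<lambda>x. x) L"
          using True by (intro eqI complex_hom_id L.ext.complex_subfield_axioms) auto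
        thus ?thesis using one by (intro exI[of _ 0]) simp
      next
        assume "\<tau> \<rho>\<^sub>1 = - \<rho>\<^sub>1"
        hence "\<tau> = restrict (\<lambda>x. \<sigma> (\<sigma> x)) L"
          using True by (intro eqI \<sigma>2_hom) (auto simp: \<sigma>_K \<sigma>_s \<sigma>_\<rho>\<^sub>1 \<sigma>_\<rho>\<^sub>2 \<sigma>_uminus)
        thus ?thesis using p2 by metis
      qed
    next
      case False
      hence s': "\<tau> s = - s" using s_cases by blast
      hence "(\<tau> \<rho>\<^sub>1)\<^sup>2 = \<rho>\<^sub>2\<^sup>2" by (simp only: \<rho> \<rho>\<^sub>2_sq diff_conv_add_uminus)
      hence "\<tau> \<rho>\<^sub>1 = \<rho>\<^sub>2 \<or> \<tau> \<rho>\<^sub>1 = - \<rho>\<^sub>2" by (simp add: power2_eq_iff)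
      thus ?thesis
      proof
        assume "\<tau> \<rho>\<^sub>1 = \<rho>\<^sub>2"
        hence "\<tau> = restrict \<sigma> L"
          using s' by (intro eqI \<sigma>_hom) (auto simp: \<sigma>_K \<sigma>_s \<sigma>_\<rho>\<^sub>1)
        thus ?thesis using p1 by metis
      next
        assume "\<tau> \<rho>\<^sub>1 = - \<rho>\<^sub>2"
        hence "\<tau> = restrict (\<lambda>x. \<sigma> (\<sigma> (\<sigma> x))) L"
          using s' by (intro eqI \<sigma>3_hom) (auto simp: \<sigma>_K \<sigma>_s \<sigma>_\<rho>\<^sub>1 \<sigma>_\<rho>\<^sub>2 \<sigma>_uminus)
        thus ?thesis using p3 by metis
      qed
    qed
    then obtain n :: nat where "\<tau> = \<sigma>' [^]\<^bsub>G\<^esub> n" by blast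
    hence "\<tau> = \<sigma>' [^]\<^bsub>G\<^esub> int n" by (simp add: int_pow_int)
    thus ?thesis by blast
  qed
  moreover have "\<sigma>' [^]\<^bsub>G\<^esub> (n::int) \<in> carrier G" for n by (rule G.int_pow_closed[OF \<sigma>'_G])
  ultimately have "carrier G = range (\<lambda>n::int. \<sigma>' [^]\<^bsub>G\<^esub> n)" by blast
  thus ?thesis unfolding G.cyclic_group using \<sigma>'_G by blast
qed

lemma dimension_4: "cf.dimension 4 K L"
proof -
  have "cf.dimension (2 * 2) K L"
    by (rule cf.telescopic_base[OF _ _ M.dimension_E L.dimension_E])
       (simp_all add: subfield_complex_field_iff K.ext.complex_subfield_axioms M.ext.complex_subfield_axioms)
  thus ?thesis by simp
qed

text \<open>An element fixed by \<open>\<sigma>\<close> is fixed by its square, the conjugation of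
  \<open>L\<close> over \<open>M\<close>; so it lies in \<open>M\<close>, where
  \<open>\<sigma>\<close> is the conjugation over \<open>K\<close>.\<close>

lemma cyclic_extension: "cyclic_extension K L"
proof -
  have "{x \<in> L. \<forall>\<tau>\<in>carrier G. \<tau> x = x} = K"
  proof
    show "K \<subseteq> {x \<in> L. \<forall>\<tau>\<in>carrier G. \<tau> x = x}"
      using subs by (auto simp: galois_group_carrier[OF L.ext.complex_subfield_axioms])
    show "{x \<in> L. \<forall>\<tau>\<in>carrier G. \<tau> x = x} \<subseteq> K"
    proof safe
      fix x assume x: "x \<in> L" "\<forall>\<tau>\<in>carrier G. \<tau> x = x"
      hence "\<sigma>' x = x" using \<sigma>'_G by blast
      hence fx: "\<sigma> x = x" using x(1) by (simp add: \<sigma>'_def)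
      hence "L.conj x = x" using \<sigma>2[OF x(1)] by simp
      hence "x \<in> M" by (rule L.conj_fixed[OF x(1)])
      moreover from this have "M.conj x = x" using fx \<sigma>_M by simp
      ultimately show "x \<in> K" by (rule M.conj_fixed)
    qed
  qed
  thus ?thesis
    unfolding cyclic_extension_def galois_extension_def subfield_complex_field_iff
    using cyclic_G subs cf.finite_dimensionI[OF dimension_4]
      K.ext.complex_subfield_axioms L.ext.complex_subfield_axioms by blast
qed

section \<open>The quartic and its splitting field\<close>

definition y\<^sub>1 :: complex where "y\<^sub>1 = (1 + s) / 2"
definition y\<^sub>2 :: complex where "y\<^sub>2 = (1 - s) / 2"
definition x\<^sub>1 :: complex where "x\<^sub>1 = (y\<^sub>1 + \<rho>\<^sub>1) / 2"
definition x\<^sub>2 :: complex where "x\<^sub>2 = (y\<^sub>2 + \<rho>\<^sub>2) / 2"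

abbreviation quartic :: "complex poly" where "quartic \<equiv> [:1, -1, - of_int t, -1, 1:]"

lemma y_sum_prod: "y\<^sub>1 + y\<^sub>2 = 1" "y\<^sub>1 * y\<^sub>2 = - of_int (t + 2)"
proof -
  have "(1 + a) / 2 + (1 - a) / 2 = 1" "((1 + a) / 2) * ((1 - a) / 2) = (1 - a\<^sup>2) / 4" for a :: complex
    by (simp_all add: field_simps power2_eq_square)
  note * = this[of s]
  show "y\<^sub>1 + y\<^sub>2 = 1" unfolding y\<^sub>1_def y\<^sub>2_def by (rule *(1))
  have "y\<^sub>1 * y\<^sub>2 = (1 - s\<^sup>2) / 4" unfolding y\<^sub>1_def y\<^sub>2_def by (rule *(2))
  also have "\<dots> = - of_int (t + 2)" unfolding s_sq by simp
  finally show "y\<^sub>1 * y\<^sub>2 = - of_int (t + 2)" .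
qed

lemma y_disc: "y\<^sub>1\<^sup>2 - 4 = \<rho>\<^sub>1\<^sup>2" "y\<^sub>2\<^sup>2 - 4 = \<rho>\<^sub>2\<^sup>2"
proof -
  have *: "((1 + a) / 2)\<^sup>2 - 4 = (a\<^sup>2 - 15 + 2 * a) / 4" for a :: complex
    by (simp add: field_simps power2_eq_square)
  have 15: "s\<^sup>2 - 15 = 2 * of_int (2 * t - 3)" unfolding s_sq by simp
  have **: "(2 * b + 2 * a) / 4 = (b + a) / 2" for a b :: complex by simp
  show "y\<^sub>1\<^sup>2 - 4 = \<rho>\<^sub>1\<^sup>2" unfolding y\<^sub>1_def * 15 \<rho>\<^sub>1_sq by (rule **)
  have "y\<^sub>2\<^sup>2 - 4 = (2 * of_int (2 * t - 3) + 2 * (- s)) / 4"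
    using *[of "- s"] 15 unfolding y\<^sub>2_def by (simp only: diff_conv_add_uminus power2_minus)
  also have "\<dots> = (of_int (2 * t - 3) + (- s)) / 2" by (rule **)
  finally show "y\<^sub>2\<^sup>2 - 4 = \<rho>\<^sub>2\<^sup>2" unfolding \<rho>\<^sub>2_sq by simp
qed

lemma quartic_factor: "poly quartic z = (z\<^sup>2 - y\<^sub>1 * z + 1) * (z\<^sup>2 - y\<^sub>2 * z + 1)"
proof -
  have "(z\<^sup>2 - a * z + 1) * (z\<^sup>2 - b * z + 1) =
      z ^ 4 + 2 * z\<^sup>2 + 1 - (a + b) * (z ^ 3 + z) + (a * b) * z\<^sup>2" for a b :: complex
    by (simp add: algebra_simps power2_eq_square power3_eq_cube power4_eq_xxxx)
  hence "(z\<^sup>2 - y\<^sub>1 * z + 1) * (z\<^sup>2 - y\<^sub>2 * z + 1) =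
      z ^ 4 + 2 * z\<^sup>2 + 1 - 1 * (z ^ 3 + z) + (- of_int (t + 2)) * z\<^sup>2" by (simp only: y_sum_prod)
  also have "\<dots> = poly quartic z"
    by (simp add: algebra_simps power2_eq_square power3_eq_cube power4_eq_xxxx)
  finally show ?thesis ..
qed

lemma quadratic_root_iff:
  fixes z y \<rho> :: complex
  assumes "y\<^sup>2 - 4 = \<rho>\<^sup>2"
  shows "z\<^sup>2 - y * z + 1 = 0 \<longleftrightarrow> z = (y + \<rho>) / 2 \<or> z = (y - \<rho>) / 2"
proof -
  have *: "4 * (z\<^sup>2 - y * z + 1) = (2 * z - y)\<^sup>2 - (y\<^sup>2 - 4)"
    by (simp add: algebra_simps power2_eq_square)
  have "z\<^sup>2 - y * z + 1 = 0 \<longleftrightarrow> 4 * (z\<^sup>2 - y * z + 1) = 0"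
    by (metis mult_eq_0_iff zero_neq_numeral)
  also have "\<dots> \<longleftrightarrow> (2 * z - y)\<^sup>2 = \<rho>\<^sup>2" unfolding * assms by simp
  also have "\<dots> \<longleftrightarrow> 2 * z - y = \<rho> \<or> 2 * z - y = - \<rho>" by (rule power2_eq_iff)
  also have "2 * z - y = \<rho> \<longleftrightarrow> z = (y + \<rho>) / 2"
    by (auto simp: field_simps)
  also have "2 * z - y = - \<rho> \<longleftrightarrow> z = (y - \<rho>) / 2"
    by (auto simp: field_simps)
  finally show ?thesis .
qed

lemma quartic_roots:
  "{z. poly quartic z = 0} = {x\<^sub>1, (y\<^sub>1 - \<rho>\<^sub>1) / 2, x\<^sub>2, (y\<^sub>2 - \<rho>\<^sub>2) / 2}"
  unfolding quartic_factor x\<^sub>1_def x\<^sub>2_def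
  using quadratic_root_iff[OF y_disc(1)] quadratic_root_iff[OF y_disc(2)] by auto

lemma in_L': "y\<^sub>1 \<in> L" "y\<^sub>2 \<in> L" "x\<^sub>1 \<in> L" "x\<^sub>2 \<in> L"
  using in_L by (simp_all add: y\<^sub>1_def y\<^sub>2_def x\<^sub>1_def x\<^sub>2_def)

text \<open>For the inclusion of \<open>L\<close>: the roots of the first quadratic factor have sum
  \<open>y\<^sub>1\<close> and difference \<open>\<rho>\<^sub>1\<close>, and
  \<open>s = 2 * y\<^sub>1 - 1\<close>.\<close>

lemma splitting_field_eq: "splitting_field K quartic = L"
proof
  have L: "subfield L complex_field"
    by (simp add: subfield_complex_field_iff L.ext.complex_subfield_axioms)
  show "splitting_field K quartic \<subseteq> L"
    unfolding splitting_field_def quartic_roots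
    by (rule field.generate_field_min_subfield1[OF field_complex_field _ L])
       (use subs in_L in_L' in auto)
  define N where "N = splitting_field K quartic"
  have "subfield N complex_field"
    unfolding N_def splitting_field_def
    by (rule field.generate_field_is_subfield[OF field_complex_field]) simp
  then interpret N: complex_subfield N by (simp add: subfield_complex_field_iff)
  have incl: "K \<union> {z. poly quartic z = 0} \<subseteq> N"
    unfolding N_def splitting_field_def by (auto intro: generate_field.incl)
  hence KN: "K \<subseteq> N" and rN: "x\<^sub>1 \<in> N" "(y\<^sub>1 - \<rho>\<^sub>1) / 2 \<in> N"
    unfolding quartic_roots by auto
  have "x\<^sub>1 + (y\<^sub>1 - \<rho>\<^sub>1) / 2 \<in> N" "x\<^sub>1 - (y\<^sub>1 - \<rho>\<^sub>1) / 2 \<in> N" using rN by auto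
  moreover have "x\<^sub>1 + (y\<^sub>1 - \<rho>\<^sub>1) / 2 = y\<^sub>1" "x\<^sub>1 - (y\<^sub>1 - \<rho>\<^sub>1) / 2 = \<rho>\<^sub>1"
    by (simp_all add: x\<^sub>1_def field_simps)
  ultimately have yN: "y\<^sub>1 \<in> N" "\<rho>\<^sub>1 \<in> N" by simp_all
  have "2 * y\<^sub>1 - 1 \<in> N" using yN by auto
  moreover have "2 * y\<^sub>1 - 1 = s" by (simp add: y\<^sub>1_def)
  ultimately have "s \<in> N" by simp
  hence "M \<subseteq> N" using M.E_minimal[OF N.complex_subfield_axioms KN] by blast
  thus "L \<subseteq> splitting_field K quartic"
    unfolding N_def[symmetric] using L.E_minimal[OF N.complex_subfield_axioms _ yN(2)] by blast
qed

lemma generate_K: "generate_field complex_field {csqrt (of_int (t * (t - 4) * (4 * t + 9)))} = K"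
proof -
  have r: "csqrt (of_int (t * (t - 4) * (4 * t + 9))) = r" by (simp add: r_def D_def)
  have K: "subfield K complex_field"
    by (simp add: subfield_complex_field_iff K.ext.complex_subfield_axioms)
  define N where "N = generate_field complex_field {r}"
  have "N \<subseteq> K"
    unfolding N_def by (rule field.generate_field_min_subfield1[OF field_complex_field _ K])
       (use r_K in auto)
  moreover have "subfield N complex_field"
    unfolding N_def by (rule field.generate_field_is_subfield[OF field_complex_field]) simp
  then interpret N: complex_subfield N by (simp add: subfield_complex_field_iff)
  have "r \<in> N" unfolding N_def by (rule generate_field.incl) simp
  hence "K \<subseteq> N" using N.rat_in by (intro K.E_minimal N.complex_subfield_axioms) auto
  ultimately show ?thesis unfolding r N_def by blast
qed

lemma quadratic_field_K: "quadratic_field K"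
  unfolding quadratic_field_def subfield_complex_field_iff
  using K.ext.complex_subfield_axioms K.dimension_E by blast

subsection \<open>Ramification\<close>

lemma algebraic_ints: "algebraic_int y\<^sub>1" "algebraic_int x\<^sub>1" "algebraic_int x\<^sub>2"
    "algebraic_int ((1 + g) / 2)"
proof -
  have y: "a\<^sup>2 + (- 1) * a + (- of_int (t + 2)) = 0" if "a + b = 1" "a * b = - of_int (t + 2)" for a b :: complex
  proof -
    have "b = 1 - a" using that(1) by (simp add: algebra_simps)
    hence "a * (1 - a) = - of_int (t + 2)" using that(2) by simp
    thus ?thesis by (simp add: algebra_simps power2_eq_square)
  qed
  show "algebraic_int y\<^sub>1"
    by (rule algebraic_int_quadratic[OF _ _ y[OF y_sum_prod]]) auto
  have q: "algebraic_int z" if "poly quartic z = 0" for z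
  proof
    show "\<forall>i. coeff quartic i \<in> \<int>" by (auto simp: coeff_pCons split: nat.splits)
  qed (use that in auto)
  show "algebraic_int x\<^sub>1" "algebraic_int x\<^sub>2"
    using q quartic_roots by blast+
  \<comment> \<open>This quotient by 4 is the norm of \<open>(1 + g) / 2\<close>, whose trace is
    1.\<close>
  have "4 dvd 1 - t * (t - 4)" using mod_8(2) by presburger
  then obtain k where k: "1 - t * (t - 4) = 4 * k" by blast
  have "((1 + g) / 2)\<^sup>2 + (- 1) * ((1 + g) / 2) + of_int k = (g\<^sup>2 - 1) / 4 + of_int k"
    by (simp add: field_simps power2_eq_square)
  also have "g\<^sup>2 - 1 = - of_int (1 - t * (t - 4))" unfolding g_sq by simp
  also have "\<dots> / 4 + of_int k = 0" unfolding k by simp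
  finally have eq: "((1 + g) / 2)\<^sup>2 + (- 1) * ((1 + g) / 2) + of_int k = 0" .
  show "algebraic_int ((1 + g) / 2)" by (rule algebraic_int_quadratic[OF _ _ eq]) auto
qed

lemma conj_\<rho>\<^sub>2: "L.conj \<rho>\<^sub>2 = - \<rho>\<^sub>2"
proof -
  have "L.conj (g / \<rho>\<^sub>1) = L.conj g / L.conj \<rho>\<^sub>1" using in_L by (intro L.conj.hom_divide)
  thus ?thesis using g_M by (simp add: \<rho>\<^sub>2_def)
qed

text \<open>Each quadratic step has two integral generators. Their differences from their conjugates
  are \<open>s\<close> and \<open>g\<close> for \<open>M\<close> over \<open>K\<close>, and
  \<open>\<rho>\<^sub>1\<close> and \<open>\<rho>\<^sub>2\<close> for \<open>L\<close> over
  \<open>M\<close>. In either pair at least one difference avoids \<open>Q\<close>, so the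
  discriminant criterion applies, also at primes over 2, because the generators are integral
  halves.\<close>

lemma unramified_finite: "unramified_at_finite_places K L"
  unfolding unramified_at_finite_places_def
proof (intro allI impI)
  fix P Q
  assume "primeideal P (ring_of_integers K) \<and> P \<noteq> {0} \<and> primeideal Q (ring_of_integers L) \<and> Q \<inter> K = P"
  hence P: "primeideal P (ring_of_integers K)" "P \<noteq> {0}" and Q: "primeideal Q (ring_of_integers L)"
    and QP: "Q \<inter> K = P" by auto
  note I = L.ext.idealD[OF L.ext.primeidealD(1)[OF Q]] and R = L.ext.primeidealD[OF Q]
  \<comment> \<open>A prime containing both would contain the coprime integers
    \<open>s\<^sup>2\<close> and \<open>g\<^sup>2\<close>, hence 1.\<close>
  have sg: "\<not> (s \<in> Q \<and> g \<in> Q)"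
  proof
    assume "s \<in> Q \<and> g \<in> Q"
    hence sQ: "s \<in> Q" and gQ: "g \<in> Q" by auto
    have "s * s \<in> Q" "g * g \<in> Q" by (rule I(4)[OF I(1)[OF sQ] sQ], rule I(4)[OF I(1)[OF gQ] gQ])
    hence mem: "of_int (4 * t + 9) \<in> Q" "of_int (t * (t - 4)) \<in> Q"
      using s_sq g_sq by (metis power2_eq_square)+
    obtain u v where uv: "u * (t * (t - 4)) + v * (4 * t + 9) = 1"
      using coprime_t bezout_int[of "t * (t - 4)" "4 * t + 9"] by auto
    have "of_int u * of_int (t * (t - 4)) + of_int v * of_int (4 * t + 9) \<in> Q"
      by (intro I(3) I(7) mem)
    also have "of_int u * of_int (t * (t - 4)) + of_int v * of_int (4 * t + 9) = (of_int 1 :: complex)"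
      unfolding of_int_mult[symmetric] of_int_add[symmetric] uv ..
    finally show False using R(2) by simp
  qed
  have q: "primeideal (Q \<inter> M) (ring_of_integers M)"
    by (rule M.ext.primeideal_restrict[OF Q L.ext.complex_subfield_axioms subs(2)])
  have MK: "locally_generated K M (Q \<inter> M)"
  proof (cases "s \<in> Q")
    case False
    have "y\<^sub>1 \<in> integers_of M" using algebraic_ints M.gen_in by (simp add: y\<^sub>1_def)
    moreover have "y\<^sub>1 - M.conj y\<^sub>1 = s"
    proof -
      have "M.conj ((1 + s) / 2) = (1 - s) / 2"
        using M.gen_in by (simp add: M.conj.hom_divide M.conj.hom_add)
      moreover have "(1 + s) / 2 - (1 - s) / 2 = s" by (simp add: field_simps)
      ultimately show ?thesis unfolding y\<^sub>1_def by (simp only:)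
    qed
    ultimately show ?thesis using False by (intro M.locally_generated_if_discriminant[OF q]) auto
  next
    case True
    hence g: "g \<notin> Q" using sg by blast
    have "(1 + g) / 2 \<in> integers_of M" using algebraic_ints g_M by simp
    moreover have "(1 + g) / 2 - M.conj ((1 + g) / 2) = g"
    proof -
      have "M.conj ((1 + g) / 2) = (1 - g) / 2"
        using g_M by (simp add: M.conj.hom_divide M.conj.hom_add conj_g)
      moreover have "(1 + g) / 2 - (1 - g) / 2 = g" by (simp add: field_simps)
      ultimately show ?thesis by (simp only:)
    qed
    ultimately show ?thesis using g by (intro M.locally_generated_if_discriminant[OF q]) auto
  qed
  have yM: "y\<^sub>1 \<in> M" "y\<^sub>2 \<in> M" using M.gen_in by (auto simp: y\<^sub>1_def y\<^sub>2_def)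
  have diff: "(a + b) / 2 - (a - b) / 2 = b" for a b :: complex by (simp add: field_simps)
  have LM: "locally_generated M L Q"
  proof (cases "\<rho>\<^sub>1 \<in> Q")
    case False
    have "x\<^sub>1 \<in> integers_of L" using algebraic_ints in_L' by simp
    moreover have "x\<^sub>1 - L.conj x\<^sub>1 = \<rho>\<^sub>1"
    proof -
      have "L.conj ((y\<^sub>1 + \<rho>\<^sub>1) / 2) = (y\<^sub>1 - \<rho>\<^sub>1) / 2"
        using in_L in_L' yM by (simp add: L.conj.hom_divide L.conj.hom_add)
      thus ?thesis unfolding x\<^sub>1_def by (simp only: diff)
    qed
    ultimately show ?thesis using False by (intro L.locally_generated_if_discriminant[OF Q]) auto
  next
    case True
    \<comment> \<open>Otherwise \<open>\<rho>\<^sub>1 * \<rho>\<^sub>2 = g\<close> and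
      \<open>\<rho>\<^sub>1\<^sup>2 - \<rho>\<^sub>2\<^sup>2 = s\<close> would both lie in
      \<open>Q\<close>.\<close>
    have \<rho>: "\<rho>\<^sub>2 \<notin> Q"
    proof
      assume \<rho>: "\<rho>\<^sub>2 \<in> Q"
      have "\<rho>\<^sub>1 * \<rho>\<^sub>2 \<in> Q" "\<rho>\<^sub>1 * \<rho>\<^sub>1 - \<rho>\<^sub>2 * \<rho>\<^sub>2 \<in> Q"
        by (intro I(4)[OF I(1)[OF True] \<rho>] I(6) I(4)[OF I(1)[OF True] True] I(4)[OF I(1)[OF \<rho>] \<rho>])+
      thus False using sg prods by (simp add: power2_eq_square)
    qed
    have "x\<^sub>2 \<in> integers_of L" using algebraic_ints in_L' by simp
    moreover have "x\<^sub>2 - L.conj x\<^sub>2 = \<rho>\<^sub>2"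
    proof -
      have "L.conj ((y\<^sub>2 + \<rho>\<^sub>2) / 2) = (y\<^sub>2 - \<rho>\<^sub>2) / 2"
        using in_L in_L' yM by (simp add: L.conj.hom_divide L.conj.hom_add conj_\<rho>\<^sub>2)
      thus ?thesis unfolding x\<^sub>2_def by (simp only: diff)
    qed
    ultimately show ?thesis using \<rho> by (intro L.locally_generated_if_discriminant[OF Q]) auto
  qed
  obtain \<alpha> \<beta> where gen: "\<alpha> \<in> P" "\<beta> \<in> P" "\<And>x. x \<in> P \<Longrightarrow> \<exists>m n. x = of_int m * \<alpha> + of_int n * \<beta>"
    using K.ideal_two_generators[OF K.ext.primeidealD(1)[OF P(1)]] by blast
  show "ramification_index L P Q = 1"
  proof (rule L.ext.ramification_index_eq_1[OF Q _ P(2)])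
    show "P \<subseteq> Q" "P \<noteq> {}" using QP gen(1) by auto
    show "finite {\<alpha>, \<beta>}" "{\<alpha>, \<beta>} \<subseteq> P" using gen by auto
    fix x assume "x \<in> Q"
    thus "\<exists>u\<in>integers_of L - Q. u * x \<in> lincomb (integers_of L) {\<alpha>, \<beta>}"
      using locally_generated_tower[OF L.ext.complex_subfield_axioms M.ext.complex_subfield_axioms subs(2)
          Q LM MK _ \<open>x \<in> Q\<close>, of \<alpha> \<beta>] gen(3) QP by blast
  qed
qed

text \<open>For \<open>t > 4\<close>, \<open>4 * t + 9\<close> is positive and both conjugates of
  the radicand of \<open>\<rho>\<^sub>1\<close> are nonnegative, so every such embedding of
  \<open>L\<close> is real. For \<open>t < -2\<close>, \<open>D\<close> is negative and no embedding
  maps \<open>K\<close> into the reals.\<close>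

lemma unramified_infinite:
  assumes "t > 4 \<or> t < -2"
  shows "unramified_at_infinite_places K L"
  unfolding unramified_at_infinite_places_def
proof (intro ballI impI)
  fix \<tau> assume "\<tau> \<in> Ring.ring_hom (subfield_ring L) complex_field" and real: "\<tau> ` K \<subseteq> \<real>"
  then interpret \<tau>: complex_hom L \<tau> using ring_hom_subfield_iff[OF L.ext.complex_subfield_axioms] by blast
  have real_sqrt: "z \<in> \<real>" if "z\<^sup>2 = of_real a" "a \<ge> 0" for z :: complex and a
  proof -
    have "z\<^sup>2 = (of_real (sqrt a))\<^sup>2" using that by (simp flip: of_real_power)
    hence "z = of_real (sqrt a) \<or> z = - of_real (sqrt a)" by (simp only: power2_eq_iff)
    thus ?thesis by auto
  qed
  show "\<tau> ` L \<subseteq> \<real>"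
  proof (cases "t > 4")
    case True
    have \<tau>s: "(\<tau> s)\<^sup>2 = of_int (4 * t + 9)" by (metis \<tau>.hom_power \<tau>.hom_of_int in_L(1) s_sq)
    hence "\<tau> s \<in> \<real>" using real_sqrt[of "\<tau> s" "of_int (4 * t + 9)"] True by simp
    then obtain S where S: "\<tau> s = of_real S" by (auto elim: Reals_cases)
    hence S2: "S\<^sup>2 = of_int (4 * t + 9)" using \<tau>s by (metis of_real_eq_iff of_real_of_int_eq of_real_power)
    \<comment> \<open>Either sign of \<open>S\<close> can occur, so its absolute value is compared
      with \<open>2 * t - 3\<close>.\<close>
    have "S\<^sup>2 \<le> (of_int (2 * t - 3))\<^sup>2"
    proof -
      have "(2 * t - 3)\<^sup>2 = (4 * t + 9) + 4 * (t * (t - 4))" by (simp add: power2_eq_square algebra_simps)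
      moreover have "t * (t - 4) \<ge> 0" using True by simp
      ultimately have "4 * t + 9 \<le> (2 * t - 3)\<^sup>2" by linarith
      thus ?thesis unfolding S2 of_int_power[symmetric] of_int_le_iff .
    qed
    hence "\<bar>S\<bar> \<le> \<bar>of_int (2 * t - 3)\<bar>" by (simp only: abs_le_square_iff)
    hence nonneg: "(of_int (2 * t - 3) + S) / 2 \<ge> 0" using True by (simp add: abs_le_iff)
    have "(\<tau> \<rho>\<^sub>1)\<^sup>2 = \<tau> ((of_int (2 * t - 3) + s) / 2)"
      using in_L by (simp only: \<rho>\<^sub>1_sq flip: \<tau>.hom_power)
    also have "\<dots> = (of_int (2 * t - 3) + \<tau> s) / 2"
      using in_L by (simp add: \<tau>.hom_divide \<tau>.hom_add del: of_int_add of_int_diff of_int_mult)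
    also have "\<dots> = of_real ((of_int (2 * t - 3) + S) / 2)" unfolding S by simp
    finally have \<tau>\<rho>: "\<tau> \<rho>\<^sub>1 \<in> \<real>" using nonneg by (rule real_sqrt)
    have \<tau>M: "\<tau> z \<in> \<real>" if z: "z \<in> M" for z
    proof -
      obtain u v where uv: "z = u + v * s" "u \<in> K" "v \<in> K" using z by (auto simp: M.E_def)
      hence "u \<in> L" "v \<in> L" using subs by auto
      hence "\<tau> z = \<tau> u + \<tau> v * \<tau> s" using uv in_L by (simp add: \<tau>.hom_add \<tau>.hom_mult)
      moreover have "\<tau> u \<in> \<real>" "\<tau> v \<in> \<real>" using real uv by auto
      ultimately show ?thesis using \<open>\<tau> s \<in> \<real>\<close> by simp
    qed
    show ?thesis
    proof
      fix w assume "w \<in> \<tau> ` L"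
      then obtain z where z: "z \<in> L" "w = \<tau> z" by blast
      obtain u v where uv: "z = u + v * \<rho>\<^sub>1" "u \<in> M" "v \<in> M" using z(1) by (auto simp: L.E_def)
      hence "u \<in> L" "v \<in> L" using subs by auto
      hence "\<tau> z = \<tau> u + \<tau> v * \<tau> \<rho>\<^sub>1" using uv in_L by (simp add: \<tau>.hom_add \<tau>.hom_mult)
      thus "w \<in> \<real>" using \<tau>M[OF uv(2)] \<tau>M[OF uv(3)] \<tau>\<rho> z(2) by simp
    qed
  next
    case False
    hence "t < -2" using assms by simp
    hence "t * (t - 4) > 0" "4 * t + 9 < 0" by (auto intro: mult_neg_neg)
    hence D: "D < 0" unfolding D_def by (rule mult_pos_neg)
    have "\<tau> r \<in> \<real>" using real r_K by blast
    then obtain x where x: "\<tau> r = of_real x" by (auto elim: Reals_cases)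
    have "(\<tau> r)\<^sup>2 = of_int D" by (metis \<tau>.hom_power \<tau>.hom_of_int in_L(5) r_sq)
    hence "x\<^sup>2 = of_int D" unfolding x by (metis of_real_eq_iff of_real_of_int_eq of_real_power)
    hence "of_int D \<ge> (0::real)" by (metis zero_le_power2)
    thus ?thesis using D by simp
  qed
qed

lemma unramified_cyclic:
  assumes "t > 4 \<or> t < -2"
  shows "unramified_cyclic_extension_of_degree 4 K (splitting_field K quartic)"
  unfolding unramified_cyclic_extension_of_degree_def unramified_extension_def splitting_field_eq
  using cyclic_extension dimension_4 unramified_finite unramified_infinite[OF assms] by blast

lemma real_K: "t > 4 \<Longrightarrow> real_quadratic_field K"
proof -
  assume t: "t > 4"
  hence "D > 0" by (simp add: D_def)
  hence "r = of_real (sqrt (of_int D))" unfolding r_def by (subst of_real_sqrt) simp_all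
  hence "r \<in> \<real>" by simp
  hence "K \<subseteq> \<real>" by (auto simp: K.E_def elim!: Rats_cases')
  thus ?thesis using quadratic_field_K by (simp add: real_quadratic_field_def)
qed

lemma imaginary_K: "t < -2 \<Longrightarrow> imaginary_quadratic_field K"
proof -
  assume "t < -2"
  hence "t * (t - 4) > 0" "4 * t + 9 < 0" by (auto intro: mult_neg_neg)
  hence D: "D < 0" unfolding D_def by (rule mult_pos_neg)
  have "\<not> K \<subseteq> \<real>"
  proof
    assume "K \<subseteq> \<real>"
    hence "r \<in> \<real>" using r_K by blast
    then obtain x where x: "r = of_real x" by (auto elim: Reals_cases)
    hence "x\<^sup>2 = of_int D" using r_sq by (metis of_real_eq_iff of_real_of_int_eq of_real_power)
    hence "of_int D \<ge> (0::real)" by (metis zero_le_power2)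
    thus False using D by simp
  qed
  thus ?thesis using quadratic_field_K by (simp add: imaginary_quadratic_field_def)
qed

end

subsection \<open>Quadratic residues\<close>

lemma odd_multiplicity_dvd: "odd (multiplicity p n) \<Longrightarrow> p dvd n"
  by (metis even_zero not_dvd_imp_multiplicity_0)

text \<open>For a multiplicative property that holds for squares of primes, only the primes of odd
  multiplicity remain to be checked. It is applied to quadratic residues and to being 1 modulo
  4.\<close>

lemma odd_multiplicity_induct:
  fixes n :: int
  assumes "n > 0" and one: "P 1" and mult: "\<And>a b. P a \<Longrightarrow> P b \<Longrightarrow> P (a * b)"
    and sq: "\<And>p. Factorial_Ring.prime p \<Longrightarrow> p dvd n \<Longrightarrow> P (p\<^sup>2)"
    and odd: "\<And>p. Factorial_Ring.prime p \<Longrightarrow> odd (multiplicity p n) \<Longrightarrow> P p"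
  shows "P n"
proof -
  have pow: "P (x ^ k)" if "P x" for x and k :: nat
    by (induction k) (use one mult that in auto)
  have "P (p ^ multiplicity p n)" if p: "p \<in> prime_factors n" for p
  proof (cases "even (multiplicity p n)")
    case True
    then obtain j where "multiplicity p n = 2 * j" by blast
    hence "p ^ multiplicity p n = (p\<^sup>2) ^ j" by (simp add: power_mult)
    thus ?thesis using pow sq[of p] p by (auto simp: in_prime_factors_iff)
  next
    case False
    then obtain j where j: "multiplicity p n = 2 * j + 1" by (rule oddE)
    have "p ^ multiplicity p n = p * (p\<^sup>2) ^ j" unfolding j by (simp add: power_mult)
    thus ?thesis using pow sq[of p] odd[OF _ False] p mult by (auto simp: in_prime_factors_iff)
  qed
  note pm = this
  have "P (\<Prod>p\<in>A. p ^ multiplicity p n)" if "finite A" "A \<subseteq> prime_factors n" for A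
    using that by (induction A rule: finite_induct) (auto intro: one mult pm)
  from this[of "prime_factors n"] show ?thesis
    using assms(1) by (simp add: prod_prime_factors)
qed

lemma QuadRes_mult: "QuadRes p a \<Longrightarrow> QuadRes p b \<Longrightarrow> QuadRes p (a * b)"
proof -
  assume "QuadRes p a" "QuadRes p b"
  then obtain x y where "[x\<^sup>2 = a] (mod p)" "[y\<^sup>2 = b] (mod p)" by (auto simp: QuadRes_def)
  hence "[(x * y)\<^sup>2 = a * b] (mod p)" unfolding power_mult_distrib by (rule cong_mult)
  thus ?thesis by (auto simp: QuadRes_def)
qed

lemma QuadRes_square: "QuadRes p (x\<^sup>2)"
  unfolding QuadRes_def by (rule exI[of _ x]) (rule cong_refl)

lemma QuadRes_cong: "[a = b] (mod p) \<Longrightarrow> QuadRes p a \<Longrightarrow> QuadRes p b"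
  unfolding QuadRes_def by (metis cong_trans)

lemma QuadRes_cancel_square:
  assumes p: "Factorial_Ring.prime (p :: int)" and "QuadRes p (a * x\<^sup>2)" "\<not> p dvd x"
  shows "QuadRes p a"
proof -
  have "Rings.coprime x p" using assms by (simp add: prime_imp_coprime coprime_commute)
  then obtain y where y: "[x * y = 1] (mod p)" using cong_solve_coprime_int by blast
  have "QuadRes p (a * x\<^sup>2 * y\<^sup>2)" by (rule QuadRes_mult[OF assms(2) QuadRes_square])
  moreover have "[a * x\<^sup>2 * y\<^sup>2 = a * 1\<^sup>2] (mod p)"
    using cong_mult[OF cong_refl[of a] cong_pow[OF y, of 2]] by (simp only: mult.assoc power_mult_distrib)
  ultimately show ?thesis using QuadRes_cong by fastforce
qed

lemma prime_int_nat:
  assumes "Factorial_Ring.prime (p :: int)"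
  obtains l :: nat where "p = int l" "Factorial_Ring.prime l"
proof
  show "p = int (nat p)" by (rule nat_0_le[OF prime_ge_0_int[OF assms], symmetric])
  show "Factorial_Ring.prime (nat p)" using prime_int_nat_transfer[of p] assms by blast
qed

lemma QuadRes_imp_power_cong_1:
  fixes l :: nat
  assumes l: "Factorial_Ring.prime l" "2 < l" and "QuadRes (int l) a" "\<not> int l dvd a"
  shows "[1 = a ^ ((l - 1) div 2)] (mod int l)"
proof -
  have "Legendre a (int l) = 1" using assms by (simp add: Legendre_def cong_0_iff)
  thus ?thesis using euler_criterion[OF l, of a] by simp
qed

text \<open>\<open>\<delta>\<close> is \<open>q\<close> with the sign that makes it 1 modulo 4; this
  sign cancels the sign of the reciprocity law, so no case distinction on \<open>l\<close>
  remains.\<close>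

lemma quadratic_reciprocity_signed:
  fixes q l :: nat
  assumes q: "Factorial_Ring.prime q" "2 < q" and l: "Factorial_Ring.prime l" "2 < l"
    and \<delta>: "\<delta> = (-1) ^ ((q - 1) div 2) * int q"
    and res: "QuadRes (int l) \<delta>" and nd: "\<not> int l dvd \<delta>"
  shows "QuadRes (int q) (int l)"
proof -
  define h where "h = (l - 1) div 2"
  define h' where "h' = (q - 1) div 2"
  have "l \<noteq> q" using nd \<delta> by auto
  have e1: "[1 = \<delta> ^ h] (mod int l)" unfolding h_def by (rule QuadRes_imp_power_cong_1[OF l res nd])
  have e2: "[Legendre (int q) (int l) = int q ^ h] (mod int l)"
    using euler_criterion[OF l, of "int q"] by (simp add: h_def)
  \<comment> \<open>By Euler's criterion \<open>Y\<close> is congruent to a power of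
    \<open>\<delta>\<close> that is 1 modulo \<open>l\<close>. Its values are -1, 0 and 1, and
    \<open>l > 2\<close>, so the congruence to 1 is an equality.\<close>
  define Y where Y: "Y = (-1) ^ (h' * h) * Legendre (int q) (int l)"
  have "[Y = (-1) ^ (h' * h) * int q ^ h] (mod int l)" unfolding Y by (intro cong_mult cong_refl e2)
  moreover have "(-1) ^ (h' * h) * int q ^ h = \<delta> ^ h"
    by (simp add: \<delta> power_mult_distrib power_mult h'_def)
  ultimately have "[Y = 1] (mod int l)" using e1 by (metis cong_sym cong_trans)
  hence "int l dvd Y - 1" by (simp add: cong_iff_dvd_diff)
  moreover have "Y \<in> {-1, 0, 1}" unfolding Y Legendre_def
    by (cases "even (h' * h)") auto
  ultimately have "Y = 1"
    using l(2) zdvd_imp_le[of "int l" 2] zdvd_imp_le[of "int l" 1] by auto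
  have rec: "Legendre (int q) (int l) * Legendre (int l) (int q) = (-1) ^ (h' * h)"
    using Quadratic_Reciprocity[OF q l \<open>l \<noteq> q\<close>[symmetric]] by (simp add: h_def h'_def)
  have "Legendre (int l) (int q) = 1"
  proof -
    have "x = 1" if "e * l = 1" "l * x = e" "e = 1 \<or> e = -1" for e l x :: int
      using that by auto
    moreover have "(-1 :: int) ^ (h' * h) = 1 \<or> (-1 :: int) ^ (h' * h) = -1"
      by (cases "even (h' * h)") auto
    ultimately show ?thesis using \<open>Y = 1\<close> rec unfolding Y by blast
  qed
  thus ?thesis unfolding Legendre_def by (auto split: if_splits)
qed

lemma not_QuadRes_minus_1:
  fixes l :: nat
  assumes l: "Factorial_Ring.prime l" "l mod 4 = 3"
  shows "\<not> QuadRes (int l) (-1)"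
proof
  assume "QuadRes (int l) (-1)"
  have "l > 2" using l(2) by presburger
  have nd: "\<not> int l dvd -1" using \<open>l > 2\<close> by simp
  hence "[1 = (-1) ^ ((l - 1) div 2)] (mod int l)"
    by (rule QuadRes_imp_power_cong_1[OF l(1) \<open>l > 2\<close> \<open>QuadRes (int l) (-1)\<close>])
  moreover have "odd ((l - 1) div 2)" using l(2) by presburger
  ultimately have "int l dvd 2" by (simp add: cong_iff_dvd_diff)
  thus False using \<open>l > 2\<close> zdvd_imp_le[of "int l" 2] by simp
qed

lemma prime_3_mod_4_dvd_sum_squares:
  assumes p: "Factorial_Ring.prime (p :: int)" "p mod 4 = 3" and dvd: "p dvd a\<^sup>2 + u\<^sup>2"
  shows "p dvd u"
proof (rule ccontr)
  assume nd: "\<not> p dvd u"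
  obtain l :: nat where l: "p = int l" "Factorial_Ring.prime l" using prime_int_nat[OF p(1)] .
  have "l mod 4 = 3" using p(2) unfolding l(1) by presburger
  have "[a\<^sup>2 = (-1) * u\<^sup>2] (mod p)" using dvd by (simp add: cong_iff_dvd_diff)
  hence "QuadRes p ((-1) * u\<^sup>2)" unfolding QuadRes_def by blast
  hence "QuadRes p (-1)" by (rule QuadRes_cancel_square[OF p(1) _ nd])
  thus False using not_QuadRes_minus_1[OF l(2) \<open>l mod 4 = 3\<close>] l(1) by simp
qed

lemma exists_prime_3_mod_4:
  fixes n :: int
  assumes "n > 0" "n mod 4 = 3"
  shows "\<exists>p. Factorial_Ring.prime p \<and> p mod 4 = 3 \<and> odd (multiplicity p n)"
proof (rule ccontr)
  assume no: "\<not> ?thesis"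
  have oddp: "odd p" if "p dvd n" for p
  proof
    assume "even p"
    hence "even n" using that by (rule dvd_trans)
    thus False using assms(2) by presburger
  qed
  have sq: "p\<^sup>2 mod 4 = 1" if p: "odd p" for p :: int
  proof -
    obtain j where "p = 2 * j + 1" using p by (rule oddE)
    hence "p\<^sup>2 = 4 * (j\<^sup>2 + j) + 1" by (simp add: power2_eq_square algebra_simps)
    thus ?thesis by presburger
  qed
  have "n mod 4 = 1"
  proof (rule odd_multiplicity_induct[OF assms(1)])
    show "a * b mod 4 = 1" if "a mod 4 = 1" "b mod 4 = 1" for a b :: int
      using mod_mult_eq[of a 4 b] that by simp
    show "p\<^sup>2 mod 4 = 1" if "p dvd n" for p by (rule sq[OF oddp[OF that]])
    fix p :: int assume p: "Factorial_Ring.prime p" "odd (multiplicity p n)"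
    have "p dvd n" by (rule odd_multiplicity_dvd[OF p(2)])
    hence "odd p" by (rule oddp)
    moreover have "p mod 4 \<noteq> 3" using no p by blast
    ultimately show "p mod 4 = 1" by presburger
  qed simp
  thus False using assms(2) by simp
qed

text \<open>\<open>t_mod_3\<close> makes \<open>D\<close> 1 modulo 3, as the ideal over 3 requires.
  In \<open>sign\<close>, a negative \<open>\<delta>\<close> controls the signs of the two factors
  through their product; for positive \<open>\<delta>\<close> these signs are harmless because -1 is
  a residue, while \<open>t mod 4 = 3\<close> provides the prime that rules out a negative
  norm.\<close>

locale order_4_family = c4_family +
  fixes \<delta> w :: int and q :: nat
  assumes \<delta>w: "\<delta> * w\<^sup>2 = 4 * t + 9"
    and q: "Factorial_Ring.prime q" "q > 3"
    and \<delta>q: "\<delta> = (-1) ^ ((q - 1) div 2) * int q"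
    and nonres: "\<not> QuadRes (int q) 3"
    and t_mod_3: "t mod 3 = 2"
    and sign: "\<delta> < 0 \<and> t < 0 \<or> QuadRes (int q) (-1) \<and> q mod 4 = 1 \<and> t > 4 \<and> t mod 4 = 3"
begin

abbreviation "d \<equiv> t * (t - 4)"
text \<open>\<open>D\<close> without the factor \<open>w\<^sup>2\<close>; square factors of
  \<open>t * (t - 4)\<close> may remain.\<close>

definition m where "m = \<delta> * d"

lemma abs_\<delta>: "\<bar>\<delta>\<bar> = int q"
  unfolding \<delta>q by (simp add: abs_mult power_abs)

lemma D_eq: "D = m * w\<^sup>2"
  using \<delta>w by (simp add: D_def m_def mult_ac)

lemma odd_w: "odd w"
proof
  assume "even w"
  hence "even (\<delta> * w\<^sup>2)" by simp
  thus False unfolding \<delta>w by simp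
qed

lemma m_mod_8: "m mod 8 = 1"
proof -
  have "(m * w\<^sup>2) mod 8 = (m mod 8) * (w\<^sup>2 mod 8) mod 8" by (simp add: mod_mult_eq)
  thus ?thesis unfolding D_eq[symmetric] mod_8(3) odd_square_mod_8[OF odd_w] by simp
qed

lemma d_pos: "d > 0"
  using sign by (auto intro: mult_neg_neg)

lemma q_coprime_d: "\<not> int q dvd d"
proof
  assume "int q dvd d"
  moreover have "int q dvd 4 * t + 9" unfolding \<delta>w[symmetric] \<delta>q by simp
  ultimately have "is_unit (int q)" using coprime_t by (meson coprime_common_divisor)
  thus False using q by simp
qed

lemma nonresidue:
  assumes "odd k"
  shows "\<not> QuadRes (int q) (4 * 3 ^ k)"
proof
  assume *: "QuadRes (int q) (4 * 3 ^ k)"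
  obtain j where k: "k = 2 * j + 1" using assms by (rule oddE)
  have "(3 :: int) ^ k = 3 * (3 ^ j)\<^sup>2" unfolding k by (simp add: mult.commute flip: power_mult)
  hence "4 * 3 ^ k = 3 * (2 * 3 ^ j :: int)\<^sup>2" by (simp add: power_mult_distrib)
  hence "QuadRes (int q) (3 * (2 * 3 ^ j)\<^sup>2)" using * by simp
  moreover have pq: "Factorial_Ring.prime (int q)" using q(1) by simp
  moreover have "\<not> int q dvd 2 * 3 ^ j"
  proof
    assume "int q dvd 2 * 3 ^ j"
    hence "int q dvd 2 \<or> int q dvd 3" using prime_dvd_mult_iff[OF pq] prime_dvd_power[OF pq] by blast
    thus False using q(2) zdvd_imp_le[of "int q" 2] zdvd_imp_le[of "int q" 3] by auto
  qed
  ultimately have "QuadRes (int q) 3" using QuadRes_cancel_square by blast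
  thus False using nonres by contradiction
qed

text \<open>\<open>(2 * t - 3)\<^sup>2 - \<delta> * w\<^sup>2 = 4 * d\<close>, so
  \<open>\<delta>\<close> is a square modulo \<open>p\<close>, and reciprocity turns this
  around.\<close>

lemma prime_dvd_d_residue:
  assumes p: "Factorial_Ring.prime (p :: int)" "odd p" "p dvd d"
  shows "QuadRes (int q) p"
proof -
  obtain l :: nat where l: "p = int l" "Factorial_Ring.prime l" using prime_int_nat[OF p(1)] .
  have l2: "2 < l" using prime_ge_2_nat[OF l(2)] p(2) l(1) by (cases "l = 2") auto
  have np: "\<not> p dvd 4 * t + 9"
  proof
    assume "p dvd 4 * t + 9"
    hence "is_unit p" using coprime_t p(3) by (meson coprime_common_divisor)
    thus False using p(1) not_prime_unit by blast
  qed
  have "(2 * t - 3)\<^sup>2 - \<delta> * w\<^sup>2 = 4 * d" unfolding \<delta>w by (simp add: power2_eq_square algebra_simps)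
  hence "[(2 * t - 3)\<^sup>2 = \<delta> * w\<^sup>2] (mod p)" using p(3) by (simp add: cong_iff_dvd_diff)
  hence "QuadRes p (\<delta> * w\<^sup>2)" unfolding QuadRes_def by blast
  moreover have "\<not> p dvd w" "\<not> p dvd \<delta>" using np unfolding \<delta>w[symmetric] by (auto simp: power2_eq_square)
  ultimately have "QuadRes p \<delta>" using QuadRes_cancel_square[OF p(1)] by blast
  thus ?thesis
    using quadratic_reciprocity_signed[OF q(1) _ l(2) l2 \<delta>q] q(2) \<open>\<not> p dvd \<delta>\<close> unfolding l(1) by simp
qed

text \<open>Squares contribute even multiplicities, and an odd prime dividing \<open>e\<close> does
  not divide \<open>f\<close>; so a prime of odd multiplicity in \<open>e\<close> has odd
  multiplicity in \<open>m\<close>. It is neither 2 nor \<open>q\<close>, hence divides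
  \<open>d\<close>.\<close>

lemma residue_of_factor:
  fixes e f c v :: int
  assumes eq: "c\<^sup>2 * (e * f) = m * v\<^sup>2" and nz: "e \<noteq> 0" "f \<noteq> 0" "c \<noteq> 0" "v \<noteq> 0"
    and common: "\<And>p. Factorial_Ring.prime p \<Longrightarrow> p dvd e \<Longrightarrow> p dvd f \<Longrightarrow> p = 2"
    and two: "even (multiplicity 2 e)" and nq: "\<not> int q dvd e"
  shows "QuadRes (int q) \<bar>e\<bar>"
proof (rule odd_multiplicity_induct)
  show "\<bar>e\<bar> > 0" using nz by simp
  show "QuadRes (int q) 1" using QuadRes_square[of "int q" 1] by simp
  show "QuadRes (int q) (a * b)" if "QuadRes (int q) a" "QuadRes (int q) b" for a b
    using that by (rule QuadRes_mult)
  show "QuadRes (int q) (p\<^sup>2)" for p by (rule QuadRes_square)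
  fix p :: int assume p: "Factorial_Ring.prime p" and "odd (multiplicity p \<bar>e\<bar>)"
  hence modd: "odd (multiplicity p e)" using multiplicity_normalize_right[of p e] by simp
  have pe: "p dvd e" by (rule odd_multiplicity_dvd[OF modd])
  have p2: "p \<noteq> 2" using two modd by auto
  hence "\<not> p dvd f" using common[OF p pe] by blast
  hence mf: "multiplicity p f = 0" by (rule not_dvd_imp_multiplicity_0)
  have pp: "prime_elem p" using p by blast
  have mnz: "m \<noteq> 0" using m_mod_8 by auto
  have "multiplicity p (c\<^sup>2 * (e * f)) = 2 * multiplicity p c + multiplicity p e"
    using nz mf by (simp add: prime_elem_multiplicity_mult_distrib[OF pp] prime_elem_multiplicity_power_distrib[OF pp])
  moreover have "multiplicity p (m * v\<^sup>2) = multiplicity p m + 2 * multiplicity p v"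
    using nz mnz by (simp add: prime_elem_multiplicity_mult_distrib[OF pp] prime_elem_multiplicity_power_distrib[OF pp])
  ultimately have "odd (multiplicity p m)" using modd unfolding eq by presburger
  hence "p dvd \<delta> * d" unfolding m_def[symmetric] by (rule odd_multiplicity_dvd)
  moreover have "\<not> p dvd \<delta>"
  proof
    assume "p dvd \<delta>"
    hence "p dvd int q" using abs_\<delta> by (metis dvd_abs_iff)
    hence "p = int q" using p q(1) by (simp add: primes_dvd_imp_eq)
    thus False using pe nq by simp
  qed
  ultimately have "p dvd d" using prime_dvd_mult_iff[OF p] by blast
  moreover have "odd p" using prime_odd_int[OF p] prime_ge_2_int[OF p] p2 by simp
  ultimately show "QuadRes (int q) p" using prime_dvd_d_residue[OF p] by blast
qed

text \<open>For positive \<open>\<delta>\<close> the prime \<open>p\<close> has odd multiplicity on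
  the right, since it divides neither \<open>q\<close> nor \<open>t - 4\<close>. On the left it
  cannot divide the sum of the squares of \<open>a\<close> and \<open>2 * 3 ^ k\<close>, since it
  divides neither 2 nor 3.\<close>

lemma no_solution_minus:
  fixes a c v :: int
  assumes eq: "c\<^sup>2 * (a\<^sup>2 + 4 * 9 ^ k) = m * v\<^sup>2" and c: "c \<noteq> 0"
  shows False
proof -
  have "(0::int) < 9 ^ k" by simp
  hence pos: "a\<^sup>2 + 4 * 9 ^ k > 0" using zero_le_power2[of a] by linarith
  hence lhs: "c\<^sup>2 * (a\<^sup>2 + 4 * 9 ^ k) > 0" using c by (intro mult_pos_pos) auto
  hence v: "v \<noteq> 0" unfolding eq by auto
  show False
  proof (cases "\<delta> < 0")
    case True
    hence "m < 0" unfolding m_def using d_pos by (rule mult_neg_pos)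
    hence "m * v\<^sup>2 \<le> 0" by (simp add: mult_nonpos_nonneg)
    thus False using lhs unfolding eq by linarith
  next
    case False
    hence *: "q mod 4 = 1" "t > 4" "t mod 4 = 3" using sign by auto
    obtain p where p: "Factorial_Ring.prime p" "p mod 4 = 3" "odd (multiplicity p t)"
      using exists_prime_3_mod_4[of t] * by auto
    have pp: "prime_elem p" using p(1) by blast
    have pt: "p dvd t" by (rule odd_multiplicity_dvd[OF p(3)])
    have p_not: "\<not> p dvd 2" "\<not> p dvd 3" "\<not> p dvd int q"
    proof -
      have "p \<noteq> 2" "p \<noteq> int q" using p(2) *(1) by presburger+
      thus "\<not> p dvd 2" "\<not> p dvd int q"
        using primes_dvd_imp_eq[OF p(1), of 2] primes_dvd_imp_eq[OF p(1), of "int q"] q(1) by auto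
      show "\<not> p dvd 3"
      proof
        assume "p dvd 3"
        hence "p = 3" using p(1) by (intro primes_dvd_imp_eq) auto
        thus False using pt t_mod_3 by presburger
      qed
    qed
    have "\<not> p dvd t - 4"
    proof
      assume "p dvd t - 4"
      hence "p dvd t - (t - 4)" by (rule dvd_diff[OF pt])
      also have "t - (t - 4) = 2 * 2" by simp
      finally have "p dvd 2 * 2" .
      thus False using p_not(1) prime_dvd_mult_iff[OF p(1)] by blast
    qed
    hence m0: "multiplicity p (t - 4) = 0" by (rule not_dvd_imp_multiplicity_0)
    have "\<not> p dvd \<delta>" using p_not(3) abs_\<delta> by (metis dvd_abs_iff)
    hence m1: "multiplicity p \<delta> = 0" by (rule not_dvd_imp_multiplicity_0)
    have nz: "\<delta> \<noteq> 0" "t \<noteq> 0" "t - 4 \<noteq> 0" using abs_\<delta> q(2) *(2) by auto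
    have "multiplicity p (m * v\<^sup>2) = multiplicity p t + 2 * multiplicity p v"
      unfolding m_def using nz v m0 m1
      by (simp add: prime_elem_multiplicity_mult_distrib[OF pp] prime_elem_multiplicity_power_distrib[OF pp])
    hence oddm: "odd (multiplicity p (m * v\<^sup>2))" using p(3) by simp
    have "\<not> p dvd a\<^sup>2 + 4 * 9 ^ k"
    proof
      assume "p dvd a\<^sup>2 + 4 * 9 ^ k"
      also have "(4::int) * 9 ^ k = (2 * 3 ^ k)\<^sup>2"
      proof -
        have "(9::int) ^ k = (3\<^sup>2) ^ k" by simp
        also have "\<dots> = (3 ^ k)\<^sup>2" by (simp only: power_mult[symmetric] mult.commute)
        finally show ?thesis by (simp add: power_mult_distrib)
      qed
      finally have "p dvd 2 * 3 ^ k" by (rule prime_3_mod_4_dvd_sum_squares[OF p(1,2)])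
      thus False using p_not(1,2) prime_dvd_mult_iff[OF p(1)] prime_dvd_power[OF p(1)] by blast
    qed
    hence "multiplicity p (a\<^sup>2 + 4 * 9 ^ k) = 0" by (rule not_dvd_imp_multiplicity_0)
    hence "multiplicity p (c\<^sup>2 * (a\<^sup>2 + 4 * 9 ^ k)) = 2 * multiplicity p c"
      using c pos by (subst prime_elem_multiplicity_mult_distrib[OF pp])
        (auto simp: prime_elem_multiplicity_power_distrib[OF pp])
    thus False using oddm unfolding eq by simp
  qed
qed

lemma QuadRes_abs:
  assumes "QuadRes (int q) \<bar>x\<bar>" "x \<ge> 0 \<or> QuadRes (int q) (-1)"
  shows "QuadRes (int q) x"
proof (cases "x \<ge> 0")
  case False
  hence "QuadRes (int q) ((-1) * \<bar>x\<bar>)" using assms by (intro QuadRes_mult) auto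
  thus ?thesis using False by simp
qed (use assms in simp)

text \<open>The residue argument for \<open>a + 2 * 3 ^ k\<close> and \<open>a - 2 * 3 ^ k\<close>
  cannot handle the prime 2, so much of the proof is a 2-adic analysis: both factors contain 2 to an
  even power.\<close>

lemma no_solution_plus:
  fixes a c v :: int
  assumes eq: "c\<^sup>2 * (a\<^sup>2 - 4 * 9 ^ k) = m * v\<^sup>2" and c: "c \<noteq> 0" and cv: "Rings.coprime c v"
    and a3: "\<not> 3 dvd a" and k: "odd k"
  shows False
proof -
  define u :: int where "u = 3 ^ k"
  have u9: "9 ^ k = u\<^sup>2"
  proof -
    have "(9::int) ^ k = (3\<^sup>2) ^ k" by simp
    also have "\<dots> = (3 ^ k)\<^sup>2" by (simp only: power_mult[symmetric] mult.commute)
    finally show ?thesis unfolding u_def .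
  qed
  have oddu: "odd u" by (simp add: u_def)
  have u8: "u\<^sup>2 mod 8 = 1" by (rule odd_square_mod_8[OF oddu])
  have u3: "3 dvd u" using k by (cases k) (auto simp: u_def)
  have upos: "u > 0" by (simp add: u_def)
  define e where "e = a + 2 * u"
  define f where "f = a - 2 * u"
  have ef: "e * f = a\<^sup>2 - 4 * 9 ^ k" by (simp add: e_def f_def u9 power2_eq_square algebra_simps)
  have eq': "c\<^sup>2 * (e * f) = m * v\<^sup>2" unfolding ef by (rule eq)
  have "\<not> 3 dvd e" "\<not> 3 dvd f"
    unfolding e_def f_def using a3 u3 by (simp_all add: dvd_add_left_iff dvd_diff_left_iff)
  hence nz: "e \<noteq> 0" "f \<noteq> 0" by auto
  have v: "v \<noteq> 0" using eq' nz c by auto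
  have "c\<^sup>2 dvd m * v\<^sup>2" unfolding eq'[symmetric] by simp
  moreover have "Rings.coprime (c\<^sup>2) (v\<^sup>2)" using cv by simp
  ultimately have cm: "c\<^sup>2 dvd m" by (simp add: coprime_dvd_mult_left_iff)
  have oddc: "odd c"
  proof
    assume "even c"
    hence "even (c\<^sup>2)" by simp
    hence "even m" using cm by (rule dvd_trans)
    thus False using m_mod_8 by presburger
  qed
  \<comment> \<open>\<open>c\<^sup>2\<close> and \<open>m\<close> are both 1 modulo 8, so such an
    equation becomes \<open>y = z\<^sup>2\<close> modulo 8.\<close>
  have red: "y mod 8 = z\<^sup>2 mod 8" if yz: "c\<^sup>2 * y = m * z\<^sup>2" for y z
  proof -
    have "(c\<^sup>2 * y) mod 8 = (c\<^sup>2 mod 8) * (y mod 8) mod 8" by (simp add: mod_mult_eq)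
    also have "\<dots> = y mod 8" unfolding odd_square_mod_8[OF oddc] by simp
    finally have 1: "(c\<^sup>2 * y) mod 8 = y mod 8" .
    have "(m * z\<^sup>2) mod 8 = (m mod 8) * (z\<^sup>2 mod 8) mod 8" by (simp add: mod_mult_eq)
    also have "\<dots> = z\<^sup>2 mod 8" unfolding m_mod_8 by simp
    finally show ?thesis using 1 yz by simp
  qed
  have efu: "e * f = a\<^sup>2 - 4 * u\<^sup>2" using ef u9 by simp
  have ev: "(a\<^sup>2 - 4 * u\<^sup>2) mod 8 = v\<^sup>2 mod 8" using red[OF eq'] unfolding efu .
  have arith: "(y - 4 * z) mod 8 = x mod 8 \<Longrightarrow> y mod 8 = 1 \<Longrightarrow> z mod 8 = 1 \<Longrightarrow> x mod 8 = 5"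
    "(4 * y - 4 * z) mod 8 = x mod 8 \<Longrightarrow> even x"
    "(4 * y - z) mod 8 = x mod 8 \<Longrightarrow> z mod 8 = 1 \<Longrightarrow> odd x \<and> x mod 8 \<noteq> 1" for x y z :: int
    by presburger+
  \<comment> \<open>For odd \<open>a\<close> the square \<open>v\<^sup>2\<close> would be 1 - 4,
    that is 5, modulo 8.\<close>
  have "even a"
  proof (rule ccontr)
    assume "\<not> even a"
    hence "a\<^sup>2 mod 8 = 1" by (rule odd_square_mod_8)
    hence "v\<^sup>2 mod 8 = 5" by (rule arith(1)[OF ev _ u8])
    thus False using not_square_mod_8[of "v\<^sup>2" v] by simp
  qed
  then obtain b where b: "a = 2 * b" by blast
  have a2: "a\<^sup>2 = 4 * b\<^sup>2" by (simp add: b power_mult_distrib)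
  have "even (v\<^sup>2)" by (rule arith(2)[OF ev[unfolded a2]])
  hence "even v" by simp
  then obtain v' where v': "v = 2 * v'" by blast
  have "4 * (c\<^sup>2 * (b\<^sup>2 - u\<^sup>2)) = c\<^sup>2 * (e * f)" unfolding efu a2 by (simp add: algebra_simps)
  also have "\<dots> = 4 * (m * v'\<^sup>2)" unfolding eq' v' by (simp add: power_mult_distrib)
  finally have eq2: "c\<^sup>2 * (b\<^sup>2 - u\<^sup>2) = m * v'\<^sup>2" by simp
  have bu: "(b\<^sup>2 - u\<^sup>2) mod 8 = v'\<^sup>2 mod 8" by (rule red[OF eq2])
  \<comment> \<open>For even \<open>b\<close> the square of \<open>v'\<close> would be odd and 3 or
    7 modulo 8.\<close>
  have oddb: "odd b"
  proof
    assume "even b"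
    then obtain b' where "b = 2 * b'" by blast
    hence b2: "b\<^sup>2 = 4 * b'\<^sup>2" by (simp add: power_mult_distrib)
    hence *: "odd (v'\<^sup>2) \<and> v'\<^sup>2 mod 8 \<noteq> 1" using arith(3)[OF bu[unfolded b2] u8] by blast
    hence "odd v'" by simp
    hence "v'\<^sup>2 mod 8 = 1" by (rule odd_square_mod_8)
    thus False using * by blast
  qed
  have p2: "prime_elem (2::int)" by simp
  have nz': "b + u \<noteq> 0" "b - u \<noteq> 0" using nz by (auto simp: e_def f_def b)
  have v'nz: "v' \<noteq> 0" using v v' by simp
  have mult_odd: "odd (multiplicity 2 (b + u)) \<and> odd (multiplicity 2 (b - u))"
  proof -
    have mc: "multiplicity 2 c = 0" "multiplicity 2 m = 0"
      using oddc m_mod_8 by (auto intro!: not_dvd_imp_multiplicity_0) presburger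
    have mnz: "m \<noteq> 0" using m_mod_8 by auto
    have "multiplicity 2 (c\<^sup>2 * ((b + u) * (b - u))) = multiplicity 2 (b + u) + multiplicity 2 (b - u)"
      using c nz' mc by (simp add: prime_elem_multiplicity_mult_distrib[OF p2] prime_elem_multiplicity_power_distrib[OF p2])
    moreover have "multiplicity 2 (m * v'\<^sup>2) = 2 * multiplicity 2 v'"
      using mnz v'nz mc by (simp add: prime_elem_multiplicity_mult_distrib[OF p2] prime_elem_multiplicity_power_distrib[OF p2])
    moreover have "(b + u) * (b - u) = b\<^sup>2 - u\<^sup>2" by (simp add: power2_eq_square algebra_simps)
    ultimately have "multiplicity 2 (b + u) + multiplicity 2 (b - u) = 2 * multiplicity 2 v'"
      using eq2 by (simp only:)
    hence sum: "even (multiplicity 2 (b + u) + multiplicity 2 (b - u))" by (simp only: dvd_triv_left)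
    have one: "multiplicity 2 x = 1" if "x mod 4 = 2" for x :: int
    proof (rule multiplicity_eqI)
      show "2 ^ 1 dvd x" using that by simp presburger
      show "\<not> 2 ^ Suc 1 dvd x" using that by simp presburger
    qed
    \<comment> \<open>Both numbers are even and differ by \<open>2 * u\<close>, which is 2 modulo 4,
      so one of them is divisible by 2 exactly once. The multiplicities have an even sum, so the
      other one is odd too.\<close>
    have "(b + u) mod 4 = 2 \<or> (b - u) mod 4 = 2" using oddb oddu by presburger
    thus ?thesis
    proof
      assume "(b + u) mod 4 = 2"
      thus ?thesis using one[of "b + u"] sum by simp
    next
      assume "(b - u) mod 4 = 2"
      thus ?thesis using one[of "b - u"] sum by simp
    qed
  qed
  have two: "even (multiplicity 2 e)" "even (multiplicity 2 f)"
  proof -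
    have "e = 2 * (b + u)" "f = 2 * (b - u)" by (simp_all add: e_def f_def b)
    moreover have "multiplicity 2 (2 * x) = 1 + multiplicity 2 x" if "x \<noteq> 0" for x :: int
      using prime_elem_multiplicity_mult_distrib[OF p2 _ that, of 2] multiplicity_prime[OF p2] by simp
    ultimately have "multiplicity 2 e = 1 + multiplicity 2 (b + u)" "multiplicity 2 f = 1 + multiplicity 2 (b - u)"
      using nz' by (simp_all only: not_False_eq_True)
    thus "even (multiplicity 2 e)" "even (multiplicity 2 f)" using mult_odd by simp_all
  qed
  have diff: "e - f = 4 * 3 ^ k" by (simp add: e_def f_def u_def)
  have common: "p = 2" if p: "Factorial_Ring.prime p" and "p dvd e" "p dvd f" for p :: int
  proof -
    have "p dvd e - f" using that(2,3) by (rule dvd_diff)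
    hence "p dvd (2 * 2) * 3 ^ k" unfolding diff by simp
    hence "p dvd 2 \<or> p dvd 3"
      using prime_dvd_mult_iff[OF p] prime_dvd_power[OF p] by blast
    moreover have "p \<noteq> 3" using \<open>\<not> 3 dvd e\<close> that(2) by auto
    ultimately show ?thesis using primes_dvd_imp_eq[OF p, of 2] primes_dvd_imp_eq[OF p, of 3] by auto
  qed
  have pq: "Factorial_Ring.prime (int q)" using q(1) by simp
  \<comment> \<open>\<open>c\<^sup>2\<close> divides \<open>m = \<delta> * d\<close>, and
    \<open>q\<close> divides this only once.\<close>
  have "\<not> int q dvd c"
  proof
    assume "int q dvd c"
    from mult_dvd_mono[OF this this] have "int q * int q dvd c\<^sup>2" unfolding power2_eq_square .
    hence "int q * int q dvd m" using cm by (rule dvd_trans)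
    hence "int q * int q dvd \<bar>\<delta> * d\<bar>" by (simp add: m_def)
    hence "int q * int q dvd int q * \<bar>d\<bar>" unfolding abs_mult abs_\<delta> .
    hence "int q dvd \<bar>d\<bar>" using q(2) by (simp only: dvd_mult_cancel_left) auto
    thus False using q_coprime_d by simp
  qed
  moreover have "int q dvd c\<^sup>2 * (e * f)"
  proof -
    have "int q dvd \<delta>" using abs_\<delta> by (metis dvd_abs_iff dvd_refl)
    thus ?thesis unfolding eq' m_def by simp
  qed
  ultimately have qef: "int q dvd e \<or> int q dvd f"
    using prime_dvd_mult_iff[OF pq] prime_dvd_power[OF pq] by blast
  have not_both: "\<not> (int q dvd e \<and> int q dvd f)" using common[OF pq] q(2) by auto
  \<comment> \<open>For negative \<open>\<delta>\<close> the product \<open>e * f\<close> is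
    nonpositive and \<open>e > f\<close>, so \<open>e\<close> and \<open>- f\<close> are
    nonnegative.\<close>
  have signs: "QuadRes (int q) (-1) \<or> e \<ge> 0 \<and> - f \<ge> 0"
  proof (cases "\<delta> < 0")
    case True
    hence "m < 0" unfolding m_def using d_pos by (rule mult_neg_pos)
    hence "c\<^sup>2 * (e * f) \<le> 0" unfolding eq' by (simp add: mult_nonpos_nonneg)
    hence "e * f \<le> 0" using c by (simp add: mult_le_0_iff)
    moreover have "e > f" using upos by (simp add: e_def f_def)
    ultimately show ?thesis using nz by (auto simp: mult_le_0_iff)
  qed (use sign in auto)
  \<comment> \<open>\<open>q\<close> divides exactly one factor. Since
    \<open>e - f = 4 * 3 ^ k\<close>, either \<open>e\<close> or \<open>- f\<close> is then
    congruent to the nonresidue \<open>4 * 3 ^ k\<close>.\<close>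
  show False
  proof (cases "int q dvd f")
    case True
    hence "QuadRes (int q) \<bar>e\<bar>"
      using residue_of_factor[OF eq' nz c v common two(1)] not_both by blast
    hence "QuadRes (int q) e" using QuadRes_abs signs by blast
    moreover have "[e = 4 * 3 ^ k] (mod int q)" using True diff by (simp add: cong_iff_dvd_diff flip: diff)
    ultimately show False using QuadRes_cong nonresidue[OF k] by blast
  next
    case False
    have "c\<^sup>2 * (f * e) = m * v\<^sup>2" using eq' by (simp add: mult.commute)
    hence "QuadRes (int q) \<bar>f\<bar>"
      using residue_of_factor[OF _ nz(2,1) c v _ two(2) False] common by blast
    hence "QuadRes (int q) \<bar>- f\<bar>" by simp
    hence "QuadRes (int q) (- f)" using QuadRes_abs[of "- f"] signs by blast
    moreover have "[- f = 4 * 3 ^ k] (mod int q)"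
    proof -
      have "- f - 4 * 3 ^ k = - e" using diff by simp
      thus ?thesis using False qef by (simp add: cong_iff_dvd_diff)
    qed
    ultimately show False using QuadRes_cong nonresidue[OF k] by blast
  qed
qed

lemma D_mod_3: "[D = 1] (mod 3)"
proof -
  have "t = 3 * (t div 3) + 2" using t_mod_3 by presburger
  then obtain j where j: "t = 3 * j + 2" by blast
  have "D - 1 = 3 * (36 * j ^ 3 + 51 * j\<^sup>2 - 16 * j - 23)"
    unfolding D_def unfolding j by (simp add: algebra_simps power2_eq_square power3_eq_cube)
  thus ?thesis by (simp only: cong_iff_dvd_diff dvd_triv_left)
qed

lemma not_principal:
  fixes k :: nat
  assumes k: "odd k" and pow: "K.prime3 [^]\<^bsub>K.IG\<^esub> (2 * k) \<in> K.PI"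
  shows False
proof -
  have "2 * k > 0" using k by (cases k) auto
  then obtain z a where z: "z \<in> K.OK" "z + K.conj z = of_int a" "\<not> 3 dvd a"
      and norm: "z * K.conj z = 3 ^ (2 * k) \<or> z * K.conj z = - (3 ^ (2 * k))"
    using K.gen_power_principal[OF D_mod_3 _ pow] by blast
  have zK: "z \<in> K" using z(1) by simp
  \<comment> \<open>Trace and norm of \<open>z\<close> satisfy
    \<open>a\<^sup>2 - 4 * (z * K.conj z) = m * (2 * w * c1 z)\<^sup>2\<close>. As \<open>m\<close>
    may have square factors, the number squared on the right may be fractional; \<open>v / c\<close>
    is its reduced form and the source of the factor \<open>c\<^sup>2\<close>.\<close>
  have "of_int w * (2 * K.c1 z) \<in> \<rat>" using K.coord_in(2)[OF zK] by simp
  then obtain v c :: int where vc: "c > 0" "Rings.coprime v c" "of_int w * (2 * K.c1 z) = of_int v / of_int c"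
    by (rule Rats_cases')
  have y: "of_int c * (of_int w * (2 * K.c1 z)) = of_int v" using vc(1) unfolding vc(3) by simp
  have a: "of_int a = 2 * K.c0 z" using z(2) K.trace_eq[OF zK] by simp
  have id: "C\<^sup>2 * ((2 * A)\<^sup>2 - 4 * (A\<^sup>2 - (M' * W\<^sup>2) * B\<^sup>2)) = M' * (C * (W * (2 * B)))\<^sup>2"
    for A B C W M' :: complex by (simp add: algebra_simps power2_eq_square)
  have "(of_int c)\<^sup>2 * ((of_int a)\<^sup>2 - 4 * (z * K.conj z)) = (of_int (m * v\<^sup>2) :: complex)"
    unfolding K.norm_eq[OF zK] D_eq of_int_mult of_int_power a id y ..
  moreover have "(3 :: complex) ^ (2 * k) = of_int (9 ^ k)" by (simp add: power_mult)
  ultimately have "(of_int (c\<^sup>2 * (a\<^sup>2 - 4 * 9 ^ k)) :: complex) = of_int (m * v\<^sup>2) \<or>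
      (of_int (c\<^sup>2 * (a\<^sup>2 + 4 * 9 ^ k)) :: complex) = of_int (m * v\<^sup>2)"
    using norm by auto
  hence "c\<^sup>2 * (a\<^sup>2 - 4 * 9 ^ k) = m * v\<^sup>2 \<or> c\<^sup>2 * (a\<^sup>2 + 4 * 9 ^ k) = m * v\<^sup>2"
    unfolding of_int_eq_iff .
  thus False
    using no_solution_plus[of c a k v] no_solution_minus[of c a k v] vc z(3) k
    by (auto simp: coprime_commute)
qed

text \<open>An odd exponent \<open>n\<close> is reduced to \<open>2 * n\<close>, so a single case
  remains, that of twice an odd number.\<close>

lemma four_dvd:
  assumes "n > 0" "K.prime3 [^]\<^bsub>K.IG\<^esub> (n::nat) \<in> K.PI"
  shows "4 dvd n"
proof (rule ccontr)
  assume n4: "\<not> 4 dvd n"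
  have IG: "K.prime3 \<in> carrier K.IG"
    using K.fractional_ideal_ideal[OF K.ideal_prime3 K.prime3_nonzero] by simp
  show False
  proof (cases "odd n")
    case True
    have "K.prime3 [^]\<^bsub>K.IG\<^esub> (n + n) \<in> K.PI"
      using subgroup.m_closed[OF K.subgroup_PI assms(2) assms(2)] K.IG.nat_pow_mult[OF IG, of n n] by simp
    thus False using not_principal[OF True] by (simp add: mult_2)
  next
    case False
    then obtain k where k: "n = 2 * k" by blast
    hence "odd k" using n4 by auto
    thus False using not_principal assms(2) unfolding k by blast
  qed
qed

lemma class_of_order_4:
  "\<exists>c\<in>carrier (ideal_class_group K). group.ord (ideal_class_group K) c = 4"
proof (rule K.exists_class_of_order_4)
  show "K.prime3 \<in> carrier K.IG"
    using K.fractional_ideal_ideal[OF K.ideal_prime3 K.prime3_nonzero] by simp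
qed (rule four_dvd)

end

subsection \<open>Infinitely many fields\<close>

text \<open>A common divisor with \<open>t\<close> divides 9 and one with \<open>t - 4\<close>
  divides 25; the congruences exclude 3 and 5.\<close>

lemma coprime_family:
  fixes t :: int
  assumes "t mod 3 = 2" "t mod 5 = 3"
  shows "Rings.coprime (t * (t - 4)) (4 * t + 9)"
proof -
  have p3: "Factorial_Ring.prime (3::int)" and p5: "Factorial_Ring.prime (5::int)" by simp_all
  have "\<not> 3 dvd t" "\<not> 5 dvd t - 4" using assms by presburger+
  hence "Rings.coprime 3 t" "Rings.coprime 5 (t - 4)"
    using prime_imp_coprime[OF p3] prime_imp_coprime[OF p5] by blast+
  hence cop: "Rings.coprime (3\<^sup>2) t" "Rings.coprime (5\<^sup>2) (t - 4)"
    by (simp_all only: coprime_power_left_iff) simp_all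
  have "Rings.coprime t (4 * t + 9)"
  proof (rule coprimeI)
    fix c assume c: "c dvd t" "c dvd 4 * t + 9"
    have "c dvd (4 * t + 9) - 4 * t" by (rule dvd_diff[OF c(2) dvd_mult[OF c(1)]])
    hence "c dvd 3\<^sup>2" by simp
    thus "is_unit c" using cop(1) c(1) by (meson coprime_common_divisor)
  qed
  moreover have "Rings.coprime (t - 4) (4 * t + 9)"
  proof (rule coprimeI)
    fix c assume c: "c dvd t - 4" "c dvd 4 * t + 9"
    have "c dvd (4 * t + 9) - 4 * (t - 4)" by (rule dvd_diff[OF c(2) dvd_mult[OF c(1)]])
    hence "c dvd 5\<^sup>2" by simp
    thus "is_unit c" using cop(2) c(1) by (meson coprime_common_divisor)
  qed
  ultimately show ?thesis by simp
qed

text \<open>The prime \<open>l\<close> divides \<open>\<delta> v\<^sup>2 - 1\<close> for a suitable multiple \<open>v\<close> of \<open>N\<close>, and \<open>w\<close> is close to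
  \<open>3 v\<close> or \<open>3 v + l\<close> in the \<open>l\<close>-adic sense.\<close>

lemma exists_exact_prime_divisor:
  fixes \<delta> w0 N :: int
  assumes "\<delta> \<noteq> 0" "N \<noteq> 0"
  shows "\<exists>w l. Factorial_Ring.prime l \<and> \<not> l dvd N \<and> \<not> l dvd 240 \<and> [w = w0] (mod 240) \<and>
    l dvd \<delta> * w\<^sup>2 - 9 \<and> \<not> l\<^sup>2 dvd \<delta> * w\<^sup>2 - 9"
proof -
  \<comment> \<open>The factors 240, \<open>\<delta>\<close> and \<open>N\<close> of
    \<open>v\<close> make every prime divisor \<open>l\<close> of
    \<open>\<delta> * v\<^sup>2 - 1\<close> prime to all of them.\<close>
  define v where "v = 240 * \<delta> * N"
  have v: "v \<noteq> 0" using assms by (simp add: v_def)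
  obtain y where y: "\<delta> * v\<^sup>2 = 240 * y" unfolding v_def by (simp add: power2_eq_square)
  have "\<delta> * v\<^sup>2 \<noteq> 0" using v assms by simp
  hence y0: "y \<noteq> 0" using y by auto
  have "\<delta> * v\<^sup>2 - 1 \<noteq> 0" "\<not> is_unit (\<delta> * v\<^sup>2 - 1)" unfolding y using y0 by (auto simp: zdvd1_eq)
  then obtain l where l: "Factorial_Ring.prime l" "l dvd \<delta> * v\<^sup>2 - 1"
    using prime_divisor_exists by blast
  have lv: "\<not> l dvd v"
  proof
    assume "l dvd v"
    hence "l dvd \<delta> * v\<^sup>2" by (simp add: power2_eq_square)
    hence "l dvd \<delta> * v\<^sup>2 - (\<delta> * v\<^sup>2 - 1)" using l(2) by (rule dvd_diff)
    hence "is_unit l" by simp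
    thus False using l(1) not_prime_unit by blast
  qed
  hence ln: "\<not> l dvd 240" "\<not> l dvd \<delta>" "\<not> l dvd N" unfolding v_def by auto
  define B where "B w = \<delta> * w\<^sup>2 - 9" for w
  have B1: "l dvd B (3 * v)"
  proof -
    have "B (3 * v) = 9 * (\<delta> * v\<^sup>2 - 1)" by (simp add: B_def power_mult_distrib algebra_simps)
    thus ?thesis using dvd_mult[OF l(2), of 9] by (simp only:)
  qed
  have B2: "B (3 * v + l) = B (3 * v) + (l * (6 * \<delta> * v) + \<delta> * l\<^sup>2)"
    by (simp add: B_def power2_eq_square algebra_simps)
  \<comment> \<open>If \<open>l\<^sup>2\<close> divides \<open>B (3 * v)\<close>, shifting the
    argument by \<open>l\<close> changes \<open>B\<close> by \<open>6 * \<delta> * v * l\<close>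
    modulo \<open>l\<^sup>2\<close>, and this is not zero.\<close>
  have "\<exists>w'. l dvd B w' \<and> \<not> l\<^sup>2 dvd B w'"
  proof (cases "l\<^sup>2 dvd B (3 * v)")
    case True
    have "l dvd B (3 * v + l)" unfolding B2 using B1 by (simp add: power2_eq_square)
    moreover have "\<not> l\<^sup>2 dvd B (3 * v + l)"
    proof
      assume "l\<^sup>2 dvd B (3 * v + l)"
      hence "l\<^sup>2 dvd B (3 * v + l) - B (3 * v) - \<delta> * l\<^sup>2" using True by (intro dvd_diff) auto
      also have "B (3 * v + l) - B (3 * v) - \<delta> * l\<^sup>2 = l * (6 * \<delta> * v)" unfolding B2 by simp
      finally have "l * l dvd l * (6 * \<delta> * v)" by (simp only: power2_eq_square)
      hence "l dvd 6 * \<delta> * v" using l(1) by auto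
      hence "l dvd 6" using ln lv prime_dvd_mult_iff[OF l(1)] by blast
      hence "l dvd 6 * 40" by (rule dvd_mult2)
      thus False using ln(1) by simp
    qed
    ultimately show ?thesis by blast
  qed (use B1 in blast)
  then obtain w' where w': "l dvd B w'" "\<not> l\<^sup>2 dvd B w'" by blast
  \<comment> \<open>The Chinese remainder theorem restores the prescribed class modulo 240, while
    both divisibilities depend only on \<open>w\<close> modulo \<open>l\<^sup>2\<close>.\<close>
  have "Rings.coprime 240 (l\<^sup>2)" using prime_imp_coprime[OF l(1) ln(1)] by (simp add: coprime_commute)
  then obtain w where w: "[w = w0] (mod 240)" "[w = w'] (mod l\<^sup>2)"
    using binary_chinese_remainder_int by blast
  have "l\<^sup>2 dvd w - w'" using w(2) by (simp add: cong_iff_dvd_diff)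
  hence l2: "l\<^sup>2 dvd \<delta> * (w + w') * (w - w')" by (rule dvd_mult)
  have Bw: "B w = B w' + \<delta> * (w + w') * (w - w')"
    by (simp add: B_def power2_eq_square algebra_simps)
  have "\<not> l\<^sup>2 dvd B w" unfolding Bw using l2 w'(2) by (simp add: dvd_add_left_iff)
  moreover have "l dvd B w"
  proof -
    have "l dvd \<delta> * (w + w') * (w - w')" using l2 by (metis dvd_trans dvd_triv_left power2_eq_square)
    thus ?thesis unfolding Bw using w'(1) by simp
  qed
  ultimately show ?thesis using l(1) ln w(1) unfolding B_def by blast
qed

text \<open>\<open>l\<close> divides \<open>t\<close> exactly once and, being prime to 4 and 9,
  divides neither \<open>t - 4\<close> nor \<open>4 * t + 9\<close>.\<close>

lemma (in c4_family) odd_multiplicity_D: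
  assumes l: "Factorial_Ring.prime l" "\<not> l dvd 240" "l dvd 4 * t" "\<not> l\<^sup>2 dvd 4 * t"
  shows "odd (multiplicity l D)"
proof -
  have pe: "prime_elem l" using l(1) by blast
  have small: "\<not> l dvd 2" "\<not> l dvd 3"
  proof -
    have "(240::int) = 2 * 120" "(240::int) = 3 * 80" by simp_all
    thus "\<not> l dvd 2" "\<not> l dvd 3" using l(2) by (metis dvd_mult2)+
  qed
  have four: "\<not> l dvd 4" using small(1) prime_dvd_mult_iff[OF l(1), of 2 2] by simp
  have nine: "\<not> l dvd 9" using small(2) prime_dvd_mult_iff[OF l(1), of 3 3] by simp
  have lt: "l dvd t" using l(3) four prime_dvd_mult_iff[OF l(1)] by blast
  have "\<not> l\<^sup>2 dvd t" using l(4) by auto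
  hence m: "multiplicity l t = 1" using lt by (intro multiplicity_eqI) (simp_all add: power2_eq_square)
  have "\<not> l dvd t - 4" using lt four by (metis dvd_diff_commute dvd_diff_right_iff)
  hence m': "multiplicity l (t - 4) = 0" by (rule not_dvd_imp_multiplicity_0)
  have "\<not> l dvd 4 * t + 9" using l(3) nine by (simp add: dvd_add_right_iff)
  hence m'': "multiplicity l (4 * t + 9) = 0" by (rule not_dvd_imp_multiplicity_0)
  have "t * (t - 4) \<noteq> 0" "4 * t + 9 \<noteq> 0" using mod_8 by fastforce+
  hence "multiplicity l D = 1"
    unfolding D_def using m m' m'' by (simp add: prime_elem_multiplicity_mult_distrib[OF pe])
  thus ?thesis by simp
qed

definition family_field :: "int \<Rightarrow> complex set" where
  "family_field t = generate_field complex_field {csqrt (of_int (t * (t - 4) * (4 * t + 9)))}"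

text \<open>Finitely many fields would come from finitely many radicands, whose product is taken as
  \<open>N\<close>. Equal fields have radicands in the same square class, but the new prime divides
  one radicand to an odd power and the other not at all.\<close>

lemma infinite_family_fields:
  assumes fam: "\<And>t. t \<in> T \<Longrightarrow> c4_family t"
    and ex: "\<And>N. N \<noteq> 0 \<Longrightarrow> \<exists>t\<in>T. \<exists>l. Factorial_Ring.prime l \<and> \<not> l dvd N \<and>
      \<not> l dvd 240 \<and> l dvd 4 * t \<and> \<not> l\<^sup>2 dvd 4 * t"
  shows "infinite (family_field ` T)"
proof
  assume "finite (family_field ` T)"
  then obtain F where F: "F \<subseteq> T" "finite F" "family_field ` T = family_field ` F"
    using finite_subset_image[of "family_field ` T" family_field T] by auto
  define disc :: "int \<Rightarrow> int" where "disc t = t * (t - 4) * (4 * t + 9)" for t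
  have nz: "disc t \<noteq> 0" if "t \<in> T" for t
  proof -
    interpret c4_family t by (rule fam[OF that])
    show ?thesis using K.D_nz unfolding disc_def D_def .
  qed
  have "prod disc F \<noteq> 0" using F nz by (auto simp: prod_zero_iff)
  then obtain t l where tl: "t \<in> T" "Factorial_Ring.prime l" "\<not> l dvd prod disc F"
      "\<not> l dvd 240" "l dvd 4 * t" "\<not> l\<^sup>2 dvd 4 * t" using ex by blast
  then obtain t' where t': "t' \<in> F" "family_field t = family_field t'" using F(3) by blast
  interpret A: c4_family t by (rule fam[OF tl(1)])
  interpret B: c4_family t' by (rule fam) (use t'(1) F(1) in blast)
  have pe: "prime_elem l" using tl(2) by blast
  have "A.K = B.K" using t'(2) unfolding family_field_def A.generate_K B.generate_K .
  hence "A.r \<in> B.K" using A.r_K by simp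
  hence "A.r \<in> \<rat> \<or> A.r / B.r \<in> \<rat>" by (rule B.K.square_in_ext) (simp add: A.r_sq)
  hence "A.r / B.r \<in> \<rat>" using A.r_irrational by blast
  then obtain a b :: int where ab: "b > 0" "A.r / B.r = of_int a / of_int b" using Rats_cases' by metis
  hence "of_int b * A.r = of_int a * B.r" using B.nonzero(5) by (simp add: field_simps)
  hence "(of_int b * A.r)\<^sup>2 = (of_int a * B.r)\<^sup>2" by simp
  hence "(of_int (b\<^sup>2 * A.D) :: complex) = of_int (a\<^sup>2 * B.D)"
    by (simp add: power_mult_distrib A.r_sq B.r_sq)
  hence eq: "b\<^sup>2 * A.D = a\<^sup>2 * B.D" unfolding of_int_eq_iff .
  have "a \<noteq> 0" using eq ab(1) A.K.D_nz by auto
  have "\<not> l dvd B.D"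
  proof
    assume "l dvd B.D"
    hence "l dvd disc t'" by (simp add: disc_def B.D_def)
    hence "l dvd prod disc F" using t'(1) F(2) by (metis dvd_prodI dvd_trans)
    thus False using tl(3) by contradiction
  qed
  hence mB: "multiplicity l B.D = 0" by (rule not_dvd_imp_multiplicity_0)
  have "multiplicity l (b\<^sup>2 * A.D) = 2 * multiplicity l b + multiplicity l A.D"
    using ab(1) A.K.D_nz
    by (simp add: prime_elem_multiplicity_mult_distrib[OF pe] prime_elem_multiplicity_power_distrib[OF pe])
  moreover have "multiplicity l (a\<^sup>2 * B.D) = 2 * multiplicity l a"
    using \<open>a \<noteq> 0\<close> B.K.D_nz mB
    by (simp add: prime_elem_multiplicity_mult_distrib[OF pe] prime_elem_multiplicity_power_distrib[OF pe])
  ultimately have "even (multiplicity l A.D)" unfolding eq by presburger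
  thus False using A.odd_multiplicity_D[OF tl(2,4,5,6)] by contradiction
qed

lemma not_QuadRes_3: "\<not> QuadRes 29 3" "\<not> QuadRes 19 3"
proof -
  show "\<not> QuadRes 29 3"
  proof
    assume "QuadRes 29 3"
    hence "[1 = 3 ^ 14] (mod (29::int))" using QuadRes_imp_power_cong_1[of 29 3] by simp
    thus False by (simp add: cong_def)
  qed
  show "\<not> QuadRes 19 3"
  proof
    assume "QuadRes 19 3"
    hence "[1 = 3 ^ 9] (mod (19::int))" using QuadRes_imp_power_cong_1[of 19 3] by simp
    thus False by (simp add: cong_def)
  qed
qed

text \<open>\<open>w\<close> modulo 240 determines \<open>4 * t\<close> modulo 240, hence
  \<open>t\<close> modulo 60. The value \<open>w = 13\<close> corresponds to
  \<open>t = 1223\<close>, which is 2 modulo 3, 3 modulo 5 and 3 modulo 4.\<close>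

lemma real_family:
  assumes "29 * w\<^sup>2 = 4 * t + 9" "[w = 13] (mod 240)"
  shows "order_4_family t 29 w 29" "t > 4" "[t = -7] (mod 30)"
proof -
  obtain j where "w - 13 = 240 * j" using assms(2) by (auto simp: cong_iff_dvd_diff elim: dvdE)
  hence w: "w = 240 * j + 13" by simp
  define i where "i = 29 * (240 * j\<^sup>2 + 26 * j)"
  have "4 * t = 4 * (60 * i + 1223)"
    using assms(1) unfolding w i_def by (simp add: power2_eq_square algebra_simps)
  hence t: "t = 60 * i + 1223" by simp
  have "w \<noteq> 0" using w by presburger
  hence "w\<^sup>2 > 0" by simp
  thus t4: "t > 4" using assms(1) by linarith
  have "t - (-7) = 30 * (2 * i + 41)" unfolding t by simp
  thus "[t = -7] (mod 30)" by (simp only: cong_iff_dvd_diff dvd_triv_left)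
  have *: "t = 3 * (20 * i + 407) + 2" "t = 5 * (12 * i + 244) + 3" "t = 4 * (15 * i + 305) + 3"
    unfolding t by simp_all
  have m: "t mod 3 = 2" "t mod 5 = 3" "t mod 4 = 3"
    using mod_mult_self4[of 3 "20 * i + 407" 2] mod_mult_self4[of 5 "12 * i + 244" 3]
      mod_mult_self4[of 4 "15 * i + 305" 3]
    unfolding *[symmetric] by simp_all
  have "odd t" unfolding t by simp
  interpret c4_family t
    by unfold_locales (use m \<open>odd t\<close> coprime_family in auto)
  have "QuadRes (int 29) (-1)"
    unfolding QuadRes_def by (rule exI[of _ 12]) (simp add: cong_def)
  thus "order_4_family t 29 w 29"
    by unfold_locales (use assms(1) m t4 not_QuadRes_3 in auto)
qed

text \<open>The residue 1 comes from \<open>t = -7\<close> at \<open>w = 1\<close>. The sign of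
  \<open>\<delta>\<close> takes over the role that \<open>t mod 4 = 3\<close> has in the real
  family.\<close>

lemma imaginary_family:
  assumes "-19 * w\<^sup>2 = 4 * t + 9" "[w = 1] (mod 240)"
  shows "order_4_family t (-19) w 19" "t < -2" "[t = -7] (mod 30)"
proof -
  obtain j where "w - 1 = 240 * j" using assms(2) by (auto simp: cong_iff_dvd_diff elim: dvdE)
  hence w: "w = 240 * j + 1" by simp
  define i where "i = -19 * (240 * j\<^sup>2 + 2 * j)"
  have "4 * t = 4 * (60 * i - 7)"
    using assms(1) unfolding w i_def by (simp add: power2_eq_square algebra_simps)
  hence t: "t = 60 * i - 7" by simp
  have "w \<noteq> 0" using w by presburger
  hence "w\<^sup>2 > 0" by simp
  thus t2: "t < -2" using assms(1) by linarith
  have "t - (-7) = 30 * (2 * i)" unfolding t by simp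
  thus "[t = -7] (mod 30)" by (simp only: cong_iff_dvd_diff dvd_triv_left)
  have *: "t = 3 * (20 * i - 3) + 2" "t = 5 * (12 * i - 2) + 3" unfolding t by simp_all
  have m: "t mod 3 = 2" "t mod 5 = 3"
    using mod_mult_self4[of 3 "20 * i - 3" 2] mod_mult_self4[of 5 "12 * i - 2" 3]
    unfolding *[symmetric] by simp_all
  have "odd t" unfolding t by simp
  interpret c4_family t
    by unfold_locales (use m \<open>odd t\<close> coprime_family in auto)
  show "order_4_family t (-19) w 19"
    by unfold_locales (use assms(1) m t2 not_QuadRes_3 in auto)
qed

text \<open>For odd \<open>w\<close> and \<open>\<delta>\<close> congruent to 1 modulo 4,
  \<open>\<delta> * w\<^sup>2 - 9\<close> is divisible by 4, so every \<open>w\<close> in the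
  residue class yields a \<open>t\<close>, and an exact prime divisor of that number is one of
  \<open>4 * t\<close>.\<close>

lemma infinite_family:
  fixes \<delta> w0 :: int and P :: "complex set \<Rightarrow> bool"
  assumes \<delta>: "\<delta> mod 4 = 1" and w0: "odd w0"
    and fam: "\<And>t w. \<delta> * w\<^sup>2 = 4 * t + 9 \<Longrightarrow> [w = w0] (mod 240) \<Longrightarrow>
      c4_family t \<and> P (family_field t)"
  shows "infinite {K. P K}"
proof -
  define T where "T = {t. \<exists>w. \<delta> * w\<^sup>2 = 4 * t + 9 \<and> [w = w0] (mod 240)}"
  have "infinite (family_field ` T)"
  proof (rule infinite_family_fields)
    show "c4_family t" if "t \<in> T" for t using that fam by (auto simp: T_def)
    fix N :: int assume N: "N \<noteq> 0"
    have "\<delta> \<noteq> 0" using \<delta> by auto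
    from exists_exact_prime_divisor[OF this N, of w0] obtain w l where wl: "Factorial_Ring.prime l" "\<not> l dvd N" "\<not> l dvd 240" "[w = w0] (mod 240)"
        "l dvd \<delta> * w\<^sup>2 - 9" "\<not> l\<^sup>2 dvd \<delta> * w\<^sup>2 - 9"
      by (elim exE conjE) (rule that)
    have "240 dvd w - w0" using wl(4) by (simp add: cong_iff_dvd_diff)
    hence "even (w - w0)" by (rule dvd_trans[rotated]) simp
    hence "odd w" using w0 by simp
    hence "w\<^sup>2 mod 8 = 1" by (rule odd_square_mod_8)
    hence "w\<^sup>2 mod 4 = 1" by presburger
    hence "(\<delta> * w\<^sup>2) mod 4 = 1" using \<delta> mod_mult_eq[of \<delta> 4 "w\<^sup>2"] by simp
    hence "4 dvd \<delta> * w\<^sup>2 - 9" by presburger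
    then obtain t where t: "\<delta> * w\<^sup>2 - 9 = 4 * t" by blast
    hence "t \<in> T" using wl(4) unfolding T_def by (intro CollectI exI[of _ w]) simp
    thus "\<exists>t\<in>T. \<exists>l. Factorial_Ring.prime l \<and> \<not> l dvd N \<and> \<not> l dvd 240 \<and> l dvd 4 * t \<and> \<not> l\<^sup>2 dvd 4 * t"
      using wl unfolding t by blast
  qed
  moreover have "family_field ` T \<subseteq> {K. P K}" using fam by (auto simp: T_def)
  ultimately show ?thesis by (meson infinite_super)
qed

theorem theorem90:
  shows "infinite {K. real_quadratic_field K \<and>
           (\<exists>c \<in> carrier (ideal_class_group K). group.ord (ideal_class_group K) c = 4) \<and>
           (\<exists>t::int.
              ([t = -13] (mod 30) \<or> [t = -7] (mod 30) \<or> [t = 11] (mod 30)) \<and>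
              K = generate_field complex_field {csqrt (of_int (t * (t - 4) * (4 * t + 9)))} \<and>
              unramified_cyclic_extension_of_degree 4 K
                (splitting_field K [:1, -1, - of_int t, -1, 1:]))} \<and>
         infinite {K. imaginary_quadratic_field K \<and>
           (\<exists>c \<in> carrier (ideal_class_group K). group.ord (ideal_class_group K) c = 4) \<and>
           (\<exists>t::int.
              ([t = -13] (mod 30) \<or> [t = -7] (mod 30) \<or> [t = 11] (mod 30)) \<and>
              K = generate_field complex_field {csqrt (of_int (t * (t - 4) * (4 * t + 9)))} \<and>
              unramified_cyclic_extension_of_degree 4 K
                (splitting_field K [:1, -1, - of_int t, -1, 1:]))}"
proof
  show "infinite {K. real_quadratic_field K \<and>
           (\<exists>c \<in> carrier (ideal_class_group K). group.ord (ideal_class_group K) c = 4) \<and>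
           (\<exists>t::int.
              ([t = -13] (mod 30) \<or> [t = -7] (mod 30) \<or> [t = 11] (mod 30)) \<and>
              K = generate_field complex_field {csqrt (of_int (t * (t - 4) * (4 * t + 9)))} \<and>
              unramified_cyclic_extension_of_degree 4 K
                (splitting_field K [:1, -1, - of_int t, -1, 1:]))}"
  proof (rule infinite_family[of 29 13])
    fix t w :: int assume *: "29 * w\<^sup>2 = 4 * t + 9" "[w = 13] (mod 240)"
    interpret order_4_family t 29 w 29 by (rule real_family(1)[OF *])
    have t: "t > 4" "[t = -7] (mod 30)" by (rule real_family(2,3)[OF *])+
    have K: "family_field t = K" unfolding family_field_def by (rule generate_K)
    show "c4_family t \<and> real_quadratic_field (family_field t) \<and>
           (\<exists>c \<in> carrier (ideal_class_group (family_field t)). group.ord (ideal_class_group (family_field t)) c = 4) \<and>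
           (\<exists>t'::int.
              ([t' = -13] (mod 30) \<or> [t' = -7] (mod 30) \<or> [t' = 11] (mod 30)) \<and>
              family_field t = generate_field complex_field {csqrt (of_int (t' * (t' - 4) * (4 * t' + 9)))} \<and>
              unramified_cyclic_extension_of_degree 4 (family_field t)
                (splitting_field (family_field t) [:1, -1, - of_int t', -1, 1:]))"
      unfolding K using c4_family_axioms real_K[OF t(1)] class_of_order_4 generate_K
        unramified_cyclic[OF disjI1[OF t(1)]] t(2) by blast
  qed simp_all
  show "infinite {K. imaginary_quadratic_field K \<and>
           (\<exists>c \<in> carrier (ideal_class_group K). group.ord (ideal_class_group K) c = 4) \<and>
           (\<exists>t::int.
              ([t = -13] (mod 30) \<or> [t = -7] (mod 30) \<or> [t = 11] (mod 30)) \<and>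
              K = generate_field complex_field {csqrt (of_int (t * (t - 4) * (4 * t + 9)))} \<and>
              unramified_cyclic_extension_of_degree 4 K
                (splitting_field K [:1, -1, - of_int t, -1, 1:]))}"
  proof (rule infinite_family[of "-19" 1])
    fix t w :: int assume *: "-19 * w\<^sup>2 = 4 * t + 9" "[w = 1] (mod 240)"
    interpret order_4_family t "-19" w 19 by (rule imaginary_family(1)[OF *])
    have t: "t < -2" "[t = -7] (mod 30)" by (rule imaginary_family(2,3)[OF *])+
    have K: "family_field t = K" unfolding family_field_def by (rule generate_K)
    show "c4_family t \<and> imaginary_quadratic_field (family_field t) \<and>
           (\<exists>c \<in> carrier (ideal_class_group (family_field t)). group.ord (ideal_class_group (family_field t)) c = 4) \<and>
           (\<exists>t'::int.
              ([t' = -13] (mod 30) \<or> [t' = -7] (mod 30) \<or> [t' = 11] (mod 30)) \<and>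
              family_field t = generate_field complex_field {csqrt (of_int (t' * (t' - 4) * (4 * t' + 9)))} \<and>
              unramified_cyclic_extension_of_degree 4 (family_field t)
                (splitting_field (family_field t) [:1, -1, - of_int t', -1, 1:]))"
      unfolding K using c4_family_axioms imaginary_K[OF t(1)] class_of_order_4 generate_K
        unramified_cyclic[OF disjI2[OF t(1)]] t(2) by blast
  qed simp_all
qed

end
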